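(* Let $k\ge3$ and let $(q_m)_{m\ge1}$ be an increasing sequence of prime powers, $q_m=p_m^{e_m}$. For each $m$ let $S(k,q_m)=S(k,q_m;f_{3,m},g_{3,m},\ldots,f_{k,m},g_{k,m})$ with $g_{i,m}(0)=0$ for all $i$, and suppose $1\le d_f^{(m)}=o_m(q_m)$, $d_g^{(m)}=o_m(\sqrt{q_m})$ and $1\le d_g^{(m)}<p_m$ for all $m$. Let $\lambda^{(m)}$ be the largest eigenvalue of $S(k,q_m)$ different from $q_m(q_m-1)$. Then $\lambda^{(m)}=o_m(q_m^2)$.
   Context: For a prime power $q$, $k\ge3$, and $f_i,g_i\in\mathbb{F}_q[X]$ ($3\le i\le k$) of degree at most $q-1$ with $g_i(-X)=-g_i(X)$, $S(k,q;f_3,g_3,\ldots,f_k,g_k)$ is the simple graph on vertex set $\mathbb{F}_q^k$ in which $a$ and $b$ are adjacent iff $a_1\ne b_1$ and $b_i-a_i=g_i(b_1-a_1)f_i\!\left(\frac{b_2-a_2}{b_1-a_1}\right)$ for $3\le i\le k$; it is $q(q-1)$-regular. $d_f^{(m)}=\max_{3\le i\le k}\deg f_{i,m}$, $d_g^{(m)}=\max_{3\le i\le k}\deg g_{i,m}$. $f=o_m(g)$ means $f(m)/g(m)\to0$ as $m\to\infty$. Eigenvalues are those of the adjacency matrix. *)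

theory Defs
  imports "HOL-Algebra.Polynomials" "HOL-Computational_Algebra.Primes" Complex_Main
begin

definition S_vertices :: "('a, 'b) ring_scheme \<Rightarrow> nat \<Rightarrow> (nat \<Rightarrow> 'a) set" where
  "S_vertices R k = PiE {1..k} (\<lambda>_. carrier R)"

definition S_adj :: "('a, 'b) ring_scheme \<Rightarrow> nat \<Rightarrow> (nat \<Rightarrow> 'a list) \<Rightarrow> (nat \<Rightarrow> 'a list)
    \<Rightarrow> (nat \<Rightarrow> 'a) \<Rightarrow> (nat \<Rightarrow> 'a) \<Rightarrow> bool" where
  "S_adj R k f g a b \<longleftrightarrow> a 1 \<noteq> b 1 \<and>
     (\<forall>i\<in>{3..k}. b i \<ominus>\<^bsub>R\<^esub> a i =
        ring.eval R (g i) (b 1 \<ominus>\<^bsub>R\<^esub> a 1) \<otimes>\<^bsub>R\<^esub>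
        ring.eval R (f i) ((b 2 \<ominus>\<^bsub>R\<^esub> a 2) \<otimes>\<^bsub>R\<^esub> inv\<^bsub>R\<^esub> (b 1 \<ominus>\<^bsub>R\<^esub> a 1)))"

definition adj_eigenvalue :: "'v set \<Rightarrow> ('v \<Rightarrow> 'v \<Rightarrow> bool) \<Rightarrow> real \<Rightarrow> bool" where
  "adj_eigenvalue V E mu \<longleftrightarrow>
     (\<exists>v :: 'v \<Rightarrow> real. (\<exists>x\<in>V. v x \<noteq> 0) \<and>
        (\<forall>a\<in>V. (\<Sum>b\<in>V. (if E a b then 1 else 0) * v b) = mu * v a))"

end

theory Submission
  imports Defs
    "HOL-Computational_Algebra.Fundamental_Theorem_Algebra"
    "HOL-Computational_Algebra.Formal_Power_Series"
begin

text \<open>The graph is a Cayley graph of \<open>F_q^k\<close>, so its eigenvalues are the sums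
  \<open>\<Sum>_{x \<noteq> 0, y} \<psi>(P_y(x))\<close> with \<open>P_y(X) = (w_1 + w_2 y) X + \<Sum>_i w_i f_i(y) g_i(X)\<close>. The
  coefficients of \<open>P_y\<close> are polynomials of degree at most \<open>d_f\<close> in \<open>y\<close>, so unless the eigenvalue is
  \<open>q(q-1)\<close> at most \<open>d_f\<close> of the \<open>P_y\<close> vanish; for the others Weil's bound gives an inner sum of
  order \<open>d_g \<surd>q\<close>. In the other direction \<open>-q\<close> is always an eigenvalue.

  Weil's bound is proved as follows. Since the degree is below the characteristic, the L-function of
  \<open>\<psi> \<circ> P\<close> is a polynomial of degree less than \<open>deg P\<close>, and its inverse roots have absolute value at
  most \<open>\<surd>q\<close> as soon as its power sums \<open>S_n\<close> are \<open>O(q^{n/2})\<close>. The latter is Bombieri's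
  version of Stepanov's argument on \<open>y^q - y = P(x)\<close>, carried out modulo the product \<open>h\<close> of all
  irreducible polynomials of degree dividing \<open>n\<close> on which the trace of \<open>P\<close> takes a given value:
  a pigeonhole argument yields a function of small pole order that is divisible by \<open>h\<close>.\<close>

section \<open>Polynomials over a finite field inside a ring\<close>

text \<open>Weil's bound is needed over every \<open>F_q\<close> and for sums over all its
  extensions, but no extension field is constructed. A point of \<open>F_(q^n)\<close> is
  represented by its minimal polynomial, an element of \<open>Irr\<close> of degree dividing n, and
  the trace of P at that point by Newton power sums of the coefficients. These are additive under
  multiplication of polynomials, so the character extends to all monic polynomials. The pigeonhole
  argument bounds the number of points only from above, for each trace value separately. Since the
  classes of all q values together contain exactly q^n points, the upper bounds imply lower ones.
  Any constant in the estimate O(q^(n/2)) will do, because only the radius of convergence of the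
  logarithmic derivative matters; this leaves room for the crude quantity d q where sharp counts
  would use the genus. The condition d < p enters twice: d is invertible in the field, which makes
  the L-function a polynomial, and d is coprime to q, which makes the pole orders of the reduced
  monomials x^i y^j distinct.\<close>

text \<open>No type-class instance can serve for a family of finite fields of varying characteristic. The
  fields are therefore realised inside one commutative ring, each as the set of elements fixed
  by multiplication with an idempotent \<open>e\<close>, which is then the unit of the field; note that
  \<open>x ^ 0 = 1\<close> lies outside it.\<close>

definition corner :: "'c::comm_ring_1 \<Rightarrow> 'c set" where
  "corner e = {a. e * a = a}"

lemma corner_mult_id: "a \<in> corner e \<Longrightarrow> e * a = a"
  by (simp add: corner_def)

lemma corner_zero [simp]: "0 \<in> corner e"
  and corner_add: "a \<in> corner e \<Longrightarrow> b \<in> corner e \<Longrightarrow> a + b \<in> corner e"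
  and corner_diff: "a \<in> corner e \<Longrightarrow> b \<in> corner e \<Longrightarrow> a - b \<in> corner e"
  and corner_uminus: "a \<in> corner e \<Longrightarrow> - a \<in> corner e"
  and corner_mult: "a \<in> corner e \<Longrightarrow> a * x \<in> corner e"
  and corner_mult2: "a \<in> corner e \<Longrightarrow> x * a \<in> corner e"
  by (simp_all add: corner_def algebra_simps) (metis mult.assoc mult.commute)+

lemma corner_sum: "(\<And>i. i \<in> I \<Longrightarrow> f i \<in> corner e) \<Longrightarrow> sum f I \<in> corner e"
  by (induction I rule: infinite_finite_induct) (auto intro: corner_add)

lemma corner_power: "a \<in> corner e \<Longrightarrow> n > 0 \<Longrightarrow> a ^ n \<in> corner e"
  by (cases n) (auto intro: corner_mult)

lemma corner_poly_iff: "u \<in> corner [:e:] \<longleftrightarrow> (\<forall>i. coeff u i \<in> corner e)"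
  by (auto simp: corner_def poly_eq_iff)

text \<open>The characteristic is imposed on \<open>e\<close> alone: the ambient ring contains
  fields of different characteristics, so \<open>of_nat p\<close> need not vanish there. Inverses
  are likewise taken relative to \<open>e\<close>.\<close>

locale finite_field_component =
  fixes e :: "'b::comm_ring_1" and p k :: nat
  assumes idem: "e * e = e" and e_nz: "e \<noteq> 0"
    and K_fin: "finite (corner e)"
    and K_inv: "\<And>a. a \<in> corner e \<Longrightarrow> a \<noteq> 0 \<Longrightarrow> \<exists>b\<in>corner e. a * b = e"
    and p_prime: "prime p" and p_char: "of_nat p * e = 0"
    and k_pos: "k > 0" and K_card: "card (corner e) = p ^ k"
begin

abbreviation "K \<equiv> corner e"
abbreviation "q \<equiv> p ^ k"
abbreviation "KP \<equiv> corner [:e:]"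

lemma e_K [simp]: "e \<in> K" by (simp add: corner_def idem)

lemma E_KP [simp]: "[:e:] \<in> KP" by (simp add: corner_def idem)

lemma q_gt1: "q > 1"
  by (rule one_less_power[OF prime_gt_1_nat[OF p_prime] k_pos])

lemma KP_coeff: "u \<in> KP \<Longrightarrow> coeff u i \<in> K"
  by (simp add: corner_poly_iff)

lemma K_eq: "a \<in> K \<Longrightarrow> e * a = a" "a \<in> K \<Longrightarrow> a * e = a"
  by (auto simp: corner_def mult.commute)

lemma KP_eq: "u \<in> KP \<Longrightarrow> [:e:] * u = u" "u \<in> KP \<Longrightarrow> u * [:e:] = u" "u \<in> KP \<Longrightarrow> smult e u = u"
  by (auto simp: corner_def mult.commute)

lemma K_integral: "a \<in> K \<Longrightarrow> b \<in> K \<Longrightarrow> a * b = 0 \<Longrightarrow> a = 0 \<or> b = 0"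
proof (rule ccontr)
  assume a: "a \<in> K" "b \<in> K" "a * b = 0" "\<not> (a = 0 \<or> b = 0)"
  then obtain c where "a * c = e" using K_inv by blast
  have "c * (a * b) = (a * c) * b" by (simp add: ac_simps)
  also have "\<dots> = b" using \<open>a * c = e\<close> K_eq(1)[OF a(2)] by simp
  finally have "b = c * (a * b)" ..
  thus False using a by simp
qed

text \<open>A cofactor in the ambient ring may leave \<open>KP\<close>; multiplying it by the
  idempotent brings it back. Hence ambient \<open>dvd\<close> can serve as divisibility over
  \<open>K\<close>.\<close>

lemma KP_dvdE:
  assumes "a dvd b" "b \<in> KP"
  obtains c where "c \<in> KP" "b = a * c"
proof -
  obtain c where c: "b = a * c" using assms(1) by (auto elim: dvdE)
  have "b = a * ([:e:] * c)" using KP_eq(1)[OF assms(2)] c by (metis mult.left_commute)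
  moreover have "[:e:] * c \<in> KP" by (intro corner_mult E_KP)
  ultimately show ?thesis using that by blast
qed

text \<open>The ambient polynomial ring has zero divisors, so degrees add only because leading
  coefficients lie in the field \<open>K\<close>.\<close>

lemma KP_lead_mult:
  assumes "u \<in> KP" "v \<in> KP" "u \<noteq> 0" "v \<noteq> 0"
  shows "lead_coeff u * lead_coeff v \<noteq> 0" "degree (u * v) = degree u + degree v" "u * v \<noteq> 0"
proof -
  show *: "lead_coeff u * lead_coeff v \<noteq> 0"
    using K_integral[OF KP_coeff[OF assms(1)] KP_coeff[OF assms(2)], of "degree u" "degree v"] assms by auto
  show "degree (u * v) = degree u + degree v"
    by (rule antisym[OF degree_mult_le le_degree]) (use * in \<open>simp add: coeff_mult_degree_sum\<close>)
  show "u * v \<noteq> 0" using * coeff_mult_degree_sum[of u v] by (metis coeff_0)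
qed

lemma KP_cancel:
  assumes "h \<in> KP" "h \<noteq> 0" "u \<in> KP" "v \<in> KP" "h * u = h * v"
  shows "u = v"
proof (rule ccontr)
  assume "u \<noteq> v"
  hence "h * (u - v) \<noteq> 0" using KP_lead_mult(3)[OF assms(1) _ assms(2)] corner_diff[OF assms(3,4)] by auto
  thus False using assms(5) by (simp add: algebra_simps)
qed

text \<open>These are the residues modulo a monic polynomial of degree \<open>n\<close>. Stating the
  bound by coefficients instead of \<open>degree\<close> keeps the zero polynomial in the set also
  for \<open>n = 0\<close>.\<close>

definition KPlt :: "nat \<Rightarrow> 'b poly set" where
  "KPlt n = {u \<in> KP. \<forall>i\<ge>n. coeff u i = 0}"

definition monics :: "nat \<Rightarrow> 'b poly set" where
  "monics n = {h \<in> KP. degree h = n \<and> coeff h n = e}"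

lemma monics_KP: "h \<in> monics n \<Longrightarrow> h \<in> KP"
  and monics_degree: "h \<in> monics n \<Longrightarrow> degree h = n"
  and monics_coeff: "h \<in> monics n \<Longrightarrow> coeff h n = e"
  and monics_nz: "h \<in> monics n \<Longrightarrow> h \<noteq> 0"
  using e_nz by (auto simp: monics_def)

lemma monics_0 [simp]: "monics 0 = {[:e:]}"
  using e_nz by (auto simp: monics_def elim!: degree_eq_zeroE)

lemma pCons_KP: "pCons c u \<in> KP \<longleftrightarrow> c \<in> K \<and> u \<in> KP"
  by (auto simp: corner_poly_iff coeff_pCons split: nat.splits)

lemma KPlt_0 [simp]: "KPlt 0 = {0}"
  by (auto simp: KPlt_def poly_eq_iff)

lemma KPlt_Suc: "KPlt (Suc n) = (\<lambda>(c, u). pCons c u) ` (K \<times> KPlt n)"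
proof (intro equalityI subsetI)
  fix u assume u: "u \<in> KPlt (Suc n)"
  obtain c v where cv: "u = pCons c v" by (cases u)
  have "coeff v i = 0" if "i \<ge> n" for i
    using u cv that unfolding KPlt_def by (auto dest: spec[of _ "Suc i"])
  thus "u \<in> (\<lambda>(c, u). pCons c u) ` (K \<times> KPlt n)"
    using u cv by (auto simp: KPlt_def pCons_KP)
qed (auto simp: KPlt_def pCons_KP coeff_pCons split: nat.splits)

lemma KPlt_card: "finite (KPlt n) \<and> card (KPlt n) = q ^ n"
proof (induction n)
  case (Suc n)
  have "inj_on (\<lambda>(c, u). pCons c u) (K \<times> KPlt n)" by (auto simp: inj_on_def)
  then show ?case using Suc K_fin K_card
    by (simp add: KPlt_Suc card_image card_cartesian_product)
qed auto

lemma monom_KP [simp]: "c \<in> K \<Longrightarrow> monom c n \<in> KP"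
  by (auto simp: corner_poly_iff coeff_monom)

lemma monics_eq: "monics n = (\<lambda>u. u + monom e n) ` KPlt n"
proof (intro equalityI subsetI)
  fix h assume h: "h \<in> monics n"
  have "coeff (h - monom e n) i = 0" if "i \<ge> n" for i
    using h that by (cases "i = n") (auto simp: monics_def coeff_eq_0)
  moreover have "h - monom e n \<in> KP" using monics_KP[OF h] by (intro corner_diff monom_KP) auto
  ultimately show "h \<in> (\<lambda>u. u + monom e n) ` KPlt n"
    by (intro image_eqI[of _ _ "h - monom e n"]) (auto simp: KPlt_def)
next
  fix h assume "h \<in> (\<lambda>u. u + monom e n) ` KPlt n"
  then obtain u where u: "u \<in> KPlt n" "h = u + monom e n" by auto
  have 1: "coeff h n = e" using u by (auto simp: KPlt_def)
  have "degree h \<le> n" by (rule degree_le) (use u in \<open>auto simp: KPlt_def\<close>)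
  moreover have "degree h \<ge> n" by (rule le_degree) (use 1 e_nz in auto)
  moreover have "h \<in> KP" using u by (auto simp: KPlt_def intro!: corner_add)
  ultimately show "h \<in> monics n" using 1 by (auto simp: monics_def)
qed

lemma monics_card: "finite (monics n)" "card (monics n) = q ^ n"
proof -
  have "inj_on (\<lambda>u. u + monom e n) (KPlt n)" by (auto simp: inj_on_def)
  thus "finite (monics n)" "card (monics n) = q ^ n"
    using KPlt_card[of n] by (auto simp: monics_eq card_image)
qed

lemma monics_mult: "a \<in> monics i \<Longrightarrow> b \<in> monics j \<Longrightarrow> a * b \<in> monics (i + j)"
proof -
  assume a: "a \<in> monics i" and b: "b \<in> monics j"
  have "degree (a * b) = i + j"
    using KP_lead_mult(2)[OF monics_KP monics_KP monics_nz monics_nz, OF a b a b] a b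
    by (simp add: monics_degree)
  moreover have "coeff (a * b) (i + j) = e"
    using coeff_mult_degree_sum[of a b] a b by (auto simp: monics_def idem)
  ultimately show "a * b \<in> monics (i + j)"
    using corner_mult[OF monics_KP[OF a]] by (simp add: monics_def)
qed

lemma monics_power: "a \<in> monics i \<Longrightarrow> n > 0 \<Longrightarrow> a ^ n \<in> monics (n * i)"
proof (induction n)
  case (Suc n)
  then show ?case by (cases "n = 0") (auto intro!: monics_mult)
qed auto

lemma monics_quot:
  assumes "a \<in> monics i" "b \<in> monics n" "a dvd b"
  obtains c where "c \<in> monics (n - i)" "b = a * c" "i \<le> n"
proof -
  obtain c where c: "c \<in> KP" "b = a * c" using KP_dvdE[OF assms(3) monics_KP[OF assms(2)]] .
  have nz: "c \<noteq> 0" using c monics_nz[OF assms(2)] by auto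
  have d: "n = i + degree c"
    using KP_lead_mult(2)[OF monics_KP[OF assms(1)] c(1) monics_nz[OF assms(1)] nz] c assms
    by (auto simp: monics_def)
  have "coeff b n = e * coeff c (degree c)"
    using coeff_mult_degree_sum[of a c] c(2) d assms(1) by (auto simp: monics_def)
  hence "coeff c (degree c) = e"
    using monics_coeff[OF assms(2)] K_eq(1)[OF KP_coeff[OF c(1)]] by simp
  thus ?thesis using that[of c] c d by (auto simp: monics_def)
qed

lemma KP_division:
  assumes "h \<in> monics n" "v \<in> KP"
  shows "\<exists>w\<in>KP. \<exists>r\<in>KPlt n. v = w * h + r"
  using assms(2)
proof (induction v)
  case 0
  show ?case by (rule bexI[of _ 0], rule bexI[of _ 0]) (auto simp: KPlt_def)
next
  case (pCons c v)
  then obtain w r where wr: "w \<in> KP" "r \<in> KPlt n" "v = w * h + r" and c: "c \<in> K" by (auto simp: pCons_KP)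
  define t where "t = coeff (pCons c r) n"
  have prk: "pCons c r \<in> KPlt (Suc n)" using wr c by (auto simp: KPlt_Suc)
  have t: "t \<in> K" using prk by (auto simp: t_def KPlt_def KP_coeff)
  have "pCons c r - smult t h \<in> KPlt n"
  proof -
    have "coeff (pCons c r - smult t h) i = 0" if "i \<ge> n" for i
      using that prk assms(1) t
      by (cases "i = n") (auto simp: t_def[symmetric] monics_def K_eq KPlt_def coeff_eq_0)
    moreover have "pCons c r - smult t h \<in> KP"
      using prk monics_KP[OF assms(1)] corner_mult2[of h "[:e:]" "[:t:]"]
      by (intro corner_diff) (auto simp: KPlt_def)
    ultimately show ?thesis by (auto simp: KPlt_def)
  qed
  moreover have "pCons t w \<in> KP" using t wr by (auto simp: pCons_KP)
  moreover have "pCons c v = pCons t w * h + (pCons c r - smult t h)"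
    using wr(3) by (simp add: algebra_simps)
  ultimately show ?case by blast
qed

lemma KP_normalise:
  assumes "u \<in> KP" "u \<noteq> 0"
  obtains c where "c \<in> K" "smult c u \<in> monics (degree u)"
proof -
  obtain c where c: "c \<in> K" "lead_coeff u * c = e"
    using K_inv[OF KP_coeff[OF assms(1)], of "degree u"] assms(2) by auto
  have 1: "coeff (smult c u) (degree u) = e" using c by (simp add: mult.commute)
  have "degree (smult c u) = degree u"
    by (rule antisym[OF degree_smult_le le_degree]) (use 1 e_nz in auto)
  moreover have "smult c u \<in> KP" using corner_mult2[OF assms(1), of "[:c:]"] by simp
  ultimately show ?thesis using that c 1 by (auto simp: monics_def)
qed

text \<open>The ambient notion of irreducibility does not fit: it refers to units of the ambient
  ring, and \<open>[:e:]\<close> need not be one. Restricting to monic factors replaces units by the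
  condition of degree 0.\<close>

definition Irr :: "'b poly set" where
  "Irr = {f. \<exists>n>0. f \<in> monics n \<and>
           (\<forall>i j. \<forall>a\<in>monics i. \<forall>b\<in>monics j. f = a * b \<longrightarrow> i = 0 \<or> j = 0)}"

lemma Irr_factor:
  assumes "f \<in> Irr" "a \<in> monics i" "b \<in> monics j" "f = a * b"
  shows "i = 0 \<or> j = 0"
proof -
  have "\<forall>i j. \<forall>a\<in>monics i. \<forall>b\<in>monics j. f = a * b \<longrightarrow> i = 0 \<or> j = 0"
    using assms(1) unfolding Irr_def mem_Collect_eq by (elim exE conjE)
  from this[THEN spec, THEN spec, THEN bspec, OF assms(2), THEN bspec, OF assms(3), THEN mp, OF assms(4)]
  show ?thesis .
qed

lemma Irr_monics: "f \<in> Irr \<Longrightarrow> f \<in> monics (degree f)"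
  and Irr_degree: "f \<in> Irr \<Longrightarrow> degree f > 0"
  by (auto simp: Irr_def monics_degree)

lemma Irr_KP: "f \<in> Irr \<Longrightarrow> f \<in> KP"
  using Irr_monics monics_KP by blast

lemma Irr_nz: "f \<in> Irr \<Longrightarrow> f \<noteq> 0"
  using Irr_degree by fastforce

lemma Irr_dvd_cases:
  assumes "f \<in> Irr" "a \<in> monics i" "a dvd f"
  shows "a = [:e:] \<or> a = f"
proof -
  obtain c where c: "c \<in> monics (degree f - i)" "f = a * c"
    using monics_quot[OF assms(2) Irr_monics[OF assms(1)] assms(3)] by blast
  have "i = 0 \<or> degree f - i = 0"
    using Irr_factor[OF assms(1,2) c] .
  thus ?thesis
  proof
    assume "i = 0" then show ?thesis using assms(2) by simp
  next
    assume "degree f - i = 0"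
    then have "c = [:e:]" using c by simp
    then show ?thesis using c KP_eq(2)[OF monics_KP[OF assms(2)]] by simp
  qed
qed

text \<open>Bezout argument: a monic element \<open>g\<close> of least degree in the ideal generated
  by \<open>a\<close> and \<open>f\<close> divides both. Irreducibility leaves \<open>g = f\<close>,
  so that \<open>f\<close> divides \<open>a\<close>, or \<open>g = [:e:]\<close>, and then
  multiplying the Bezout relation by \<open>b\<close> shows that \<open>f\<close> divides
  \<open>b\<close>.\<close>

lemma Irr_prime:
  assumes f: "f \<in> Irr" and a: "a \<in> KP" and b: "b \<in> KP" and ab: "f dvd a * b"
  shows "f dvd a \<or> f dvd b"
proof (rule ccontr)
  assume neg: "\<not> (f dvd a \<or> f dvd b)"
  define I where "I = {u * a + v * f | u v. u \<in> KP \<and> v \<in> KP}"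
  have I_KP: "x \<in> KP" if "x \<in> I" for x
    using that a Irr_KP[OF f] by (auto simp: I_def intro!: corner_add corner_mult)
  have I_lin: "x - w * y \<in> I" if xy: "x \<in> I" "y \<in> I" for x y w
  proof -
    obtain u v where x: "x = u * a + v * f" "u \<in> KP" "v \<in> KP" using xy(1) unfolding I_def by blast
    obtain u' v' where y: "y = u' * a + v' * f" "u' \<in> KP" "v' \<in> KP" using xy(2) unfolding I_def by blast
    have "x - w * y = (u - w * u') * a + (v - w * v') * f" using x y by (simp add: algebra_simps)
    thus ?thesis unfolding I_def using x y by (blast intro: corner_diff corner_mult2)
  qed
  have aI: "a \<in> I" unfolding I_def using KP_eq(1)[OF a]
    by (intro CollectI exI[of _ "[:e:]"] exI[of _ 0]) auto
  have fI: "f \<in> I" unfolding I_def using KP_eq(1)[OF Irr_KP[OF f]]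
    by (intro CollectI exI[of _ "[:e:]"] exI[of _ 0]) auto
  define m where "m = (LEAST m. \<exists>g\<in>monics m. g \<in> I)"
  have ex: "\<exists>m. \<exists>g\<in>monics m. g \<in> I" using fI Irr_monics[OF f] by blast
  obtain g where g: "g \<in> monics m" "g \<in> I" using LeastI_ex[OF ex] unfolding m_def by blast
  have dv: "g dvd x" if x: "x \<in> I" for x
  proof -
    obtain w r where wr: "w \<in> KP" "r \<in> KPlt m" "x = w * g + r"
      using KP_division[OF g(1) I_KP[OF x]] by blast
    have rI: "r \<in> I" using I_lin[OF x g(2), of w] wr(3) by simp
    have "r = 0"
    proof (rule ccontr)
      assume "r \<noteq> 0"
      then obtain c where c: "smult c r \<in> monics (degree r)" using KP_normalise I_KP[OF rI] by blast
      \<comment> \<open>Scaling by \<open>c\<close> is obtained from \<open>I_lin\<close> alone: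
        \<open>r - r\<close>, and then minus \<open>[:-c:]\<close> times \<open>r\<close>.\<close>
      have "smult c r \<in> I" using I_lin[OF I_lin[OF rI rI, of 1] rI, of "[:-c:]"] by simp
      hence "m \<le> degree r" unfolding m_def using c by (intro Least_le) blast
      moreover have "coeff r (degree r) \<noteq> 0" using \<open>r \<noteq> 0\<close> by simp
      ultimately show False using wr(2) by (auto simp: KPlt_def)
    qed
    thus ?thesis using wr by simp
  qed
  from Irr_dvd_cases[OF f g(1) dv[OF fI]] show False
  proof
    assume "g = f" thus False using dv[OF aI] neg by simp
  next
    assume "g = [:e:]"
    then obtain u v where uv: "[:e:] = u * a + v * f" using g by (auto simp: I_def)
    have "b = (u * a + v * f) * b" using KP_eq(1)[OF b] uv by simp
    also have "\<dots> = u * (a * b) + f * (v * b)" by (simp add: algebra_simps)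
    finally have "f dvd b" using ab by (metis dvd_add dvd_mult dvd_triv_left)
    thus False using neg by simp
  qed
qed

lemma Irr_prime_power:
  assumes f: "f \<in> Irr" and g: "g \<in> Irr" and "f \<noteq> g" and h: "h \<in> KP" "f ^ n dvd g * h"
  shows "f ^ n dvd h"
  using h
proof (induction n arbitrary: h)
  case (Suc n)
  have fnz: "f \<noteq> 0" "f \<in> KP" using f Irr_nz Irr_KP by auto
  have "f dvd g * h" using Suc.prems(2) by (metis dvd_mult_left power_Suc)
  hence "f dvd g \<or> f dvd h" by (rule Irr_prime[OF f Irr_KP[OF g] Suc.prems(1)])
  moreover have "\<not> f dvd g"
    using Irr_dvd_cases[OF g Irr_monics[OF f]] \<open>f \<noteq> g\<close> Irr_degree[OF f] by auto
  ultimately have "f dvd h" by blast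
  then obtain c where c: "c \<in> KP" "h = f * c" using KP_dvdE Suc.prems(1) by blast
  have gh: "g * h \<in> KP" using Suc.prems(1) by (rule corner_mult2)
  obtain d where d: "d \<in> KP" "g * h = f ^ Suc n * d" using KP_dvdE[OF Suc.prems(2) gh] .
  have "f * (g * c) = f * (f ^ n * d)" using d c by (simp add: ac_simps)
  hence "g * c = f ^ n * d" using KP_cancel fnz c d by (meson corner_mult2)
  hence "f ^ n dvd c" using Suc.IH[OF c(1)] by simp
  thus ?case using c by (simp add: mult_dvd_mono)
qed auto

lemma Irr_divisor_exists:
  assumes "h \<in> monics n" "n > 0"
  shows "\<exists>f\<in>Irr. f dvd h"
  using assms
proof (induction n arbitrary: h rule: less_induct)
  case (less n)
  show ?case
  proof (cases "h \<in> Irr")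
    case False
    have "\<exists>i j. \<exists>a\<in>monics i. \<exists>b\<in>monics j. h = a * b \<and> i > 0 \<and> j > 0"
    proof (rule ccontr)
      assume neg: "\<not> ?thesis"
      have "i = 0 \<or> j = 0" if A: "a \<in> monics i" "b \<in> monics j" "h = a * b" for i j a b
      proof (rule ccontr)
        assume "\<not> (i = 0 \<or> j = 0)"
        hence "h = a * b \<and> i > 0 \<and> j > 0" using A(3) by simp
        with A(1,2) have "\<exists>i j. \<exists>a\<in>monics i. \<exists>b\<in>monics j. h = a * b \<and> i > 0 \<and> j > 0"
          by (intro exI bexI)
        with neg show False by (rule notE)
      qed
      hence "h \<in> Irr" unfolding Irr_def
        by (intro CollectI exI[of _ n] conjI allI ballI impI less.prems)
      thus False using False by (rule notE[rotated])
    qed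
    then obtain i j a b where ab: "a \<in> monics i" "b \<in> monics j" "h = a * b" "i > 0" "j > 0"
      by (elim exE bexE conjE)
    have "n = i + j" using monics_degree[OF monics_mult[OF ab(1,2)]] monics_degree[OF less.prems(1)] ab(3) by simp
    hence "i < n" using ab(5) by simp
    from less.IH[OF this ab(1,4)] obtain f where f: "f \<in> Irr" "f dvd a" ..
    show ?thesis unfolding ab(3) using dvd_mult2[OF f(2)] f(1) by (rule bexI)
  next
    case True
    show ?thesis by (rule bexI[OF dvd_refl True])
  qed
qed

text \<open>The exponents counted form an initial segment, so this is the f-adic valuation of
  \<open>h\<close>. As a cardinality it turns into a sum of indicators over \<open>i\<close>, which
  is the form used in the recurrence for the L-series.\<close>

definition irr_mult :: "'b poly \<Rightarrow> 'b poly \<Rightarrow> nat" where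
  "irr_mult f h = card {i. i > 0 \<and> f ^ i dvd h}"

lemma Irr_power_dvd_le:
  assumes "f \<in> Irr" "h \<in> monics n" "i > 0" "f ^ i dvd h"
  shows "i * degree f \<le> n" "i \<le> n"
proof -
  show 1: "i * degree f \<le> n"
    using monics_quot[OF monics_power[OF Irr_monics[OF assms(1)] assms(3)] assms(2,4)] by blast
  have "i * 1 \<le> i * degree f" using Irr_degree[OF assms(1)] by (intro mult_le_mono) auto
  thus "i \<le> n" using 1 by linarith
qed

lemma finite_irr_mult: "f \<in> Irr \<Longrightarrow> h \<in> monics n \<Longrightarrow> finite {i. i > 0 \<and> f ^ i dvd h}"
  by (rule finite_subset[of _ "{..n}"]) (auto dest: Irr_power_dvd_le(2))

lemma irr_mult_same:
  assumes f: "f \<in> Irr" and h: "h \<in> monics n"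
  shows "irr_mult f (f * h) = Suc (irr_mult f h)"
proof -
  have *: "f ^ Suc i dvd f * h \<longleftrightarrow> f ^ i dvd h" for i
  proof
    assume "f ^ Suc i dvd f * h"
    then obtain d where d: "d \<in> KP" "f * h = f ^ Suc i * d"
      using KP_dvdE corner_mult2[OF monics_KP[OF h]] by metis
    hence "f * h = f * (f ^ i * d)" by (simp add: ac_simps)
    hence "h = f ^ i * d" using KP_cancel[OF Irr_KP[OF f] Irr_nz[OF f]] monics_KP[OF h] d
      by (meson corner_mult2)
    thus "f ^ i dvd h" by simp
  qed (simp add: mult_dvd_mono)
  have "card {i. i > 0 \<and> f ^ i dvd f * h} = card (Suc ` {i. f ^ i dvd h})"
    using * by (intro arg_cong[of _ _ card]) (auto simp: image_iff gr0_conv_Suc simp del: power_Suc)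
  also have "\<dots> = card {i. f ^ i dvd h}" by (simp add: card_image)
  also have "{i. f ^ i dvd h} = insert 0 {i. i > 0 \<and> f ^ i dvd h}" by auto
  finally show ?thesis
    using finite_irr_mult[OF f h] by (simp add: irr_mult_def)
qed

lemma irr_mult_other:
  assumes "f \<in> Irr" "g \<in> Irr" "f \<noteq> g" "h \<in> KP"
  shows "irr_mult f (g * h) = irr_mult f h"
  using Irr_prime_power[OF assms] by (auto simp: irr_mult_def intro!: arg_cong[of _ _ card])

lemma finite_Irr_le: "finite {f \<in> Irr. degree f \<le> N}"
  by (rule finite_subset[of _ "\<Union>n\<in>{..N}. monics n"]) (use monics_card Irr_monics in auto)

text \<open>Unique factorisation enters in this form. Splitting off one irreducible divisor
  \<open>g\<close> raises the multiplicity of \<open>g\<close> by one and leaves all others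
  unchanged.\<close>

lemma degree_eq_sum_irr_mult:
  assumes "h \<in> monics n" "n \<le> N"
  shows "(\<Sum>f | f \<in> Irr \<and> degree f \<le> N. degree f * irr_mult f h) = n"
  using assms
proof (induction n arbitrary: h rule: less_induct)
  case (less n)
  show ?case
  proof (cases "n = 0")
    case True
    have "irr_mult f h = 0" if "f \<in> Irr" for f
    proof -
      have "{i. i > 0 \<and> f ^ i dvd h} = {}"
        using Irr_power_dvd_le(2)[OF that less.prems(1)] True by auto
      thus ?thesis by (simp only: irr_mult_def card.empty)
    qed
    thus ?thesis using True by simp
  next
    case False
    then obtain g where g: "g \<in> Irr" "g dvd h" using Irr_divisor_exists less.prems by blast
    obtain c where c: "c \<in> monics (n - degree g)" "h = g * c" "degree g \<le> n"
      using monics_quot[OF Irr_monics[OF g(1)] less.prems(1) g(2)] .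
    have IH: "(\<Sum>f | f \<in> Irr \<and> degree f \<le> N. degree f * irr_mult f c) = n - degree g"
      using less.IH[OF _ c(1)] False Irr_degree[OF g(1)] less.prems by auto
    have "(\<Sum>f | f \<in> Irr \<and> degree f \<le> N. degree f * irr_mult f h)
        = (\<Sum>f | f \<in> Irr \<and> degree f \<le> N. degree f * irr_mult f c + (if f = g then degree g else 0))"
      using irr_mult_same[OF g(1) c(1)] irr_mult_other[OF _ g(1) _ monics_KP[OF c(1)]] c(2)
      by (intro sum.cong) auto
    also have "\<dots> = (n - degree g) + degree g"
      using IH finite_Irr_le[of N] g(1) c(3) less.prems by (simp add: sum.distrib sum.delta)
    finally show ?thesis using c by simp
  qed
qed

section \<open>L-series of completely multiplicative functions on monic polynomials\<close>

definition mult_char :: "('b poly \<Rightarrow> complex) \<Rightarrow> bool" where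
  "mult_char \<chi> \<longleftrightarrow> (\<forall>i j. \<forall>a\<in>monics i. \<forall>b\<in>monics j. \<chi> (a * b) = \<chi> a * \<chi> b)"

text \<open>The coefficient of t^n in the series of \<chi>(h) t^(deg h) over all monic h.\<close>

definition Lcoeff :: "('b poly \<Rightarrow> complex) \<Rightarrow> nat \<Rightarrow> complex" where
  "Lcoeff \<chi> n = (\<Sum>h\<in>monics n. \<chi> h)"

text \<open>The coefficient of t^n in t L'/L. For a trace character it is the character sum over
  \<open>F_(q^n)\<close>: an irreducible f of degree dividing n stands for its deg f roots.\<close>

definition Lsum :: "('b poly \<Rightarrow> complex) \<Rightarrow> nat \<Rightarrow> complex" where
  "Lsum \<chi> n = (\<Sum>f | f \<in> Irr \<and> degree f dvd n. of_nat (degree f) * \<chi> f ^ (n div degree f))"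

lemma mult_char_power:
  assumes "mult_char \<chi>" "a \<in> monics i" "n > 0"
  shows "\<chi> (a ^ n) = \<chi> a ^ n"
  using assms(3)
proof (induction n)
  case (Suc n)
  show ?case
  proof (cases "n = 0")
    case False
    hence "a ^ n \<in> monics (n * i)" using monics_power assms(2) by blast
    thus ?thesis using Suc False assms by (auto simp: mult_char_def)
  qed auto
qed auto

lemma sum_power_dvd:
  assumes \<chi>: "mult_char \<chi>" and f: "f \<in> Irr" and i: "i > 0"
  shows "(\<Sum>h\<in>monics n. if f ^ i dvd h then \<chi> h else 0)
       = (if i * degree f \<le> n then \<chi> f ^ i * Lcoeff \<chi> (n - i * degree f) else 0)"
proof (cases "i * degree f \<le> n")
  case True
  have fi: "f ^ i \<in> monics (i * degree f)" using monics_power[OF Irr_monics[OF f] i] .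
  have eq: "{h\<in>monics n. f ^ i dvd h} = (\<lambda>h. f ^ i * h) ` monics (n - i * degree f)"
  proof (intro equalityI subsetI)
    fix h assume "h \<in> {h\<in>monics n. f ^ i dvd h}"
    thus "h \<in> (\<lambda>h. f ^ i * h) ` monics (n - i * degree f)"
      using monics_quot[OF fi] by (metis (mono_tags, lifting) image_eqI mem_Collect_eq)
  next
    fix h assume "h \<in> (\<lambda>h. f ^ i * h) ` monics (n - i * degree f)"
    thus "h \<in> {h\<in>monics n. f ^ i dvd h}" using monics_mult[OF fi, of _ "n - i * degree f"] True by auto
  qed
  have inj: "inj_on (\<lambda>h. f ^ i * h) (monics (n - i * degree f))"
    by (rule inj_onI) (rule KP_cancel[OF monics_KP[OF fi] monics_nz[OF fi] monics_KP monics_KP])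
  have "(\<Sum>h\<in>monics n. if f ^ i dvd h then \<chi> h else 0) = (\<Sum>h\<in>{h\<in>monics n. f ^ i dvd h}. \<chi> h)"
    using monics_card by (simp add: sum.inter_filter)
  also have "\<dots> = (\<Sum>h\<in>monics (n - i * degree f). \<chi> (f ^ i * h))"
    unfolding eq using inj by (simp add: sum.reindex)
  also have "\<dots> = (\<Sum>h\<in>monics (n - i * degree f). \<chi> f ^ i * \<chi> h)"
    using \<chi> fi mult_char_power[OF \<chi> Irr_monics[OF f] i] by (intro sum.cong) (auto simp: mult_char_def)
  finally show ?thesis using True by (simp add: Lcoeff_def sum_distrib_left)
next
  case False
  hence "\<not> f ^ i dvd h" if "h \<in> monics n" for h using Irr_power_dvd_le(1)[OF f that i] by blast
  thus ?thesis using False by (simp add: sum.neutral)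
qed

text \<open>The identity t L' = L (t L'/L) by coefficients, without Euler products: the factor n is
  rewritten for every h as the sum of deg f over all pairs (f, i) with f^i dividing h, and then the
  sum over h is carried out first.\<close>

theorem Lcoeff_recurrence:
  assumes \<chi>: "mult_char \<chi>"
  shows "of_nat n * Lcoeff \<chi> n = (\<Sum>j=1..n. Lsum \<chi> j * Lcoeff \<chi> (n - j))"
proof -
  define A where "A = {f \<in> Irr. degree f \<le> n}"
  have A: "finite A" unfolding A_def by (rule finite_Irr_le)
  have im: "of_nat (irr_mult f h) = (\<Sum>i=1..n. if f ^ i dvd h then 1 else (0::complex))"
    if "f \<in> A" "h \<in> monics n" for f h
  proof -
    have "{i. i > 0 \<and> f ^ i dvd h} = {i\<in>{1..n}. f ^ i dvd h}"
      using that Irr_power_dvd_le(2) by (auto simp: A_def)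
    thus ?thesis by (simp add: irr_mult_def sum.If_cases Int_def)
  qed
  have "of_nat n * Lcoeff \<chi> n
      = (\<Sum>h\<in>monics n. \<chi> h * of_nat (\<Sum>f\<in>A. degree f * irr_mult f h))"
    unfolding Lcoeff_def sum_distrib_left
    by (intro sum.cong) (auto simp: A_def degree_eq_sum_irr_mult simp del: of_nat_sum)
  also have "\<dots> = (\<Sum>h\<in>monics n. \<Sum>f\<in>A. \<Sum>i=1..n. of_nat (degree f) * (if f ^ i dvd h then \<chi> h else 0))"
    by (intro sum.cong)
       (auto simp: sum_distrib_left im simp del: of_nat_mult intro!: sum.cong simp: of_nat_mult)
  also have "\<dots> = (\<Sum>f\<in>A. \<Sum>i=1..n. \<Sum>h\<in>monics n. of_nat (degree f) * (if f ^ i dvd h then \<chi> h else 0))"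
    by (subst sum.swap) (intro sum.cong refl sum.swap)
  also have "\<dots> = (\<Sum>f\<in>A. \<Sum>i=1..n. if i * degree f \<le> n then
                      of_nat (degree f) * (\<chi> f ^ i * Lcoeff \<chi> (n - i * degree f)) else 0)"
  proof (intro sum.cong refl)
    fix f i assume "f \<in> A" "i \<in> {1..n}"
    hence "f \<in> Irr" "i > 0" by (auto simp: A_def)
    thus "(\<Sum>h\<in>monics n. of_nat (degree f) * (if f ^ i dvd h then \<chi> h else 0))
        = (if i * degree f \<le> n then
             of_nat (degree f) * (\<chi> f ^ i * Lcoeff \<chi> (n - i * degree f)) else 0)"
      unfolding sum_distrib_left[symmetric] by (subst sum_power_dvd[OF \<chi>]) auto
  qed
  \<comment> \<open>Regrouping by the degree \<open>j = i * degree f\<close> of the prime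
    power.\<close>
  also have "\<dots> = (\<Sum>f\<in>A. \<Sum>j=1..n. if degree f dvd j then
                      of_nat (degree f) * (\<chi> f ^ (j div degree f) * Lcoeff \<chi> (n - j)) else 0)"
  proof (rule sum.cong[OF refl])
    fix f assume "f \<in> A"
    hence d: "degree f > 0" by (simp add: A_def Irr_degree)
    define F where "F = (\<lambda>j. of_nat (degree f) * (\<chi> f ^ (j div degree f) * Lcoeff \<chi> (n - j)))"
    have "(\<Sum>i=1..n. if i * degree f \<le> n then
                      of_nat (degree f) * (\<chi> f ^ i * Lcoeff \<chi> (n - i * degree f)) else 0)
        = (\<Sum>i\<in>{i\<in>{1..n}. i * degree f \<le> n}. F (i * degree f))"
      using d by (simp add: F_def sum.If_cases Int_def)
    also have "\<dots> = (\<Sum>j\<in>{j\<in>{1..n}. degree f dvd j}. F j)"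
    proof (rule sum.reindex_bij_witness[of _ "\<lambda>j. j div degree f" "\<lambda>i. i * degree f"])
      fix j assume "j \<in> {j\<in>{1..n}. degree f dvd j}"
      then show "j div degree f \<in> {i\<in>{1..n}. i * degree f \<le> n}"
        using d by (auto simp: dvd_div_mult_self intro: order.trans[OF div_le_dividend]
            dest: dvd_imp_le simp: div_greater_zero_iff Suc_le_eq)
    qed (use d in auto)
    also have "\<dots> = (\<Sum>j=1..n. if degree f dvd j then F j else 0)"
      by (simp add: sum.If_cases Int_def)
    finally show "(\<Sum>i=1..n. if i * degree f \<le> n then
                      of_nat (degree f) * (\<chi> f ^ i * Lcoeff \<chi> (n - i * degree f)) else 0)
        = (\<Sum>j=1..n. if degree f dvd j then
                      of_nat (degree f) * (\<chi> f ^ (j div degree f) * Lcoeff \<chi> (n - j)) else 0)"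
      unfolding F_def .
  qed
  also have "\<dots> = (\<Sum>j=1..n. \<Sum>f\<in>A. if degree f dvd j then
                      of_nat (degree f) * (\<chi> f ^ (j div degree f) * Lcoeff \<chi> (n - j)) else 0)"
    by (rule sum.swap)
  also have "\<dots> = (\<Sum>j=1..n. Lsum \<chi> j * Lcoeff \<chi> (n - j))"
  proof (intro sum.cong refl)
    fix j assume j: "j \<in> {1..n}"
    have "{f \<in> Irr. degree f dvd j} = A \<inter> {f. degree f dvd j}"
      using j by (auto simp: A_def dest: dvd_imp_le)
    thus "(\<Sum>f\<in>A. if degree f dvd j then
                      of_nat (degree f) * (\<chi> f ^ (j div degree f) * Lcoeff \<chi> (n - j)) else 0)
        = Lsum \<chi> j * Lcoeff \<chi> (n - j)"
      using A by (simp add: Lsum_def sum.If_cases sum_distrib_right mult.assoc)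
  qed
  finally show ?thesis .
qed

text \<open>Gauss's count of the elements of \<open>F_(q^n)\<close> by their minimal polynomials:
  the recurrence for the constant character 1, whose L-series is 1/(1 - q t).\<close>

lemma sum_degree_Irr:
  assumes "n > 0"
  shows "(\<Sum>f | f \<in> Irr \<and> degree f dvd n. degree f) = q ^ n"
proof -
  have mc: "mult_char (\<lambda>_. 1)" by (simp add: mult_char_def)
  have L: "Lcoeff (\<lambda>_. 1) n = of_nat q ^ n" for n by (simp add: Lcoeff_def monics_card)
  have "Lsum (\<lambda>_. 1) n = of_nat q ^ n"
    using assms
  proof (induction n rule: less_induct)
    case (less n)
    have "of_nat n * of_nat q ^ n = (\<Sum>j=1..n. Lsum (\<lambda>_. 1) j * of_nat q ^ (n - j))"
      using Lcoeff_recurrence[OF mc, of n] by (simp only: L)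
    also have "{1..n} = insert n {1..<n}" using less.prems by auto
    also have "(\<Sum>j\<in>insert n {1..<n}. Lsum (\<lambda>_. 1) j * of_nat q ^ (n - j))
             = Lsum (\<lambda>_. 1) n + (\<Sum>j=1..<n. Lsum (\<lambda>_. 1) j * of_nat q ^ (n - j))" by simp
    also have "(\<Sum>j=1..<n. Lsum (\<lambda>_. 1) j * of_nat q ^ (n - j)) = (\<Sum>j=1..<n. of_nat q ^ n)"
      using less.IH by (intro sum.cong) (auto simp flip: power_add)
    finally show ?case using less.prems by (simp add: of_nat_diff algebra_simps)
  qed
  hence "of_nat (\<Sum>f | f \<in> Irr \<and> degree f dvd n. degree f) = (of_nat (q ^ n) :: complex)"
    by (simp add: Lsum_def)
  thus ?thesis by (simp only: of_nat_eq_iff)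
qed

end

section \<open>Congruences and Frobenius powers in a commutative ring\<close>

lemma prod_mod_cong:
  fixes m :: "'c::comm_ring_1"
  assumes "\<And>i. i \<in> I \<Longrightarrow> m dvd F i - G i"
  shows "m dvd prod F I - prod G I"
  using assms
proof (induction I rule: infinite_finite_induct)
  case (insert x A)
  have "F x * prod F A - G x * prod G A
      = (F x - G x) * prod F A + G x * (prod F A - prod G A)" by (simp add: algebra_simps)
  moreover have "m dvd (F x - G x) * prod F A + G x * (prod F A - prod G A)"
    using insert by (intro dvd_add dvd_mult dvd_mult2) auto
  ultimately show ?case using insert by simp
qed auto

lemma sum_mod_cong:
  fixes m :: "'c::comm_ring_1"
  assumes "\<And>i. i \<in> I \<Longrightarrow> m dvd F i - G i"
  shows "m dvd sum F I - sum G I"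
  unfolding sum_subtractf[symmetric] by (rule dvd_sum) (use assms in auto)

lemma power_mod_cong:
  fixes m :: "'c::comm_ring_1"
  assumes "m dvd a - b"
  shows "m dvd a ^ n - b ^ n"
  using prod_mod_cong[of "{..<n}" m "\<lambda>_. a" "\<lambda>_. b"] assms by simp

lemma mod_trans:
  fixes m :: "'c::comm_ring_1"
  assumes "m dvd a - b" "m dvd b - c"
  shows "m dvd a - c"
  using dvd_add[OF assms] by simp

lemma mod_sym:
  fixes m :: "'c::comm_ring_1"
  assumes "m dvd a - b"
  shows "m dvd b - a"
  using assms by (metis dvd_minus_iff minus_diff_eq)

text \<open>Only \<open>u\<close> and \<open>v\<close> are assumed to be killed by \<open>p\<close>,
  since the ambient ring need not have characteristic p. Every mixed binomial term contains a factor
  \<open>u\<close> next to a multiple of \<open>p\<close>, so this is enough.\<close>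

lemma freshman_power:
  fixes u v :: "'c::comm_ring_1"
  assumes "prime p" "of_nat p * u = 0" "of_nat p * v = 0"
  shows "(u + v) ^ (p ^ n) = u ^ (p ^ n) + v ^ (p ^ n)"
proof (cases "n = 0")
  case False
  have step: "(u + v) ^ p = u ^ p + v ^ p" if "of_nat p * u = 0" "of_nat p * v = 0" for u v :: 'c
  proof -
    have p1: "p > 1" using assms(1) by (rule prime_gt_1_nat)
    have "(u + v) ^ p = (\<Sum>i\<le>p. of_nat (p choose i) * u ^ i * v ^ (p - i))"
      by (rule binomial_ring)
    also have "{..p} = insert 0 (insert p {0<..<p})" using p1 by auto
    also have "(\<Sum>i\<in>insert 0 (insert p {0<..<p}). of_nat (p choose i) * u ^ i * v ^ (p - i))
             = v ^ p + (u ^ p + (\<Sum>i\<in>{0<..<p}. of_nat (p choose i) * u ^ i * v ^ (p - i)))"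
      using p1 by simp
    also have "(\<Sum>i\<in>{0<..<p}. of_nat (p choose i) * u ^ i * v ^ (p - i)) = 0"
    proof (rule sum.neutral, rule ballI)
      fix i assume i: "i \<in> {0<..<p}"
      hence "p dvd (p choose i)" by (intro dvd_choose_prime) (use assms(1) in auto)
      then obtain c where c: "p choose i = p * c" by (auto elim: dvdE)
      obtain i' where "i = Suc i'" using i by (cases i) auto
      hence "of_nat (p choose i) * u ^ i = of_nat c * u ^ i' * (of_nat p * u)"
        unfolding c by (simp add: ac_simps)
      thus "of_nat (p choose i) * u ^ i * v ^ (p - i) = 0" using that by simp
    qed
    finally show ?thesis by simp
  qed
  have kill: "of_nat p * x ^ i = 0" if "of_nat p * x = 0" "i > 0" for x :: 'c and i
    using that by (cases i) (auto simp: mult.assoc[symmetric])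
  have "(u + v) ^ (p ^ m) = u ^ (p ^ m) + v ^ (p ^ m)" for m
  proof (induction m)
    case (Suc m)
    have p0: "p ^ m > 0" using prime_gt_0_nat[OF assms(1)] by simp
    have "(u + v) ^ (p ^ Suc m) = ((u + v) ^ (p ^ m)) ^ p" by (simp add: power_mult[symmetric] mult.commute)
    also have "\<dots> = (u ^ (p ^ m)) ^ p + (v ^ (p ^ m)) ^ p"
      unfolding Suc using step kill[OF assms(2) p0] kill[OF assms(3) p0] by simp
    finally show ?case by (simp add: power_mult[symmetric] mult.commute)
  qed auto
  thus ?thesis .
qed auto

lemma freshman_power_sum:
  fixes F :: "'i \<Rightarrow> 'c::comm_ring_1"
  assumes "prime p" "\<And>i. i \<in> I \<Longrightarrow> of_nat p * F i = 0"
  shows "(sum F I) ^ (p ^ n) = (\<Sum>i\<in>I. F i ^ (p ^ n))"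
proof -
  have pn: "p ^ n > 0" using prime_gt_0_nat[OF assms(1)] by simp
  show ?thesis
    using assms(2)
  proof (induction I rule: infinite_finite_induct)
    case (insert x A)
    have "of_nat p * sum F A = 0" using insert.prems by (simp add: sum_distrib_left)
    then show ?case using insert freshman_power[OF assms(1), of "F x" "sum F A" n] by simp
  qed (use pn in \<open>auto simp: power_0_left\<close>)
qed

text \<open>Expanding the power of \<open>u + - u\<close> avoids a case distinction between odd p
  and p = 2.\<close>

lemma freshman_power_uminus:
  fixes u :: "'c::comm_ring_1"
  assumes "prime p" "of_nat p * u = 0"
  shows "(- u) ^ (p ^ n) = - (u ^ (p ^ n))"
proof -
  have pn: "p ^ n > 0" using prime_gt_0_nat[OF assms(1)] by simp
  have "(u + - u) ^ (p ^ n) = u ^ (p ^ n) + (- u) ^ (p ^ n)"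
    by (rule freshman_power) (use assms in auto)
  hence "u ^ (p ^ n) + (- u) ^ (p ^ n) = 0" using pn by (metis add.right_inverse power_0_left less_irrefl)
  thus ?thesis by (simp add: eq_neg_iff_add_eq_0 add.commute)
qed

section \<open>Newton power sums\<close>

text \<open>Newton's identities solved for the power sums: if the \<open>c i\<close> are the
  coefficients of the product of all 1 - x t, then \<open>newton c j\<close> is the sum of the x^j.
  No roots have to exist, and nothing is divided.\<close>

function newton :: "(nat \<Rightarrow> 'c::comm_ring_1) \<Rightarrow> nat \<Rightarrow> 'c" where
  "newton c j = - (of_nat j * c j + (\<Sum>i\<in>{1..<j}. c i * newton c (j - i)))"
  by auto
termination by (relation "measure snd") auto

declare newton.simps [simp del]

lemma newton_0 [simp]: "newton c 0 = 0"
  by (subst newton.simps) simp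

lemma newton_cong:
  assumes "\<And>i. 1 \<le> i \<Longrightarrow> i \<le> j \<Longrightarrow> c i = c' i"
  shows "newton c j = newton c' j"
  using assms
proof (induction j rule: less_induct)
  case (less j)
  have "newton c (j - i) = newton c' (j - i)" if "i \<in> {1..<j}" for i
    using that by (intro less) auto
  hence "(\<Sum>i\<in>{1..<j}. c i * newton c (j - i)) = (\<Sum>i\<in>{1..<j}. c' i * newton c' (j - i))"
    using less.prems by (intro sum.cong) auto
  moreover have "of_nat j * c j = of_nat j * c' j" using less.prems[of j] by (cases "j = 0") auto
  ultimately show ?case by (subst (1 2) newton.simps) simp
qed

text \<open>The coefficient \<open>c j\<close> enters the power sum of index \<open>j\<close>
  linearly, with factor -j. This is what later moves the trace form by a prescribed amount.\<close>

lemma newton_top: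
  assumes "\<And>i. 1 \<le> i \<Longrightarrow> i < j \<Longrightarrow> c' i = c i" "c' j = c j + t"
  shows "newton c' j = newton c j - of_nat j * t"
proof -
  have "newton c' (j - i) = newton c (j - i)" if "i \<in> {1..<j}" for i
    using that assms by (intro newton_cong) auto
  hence "(\<Sum>i\<in>{1..<j}. c' i * newton c' (j - i)) = (\<Sum>i\<in>{1..<j}. c i * newton c (j - i))"
    using assms(1) by (intro sum.cong) auto
  thus ?thesis by (subst (1 2) newton.simps) (simp add: assms(2) algebra_simps)
qed

lemma newton_corner:
  assumes "\<And>i. c i \<in> corner \<epsilon>"
  shows "newton c j \<in> corner \<epsilon>"
proof (induction j rule: less_induct)
  case (less j)
  show ?case
    by (subst newton.simps) (intro corner_uminus corner_add corner_sum corner_mult2 corner_mult assms)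
qed

text \<open>The generating function form F P = - t F', where the term \<open>i = 0\<close> is
  absorbed by the idempotent.\<close>

lemma newton_identity:
  assumes "\<And>i. c i \<in> corner \<epsilon>" "c 0 = \<epsilon>"
  shows "(\<Sum>i\<le>j. c i * newton c (j - i)) = - (of_nat j * c j)"
proof (cases "j = 0")
  case False
  have "{..j} = insert 0 (insert j {1..<j})" using False by auto
  hence "(\<Sum>i\<le>j. c i * newton c (j - i)) = \<epsilon> * newton c j + (\<Sum>i=1..<j. c i * newton c (j - i))"
    using False assms(2) by simp
  also have "\<epsilon> * newton c j = newton c j"
    using newton_corner[of c, OF assms(1)] by (rule corner_mult_id)
  also have "newton c j = - (of_nat j * c j + (\<Sum>i=1..<j. c i * newton c (j - i)))"
    by (rule newton.simps)
  finally show ?thesis by simp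
qed auto

text \<open>Power sums are minus the logarithmic derivative, which turns products into sums;
  \<open>D\<close> is the derivation t d/dt.\<close>

lemma newton_mult:
  assumes c: "\<And>i. c i \<in> corner \<epsilon>" "c 0 = \<epsilon>" and c': "\<And>i. c' i \<in> corner \<epsilon>" "c' 0 = \<epsilon>"
    and C: "\<And>n. C n = (\<Sum>i\<le>n. c i * c' (n - i))"
  shows "newton C j = newton c j + newton c' j"
proof -
  have \<epsilon>: "\<epsilon> * \<epsilon> = \<epsilon>" using corner_mult_id[OF c(1)[of 0]] c(2) by simp
  have CC: "C i \<in> corner \<epsilon>" "C 0 = \<epsilon>" for i
    using c c' by (auto simp: C \<epsilon> intro!: corner_sum corner_mult)
  define F F' G where "F = Abs_fps c" "F' = Abs_fps c'" "G = Abs_fps C"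
  define P P' Q where "P = Abs_fps (newton c)" "P' = Abs_fps (newton c')" "Q = Abs_fps (newton C)"
  define D :: "'a fps \<Rightarrow> 'a fps" where "D = (\<lambda>f. Abs_fps (\<lambda>n. of_nat n * fps_nth f n))"
  note defs = F_F'_G_def P_P'_Q_def
  have G: "G = F * F'"
    by (rule fps_ext) (simp add: defs C fps_mult_nth atMost_atLeast0)
  have D: "D (f * g) = D f * g + f * D g" for f g
  proof (rule fps_ext)
    fix n
    have "of_nat n * (fps_nth f i * fps_nth g (n - i))
        = of_nat i * fps_nth f i * fps_nth g (n - i) + fps_nth f i * (of_nat (n - i) * fps_nth g (n - i))"
      if "i \<in> {0..n}" for i
    proof -
      have "of_nat n = (of_nat i + of_nat (n - i) :: 'a)" using that by (simp flip: of_nat_add)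
      thus ?thesis by (simp only: distrib_right distrib_left ac_simps)
    qed
    hence "(\<Sum>i=0..n. of_nat n * (fps_nth f i * fps_nth g (n - i)))
        = (\<Sum>i=0..n. of_nat i * fps_nth f i * fps_nth g (n - i) + fps_nth f i * (of_nat (n - i) * fps_nth g (n - i)))"
      by (intro sum.cong refl)
    thus "fps_nth (D (f * g)) n = fps_nth (D f * g + f * D g) n"
      by (simp only: D_def fps_mult_nth sum_distrib_left sum.distrib fps_add_nth fps_nth_Abs_fps)
  qed
  have FP: "F * P = - D F" "F' * P' = - D F'" "G * Q = - D G"
    using newton_identity[of c, OF c] newton_identity[of c', OF c'] newton_identity[of C, OF CC(1) CC(2)]
    by (auto intro!: fps_ext simp: defs D_def fps_mult_nth atMost_atLeast0)
  have "G * (P + P' - Q) = F' * (F * P) + F * (F' * P') - G * Q"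
    unfolding G by (simp add: algebra_simps)
  also have "\<dots> = 0" unfolding FP by (simp add: G D algebra_simps)
  finally have 0: "G * (P + P' - Q) = 0" .
  \<comment> \<open>The series \<open>G\<close> starts with an idempotent and need not be
    invertible, so it is cancelled coefficient by coefficient; \<open>\<epsilon>\<close> acts as a
    unit because all coefficients concerned lie in its corner.\<close>
  have "fps_nth (P + P' - Q) n = 0" for n
  proof (induction n rule: less_induct)
    case (less n)
    have "0 = fps_nth (G * (P + P' - Q)) n" using 0 by simp
    also have "\<dots> = (\<Sum>i=0..n. fps_nth G i * fps_nth (P + P' - Q) (n - i))"
      by (rule fps_mult_nth)
    also have "\<dots> = (\<Sum>i=0..n. if i = 0 then \<epsilon> * fps_nth (P + P' - Q) n else 0)"
    proof (rule sum.cong[OF refl])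
      fix i assume "i \<in> {0..n}"
      then show "fps_nth G i * fps_nth (P + P' - Q) (n - i)
          = (if i = 0 then \<epsilon> * fps_nth (P + P' - Q) n else 0)"
        using less[of "n - i"] CC(2) by (cases "i = 0") (auto simp: defs)
    qed
    also have "\<dots> = \<epsilon> * fps_nth (P + P' - Q) n" by simp
    also have "\<dots> = fps_nth (P + P' - Q) n"
      by (rule corner_mult_id)
         (auto simp: defs intro!: corner_diff corner_add newton_corner c c' CC)
    finally show ?case by simp
  qed
  from this[of j] show ?thesis by (simp add: defs)
qed

lemma newton_mod_cong:
  assumes "\<And>i. m dvd c i - c' i"
  shows "m dvd newton c j - newton c' j"
proof (induction j rule: less_induct)
  case (less j)
  have 1: "m dvd (\<Sum>i\<in>{1..<j}. c i * newton c (j - i)) - (\<Sum>i\<in>{1..<j}. c' i * newton c' (j - i))"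
  proof (rule sum_mod_cong)
    fix i assume "i \<in> {1..<j}"
    hence "m dvd (c i - c' i) * newton c (j - i) + c' i * (newton c (j - i) - newton c' (j - i))"
      using less[of "j - i"] assms[of i] by (intro dvd_add dvd_mult dvd_mult2) auto
    thus "m dvd c i * newton c (j - i) - c' i * newton c' (j - i)" by (simp add: algebra_simps)
  qed
  have "m dvd - (of_nat j * (c j - c' j) +
      ((\<Sum>i\<in>{1..<j}. c i * newton c (j - i)) - (\<Sum>i\<in>{1..<j}. c' i * newton c' (j - i))))"
    using dvd_add[OF dvd_mult[OF assms, of "of_nat j" j] 1] by (simp only: dvd_minus_iff)
  thus ?case by (subst (1 2) newton.simps) (simp add: algebra_simps)
qed

lemma const_poly_sum: "[:sum F I:] = (\<Sum>i\<in>I. [:F i:])"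
  by (rule poly_eqI) (simp add: coeff_sum coeff_pCons split: nat.splits)

lemma newton_const_poly: "newton (\<lambda>i. [:c i:]) j = [:newton c j:]"
proof (induction j rule: less_induct)
  case (less j)
  have "(\<Sum>i\<in>{1..<j}. [:c i:] * newton (\<lambda>i. [:c i:]) (j - i))
      = [:\<Sum>i\<in>{1..<j}. c i * newton c (j - i):]"
    unfolding const_poly_sum using less by (intro sum.cong) auto
  thus ?case by (subst (1 2) newton.simps) (simp add: of_nat_poly)
qed

text \<open>The case 1 - a t of a single root.\<close>

lemma newton_linear:
  assumes "c 1 = - a" "\<And>i. i > 1 \<Longrightarrow> c i = 0" "j > 0"
  shows "newton c j = a ^ j"
  using assms(3)
proof (induction j rule: less_induct)
  case (less j)
  show ?case
  proof (cases "j = 1")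
    case True
    then show ?thesis using assms(1) by (subst newton.simps) simp
  next
    case False
    have "(\<Sum>i\<in>{1..<j}. c i * newton c (j - i)) = (\<Sum>i\<in>{1..<j}. if i = 1 then - a * a ^ (j - 1) else 0)"
      using less.IH[of "j - 1"] False assms(1,2) less.prems by (intro sum.cong) auto
    also have "\<dots> = - a * a ^ (j - 1)" using less.prems False by (subst sum.delta) auto
    also have "\<dots> = - (a ^ j)" using less.prems by (cases j) auto
    finally show ?thesis using assms(2)[of j] False less.prems by (subst newton.simps) simp
  qed
qed

text \<open>Coefficients of the reversed polynomial t^n h(1/t). The length \<open>n\<close> is a
  parameter, so that upper bounds on degrees suffice in products.\<close>

definition rcoeff :: "nat \<Rightarrow> 'c::comm_ring_1 poly \<Rightarrow> nat \<Rightarrow> 'c" where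
  "rcoeff n h i = (if i \<le> n then coeff h (n - i) else 0)"

lemma rcoeff_mult:
  assumes "degree u \<le> n" "degree v \<le> m"
  shows "rcoeff (n + m) (u * v) i = (\<Sum>j\<le>i. rcoeff n u j * rcoeff m v (i - j))"
proof (cases "i \<le> n + m")
  case True
  define N where "N = n + m - i"
  have "(\<Sum>k\<le>N. coeff u k * coeff v (N - k))
      = (\<Sum>k\<in>{k\<in>{..N}. k \<le> n \<and> N - k \<le> m}. coeff u k * coeff v (N - k))"
  proof (intro sum.mono_neutral_right ballI)
    fix k assume "k \<in> {..N} - {k\<in>{..N}. k \<le> n \<and> N - k \<le> m}"
    then show "coeff u k * coeff v (N - k) = 0"
      using assms by (cases "k \<le> n") (auto simp: coeff_eq_0)
  qed auto
  also have "\<dots> = (\<Sum>j\<in>{j\<in>{..i}. j \<le> n \<and> i - j \<le> m}. rcoeff n u j * rcoeff m v (i - j))"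
  proof (rule sum.reindex_bij_witness[of _ "\<lambda>j. n - j" "\<lambda>k. n - k"])
    fix k assume "k \<in> {k\<in>{..N}. k \<le> n \<and> N - k \<le> m}"
    hence k: "k \<le> N" "k \<le> n" "N - k \<le> m" by auto
    have "m - (i - (n - k)) = N - k" using k True unfolding N_def by auto
    moreover have "i - (n - k) \<le> m" using k True unfolding N_def by auto
    ultimately show "rcoeff n u (n - k) * rcoeff m v (i - (n - k)) = coeff u k * coeff v (N - k)"
      using k by (simp add: rcoeff_def)
  qed (use True in \<open>auto simp: N_def\<close>)
  also have "\<dots> = (\<Sum>j\<le>i. rcoeff n u j * rcoeff m v (i - j))"
    by (intro sum.mono_neutral_left) (auto simp: rcoeff_def)
  finally have "(\<Sum>k\<le>N. coeff u k * coeff v (N - k)) = (\<Sum>j\<le>i. rcoeff n u j * rcoeff m v (i - j))" .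
  thus ?thesis using True by (simp add: rcoeff_def coeff_mult N_def)
next
  case False
  have "rcoeff n u j * rcoeff m v (i - j) = 0" if "j \<le> i" for j
    using False that by (auto simp: rcoeff_def)
  thus ?thesis using False by (simp add: rcoeff_def)
qed

lemma corner_kill:
  assumes "of_nat p * \<epsilon> = 0" "u \<in> corner \<epsilon>"
  shows "of_nat p * u = 0"
proof -
  have "of_nat p * u = of_nat p * \<epsilon> * u" using corner_mult_id[OF assms(2)] by (simp add: mult.assoc)
  thus ?thesis using assms(1) by simp
qed

lemma corner_prod:
  assumes "finite A" "x \<in> A" "F x \<in> corner \<epsilon>"
  shows "prod F A \<in> corner \<epsilon>"
  using assms by (simp add: prod.remove corner_mult)

text \<open>The index set is nonempty because the empty product is the ambient \<open>1\<close>,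
  which need not have coefficients in the corner; the induction therefore starts with one
  factor.\<close>

lemma newton_prod_linear:
  fixes x :: "'i \<Rightarrow> 'c::comm_ring_1"
  assumes \<epsilon>: "\<epsilon> * \<epsilon> = \<epsilon>" and I: "finite I" "I \<noteq> {}" and x: "\<And>i. i \<in> I \<Longrightarrow> x i \<in> corner \<epsilon>"
  defines "G \<equiv> (\<Prod>i\<in>I. [:- x i, \<epsilon>:])"
  shows "degree G \<le> card I" "\<And>i. rcoeff (card I) G i \<in> corner \<epsilon>" "rcoeff (card I) G 0 = \<epsilon>"
    "\<And>j. j > 0 \<Longrightarrow> newton (rcoeff (card I) G) j = (\<Sum>i\<in>I. x i ^ j)"
proof -
  let ?G = "\<lambda>I. \<Prod>i\<in>I. [:- x i, \<epsilon>:]"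
  have \<epsilon>c: "\<epsilon> \<in> corner \<epsilon>" using \<epsilon> by (simp add: corner_def)
  have lin: "degree [:- a, \<epsilon>:] \<le> 1" "rcoeff 1 [:- a, \<epsilon>:] i \<in> corner \<epsilon>"
            "rcoeff 1 [:- a, \<epsilon>:] 0 = \<epsilon>" "j > 0 \<Longrightarrow> newton (rcoeff 1 [:- a, \<epsilon>:]) j = a ^ j"
    if "a \<in> corner \<epsilon>" for a i j
  proof -
    show "degree [:- a, \<epsilon>:] \<le> 1" by (simp add: degree_pCons_eq_if)
    show "rcoeff 1 [:- a, \<epsilon>:] i \<in> corner \<epsilon>"
      using that \<epsilon>c by (auto simp: rcoeff_def coeff_pCons corner_uminus split: nat.splits)
    show "rcoeff 1 [:- a, \<epsilon>:] 0 = \<epsilon>" by (simp add: rcoeff_def)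
    show "j > 0 \<Longrightarrow> newton (rcoeff 1 [:- a, \<epsilon>:]) j = a ^ j"
      by (rule newton_linear) (auto simp: rcoeff_def)
  qed
  have "degree (?G I) \<le> card I \<and> (\<forall>i. rcoeff (card I) (?G I) i \<in> corner \<epsilon>) \<and>
        rcoeff (card I) (?G I) 0 = \<epsilon> \<and> (\<forall>j>0. newton (rcoeff (card I) (?G I)) j = (\<Sum>i\<in>I. x i ^ j))"
    using I x
  proof (induction I rule: finite_ne_induct)
    case (singleton y)
    then show ?case using lin[of "x y"] by simp
  next
    case (insert y A)
    have y: "x y \<in> corner \<epsilon>" using insert by simp
    have IH: "degree (?G A) \<le> card A" "\<And>i. rcoeff (card A) (?G A) i \<in> corner \<epsilon>"
             "rcoeff (card A) (?G A) 0 = \<epsilon>"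
             "\<And>j. j > 0 \<Longrightarrow> newton (rcoeff (card A) (?G A)) j = (\<Sum>i\<in>A. x i ^ j)"
      using insert by auto
    have G: "?G (insert y A) = [:- x y, \<epsilon>:] * ?G A" and c: "card (insert y A) = 1 + card A"
      using insert by auto
    have r: "rcoeff (1 + card A) (?G (insert y A)) n
           = (\<Sum>i\<le>n. rcoeff 1 [:- x y, \<epsilon>:] i * rcoeff (card A) (?G A) (n - i))" for n
      unfolding G by (rule rcoeff_mult[OF lin(1)[OF y] IH(1)])
    have "degree (?G (insert y A)) \<le> 1 + card A"
      unfolding G using degree_mult_le[of "[:- x y, \<epsilon>:]" "?G A"] lin(1)[OF y] IH(1) by linarith
    moreover have "rcoeff (1 + card A) (?G (insert y A)) n \<in> corner \<epsilon>" for n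
      unfolding r by (intro corner_sum corner_mult lin(2) y)
    moreover have "rcoeff (1 + card A) (?G (insert y A)) 0 = \<epsilon>"
      unfolding r using lin(3)[OF y] IH(3) by (simp add: \<epsilon>)
    moreover have "newton (rcoeff (1 + card A) (?G (insert y A))) j = (\<Sum>i\<in>insert y A. x i ^ j)"
      if "j > 0" for j
      using newton_mult[OF lin(2,3)[OF y] IH(2,3) r] lin(4)[OF y that] IH(4)[OF that] insert by simp
    ultimately show ?case unfolding c by blast
  qed
  thus "degree G \<le> card I" "\<And>i. rcoeff (card I) G i \<in> corner \<epsilon>" "rcoeff (card I) G 0 = \<epsilon>"
    "\<And>j. j > 0 \<Longrightarrow> newton (rcoeff (card I) G) j = (\<Sum>i\<in>I. x i ^ j)"
    unfolding G_def by blast+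
qed

text \<open>The Frobenius power is additive and multiplicative on the corner, so applying it to the
  coefficients amounts to applying it to the roots.\<close>

lemma frob_prod_linear:
  fixes x :: "'i \<Rightarrow> 'c::comm_ring_1"
  assumes p: "prime p" "of_nat p * \<epsilon> = 0" "\<epsilon> * \<epsilon> = \<epsilon>" and x: "\<And>i. i \<in> I \<Longrightarrow> x i \<in> corner \<epsilon>"
  shows "coeff (\<Prod>i\<in>I. [:- x i, \<epsilon>:]) n ^ (p ^ k) = coeff (\<Prod>i\<in>I. [:- (x i ^ (p ^ k)), \<epsilon>:]) n"
proof -
  have q0: "p ^ k > 0" using prime_gt_0_nat[OF p(1)] by simp
  have zq: "(0::'c) ^ (p ^ k) = 0" using q0 by (metis power_0_left less_irrefl)
  have \<epsilon>q: "\<epsilon> ^ m = \<epsilon>" if "m > 0" for m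
    using that
  proof (induction m)
    case (Suc m)
    then show ?case by (cases "m = 0") (simp_all add: p(3))
  qed simp
  show ?thesis
    using x
  proof (induction I arbitrary: n rule: infinite_finite_induct)
    case (insert y A)
    let ?G = "\<Prod>i\<in>A. [:- x i, \<epsilon>:]" and ?H = "\<Prod>i\<in>A. [:- (x i ^ (p ^ k)), \<epsilon>:]"
    have IH: "coeff ?G n ^ (p ^ k) = coeff ?H n" for n using insert by auto
    have kx: "of_nat p * (x y * z) = 0" for z
      by (rule corner_kill[OF p(2)], rule corner_mult) (use insert in auto)
    have ke: "of_nat p * (\<epsilon> * z) = 0" for z
      by (simp add: mult.assoc[symmetric] p(2))
    have c: "coeff ([:- a, \<epsilon>:] * P) n = - (a * coeff P n) + \<epsilon> * (case n of 0 \<Rightarrow> 0 | Suc m \<Rightarrow> coeff P m)"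
      for a P by (simp add: coeff_pCons split: nat.splits)
    have "coeff (\<Prod>i\<in>insert y A. [:- x i, \<epsilon>:]) n ^ (p ^ k)
        = (- (x y * coeff ?G n) + \<epsilon> * (case n of 0 \<Rightarrow> 0 | Suc m \<Rightarrow> coeff ?G m)) ^ (p ^ k)"
      by (simp only: prod.insert[OF insert.hyps(1,2)] c)
    also have "\<dots> = (- (x y * coeff ?G n)) ^ (p ^ k) + (\<epsilon> * (case n of 0 \<Rightarrow> 0 | Suc m \<Rightarrow> coeff ?G m)) ^ (p ^ k)"
      by (rule freshman_power[OF p(1)]) (use kx[of "coeff ?G n"] ke in auto)
    also have "(- (x y * coeff ?G n)) ^ (p ^ k) = - ((x y * coeff ?G n) ^ (p ^ k))"
      by (rule freshman_power_uminus[OF p(1) kx])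
    also have "(x y * coeff ?G n) ^ (p ^ k) = x y ^ (p ^ k) * coeff ?H n"
      by (simp add: power_mult_distrib IH)
    also have "(\<epsilon> * (case n of 0 \<Rightarrow> 0 | Suc m \<Rightarrow> coeff ?G m)) ^ (p ^ k)
             = \<epsilon> * (case n of 0 \<Rightarrow> 0 | Suc m \<Rightarrow> coeff ?H m)"
      using q0 by (cases n) (auto simp: power_mult_distrib IH \<epsilon>q zq)
    also have "- (x y ^ (p ^ k) * coeff ?H n) + \<epsilon> * (case n of 0 \<Rightarrow> 0 | Suc m \<Rightarrow> coeff ?H m)
        = coeff (\<Prod>i\<in>insert y A. [:- (x i ^ (p ^ k)), \<epsilon>:]) n"
      by (simp only: prod.insert[OF insert.hyps(1,2)] c)
    finally show ?case .
  qed (auto simp: coeff_1 zq)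
qed

lemma pcompose_monom: "pcompose (monom c n) u = smult c (u ^ n)"
  by (induction n) (auto simp: monom_0 monom_Suc pcompose_pCons algebra_simps)

section \<open>Fermat's theorem, roots and fixed points of Frobenius\<close>

context finite_field_component begin

lemma p_char_E: "of_nat p * [:e:] = 0"
  using p_char by (simp add: of_nat_poly mult.commute)

lemma E_idem: "[:e:] * [:e:] = [:e:]"
  by (simp add: idem)

lemma e_power: "n > 0 \<Longrightarrow> e ^ n = e"
proof (induction n)
  case (Suc n)
  then show ?case by (cases "n = 0") (simp_all add: idem)
qed simp

lemma p_pos [simp]: "p > 0"
  using p_prime by (rule prime_gt_0_nat)

lemma K_ne: "K \<noteq> {}"
  using e_K by blast

lemma E_KPlt: "n > 0 \<Longrightarrow> [:e:] \<in> KPlt n"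
  by (auto simp: KPlt_def coeff_pCons split: nat.splits)

lemma KPlt_not_dvd:
  assumes "f \<in> monics n" "u \<in> KPlt n" "f dvd u"
  shows "u = 0"
proof (rule ccontr)
  assume u: "u \<noteq> 0"
  have uKP: "u \<in> KP" using assms by (simp add: KPlt_def)
  obtain c where c: "c \<in> KP" "u = f * c" using KP_dvdE[OF assms(3) uKP] .
  have "c \<noteq> 0" using c u by auto
  hence "degree u = n + degree c"
    using KP_lead_mult(2)[OF monics_KP[OF assms(1)] c(1) monics_nz[OF assms(1)]] c(2) monics_degree[OF assms(1)] by simp
  hence "coeff u (degree u) = 0" using assms(2) by (simp add: KPlt_def)
  thus False using u by simp
qed

text \<open>The extra factor \<open>v\<close> keeps the product inside \<open>KP\<close> when
  \<open>A\<close> is empty, and it collects the factors already passed in the induction.\<close>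

lemma Irr_dvd_prod:
  assumes "f \<in> Irr" "finite A" "\<And>i. i \<in> A \<Longrightarrow> F i \<in> KP" "v \<in> KP" "f dvd prod F A * v"
  shows "(\<exists>i\<in>A. f dvd F i) \<or> f dvd v"
  using assms(2,3,4,5)
proof (induction A arbitrary: v rule: finite_induct)
  case (insert x A)
  have "f dvd prod F A * (F x * v)" using insert by (simp add: ac_simps)
  hence "(\<exists>i\<in>A. f dvd F i) \<or> f dvd F x * v"
    using insert by (intro insert.IH corner_mult) auto
  thus ?case using Irr_prime[OF assms(1), of "F x" v] insert.prems by auto
qed auto

text \<open>Multiplication by \<open>x\<close> permutes the nonzero residues modulo
  \<open>f\<close>; comparing the products of all residues before and after yields x^(q^deg f - 1)
  congruent to the unit.\<close>

lemma Irr_fermat: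
  assumes f: "f \<in> Irr" and x: "x \<in> KP"
  shows "f dvd x ^ (q ^ degree f) - x"
proof (cases "f dvd x")
  case True
  have "q ^ degree f > 0" by simp
  hence "x dvd x ^ (q ^ degree f)" by (cases "q ^ degree f") auto
  then show ?thesis using True by (meson dvd_diff dvd_trans)
next
  case False
  define r where "r = degree f"
  have r: "f \<in> monics r" "r > 0" using Irr_monics[OF f] Irr_degree[OF f] by (auto simp: r_def)
  define N where "N = KPlt r - {0}"
  have N: "finite N" "card N = q ^ r - 1"
    using KPlt_card[of r] by (auto simp: N_def KPlt_def)
  have N_KP: "u \<in> KP" if "u \<in> N" for u using that by (auto simp: N_def KPlt_def)
  have ndvd: "\<not> f dvd u" if "u \<in> N" for u
    using KPlt_not_dvd[OF r(1)] that by (auto simp: N_def)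
  have "\<exists>v\<in>N. f dvd x * u - v" if u: "u \<in> N" for u
  proof -
    obtain w v where wv: "v \<in> KPlt r" "x * u = w * f + v"
      using KP_division[OF r(1) corner_mult[OF x, of u]] by blast
    have "v \<noteq> 0"
    proof
      assume "v = 0"
      hence "f dvd x * u" using wv by simp
      thus False using Irr_prime[OF f x N_KP[OF u]] False ndvd[OF u] by blast
    qed
    thus ?thesis using wv by (intro bexI[of _ v]) (auto simp: N_def)
  qed
  then obtain \<rho> where \<rho>: "\<And>u. u \<in> N \<Longrightarrow> \<rho> u \<in> N" "\<And>u. u \<in> N \<Longrightarrow> f dvd x * u - \<rho> u"
    by metis
  have "inj_on \<rho> N"
  proof (rule inj_onI)
    fix u v assume uv: "u \<in> N" "v \<in> N" "\<rho> u = \<rho> v"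
    have "f dvd x * u - x * v" using mod_trans[OF \<rho>(2)[OF uv(1)]] mod_sym[OF \<rho>(2)[OF uv(2)]] uv(3) by simp
    hence "f dvd x * (u - v)" by (simp add: algebra_simps)
    hence "f dvd u - v" using Irr_prime[OF f x corner_diff[OF N_KP[OF uv(1)] N_KP[OF uv(2)]]] False by blast
    moreover have "u - v \<in> KPlt r" using uv by (auto simp: N_def KPlt_def corner_diff)
    ultimately show "u = v" using KPlt_not_dvd[OF r(1), of "u - v"] by simp
  qed
  hence surj: "\<rho> ` N = N" using \<rho>(1) N(1) by (intro endo_inj_surj) auto
  define U where "U = (\<Prod>u\<in>N. u)"
  have "(\<Prod>u\<in>N. \<rho> u) = U"
    using prod.reindex[OF \<open>inj_on \<rho> N\<close>, of "\<lambda>u. u"] surj by (simp add: U_def)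
  hence 1: "f dvd (\<Prod>u\<in>N. x * u) - U" using prod_mod_cong[of N f "\<lambda>u. x * u" \<rho>] \<rho>(2) by simp
  have eN: "[:e:] \<in> N" using E_KPlt[OF r(2)] e_nz by (auto simp: N_def)
  have UK: "U \<in> KP" unfolding U_def using N(1) eN by (rule corner_prod) auto
  define M where "M = q ^ r - 1"
  have "q ^ r > 1" using one_less_power[OF q_gt1 r(2)] .
  hence M: "M > 0" "Suc M = q ^ r" by (auto simp: M_def)
  have "(\<Prod>u\<in>N. x * u) - U = U * (x ^ M - [:e:])"
    using N(2) KP_eq(1)[OF UK] by (simp add: prod.distrib U_def M_def algebra_simps)
  hence "f dvd (\<Prod>u\<in>N. u) * (x ^ M - [:e:])" using 1 by (simp add: U_def)
  hence "f dvd x ^ M - [:e:]"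
    using Irr_dvd_prod[OF f N(1), of "\<lambda>u. u"] N_KP ndvd corner_diff[OF corner_power[OF x M(1)] E_KP] by blast
  hence "f dvd x * (x ^ M - [:e:])" by (rule dvd_mult)
  also have "x * (x ^ M - [:e:]) = x ^ Suc M - x"
    using KP_eq(2)[OF x] by (simp only: right_diff_distrib power_Suc)
  finally show ?thesis by (simp only: M(2) r_def)
qed

lemma linear_monics: "c \<in> K \<Longrightarrow> [:- c, e:] \<in> monics 1"
  using e_nz by (auto simp: monics_def pCons_KP corner_uminus)

lemma linear_Irr: "c \<in> K \<Longrightarrow> [:- c, e:] \<in> Irr"
proof -
  assume c: "c \<in> K"
  have "i = 0 \<or> j = 0" if "a \<in> monics i" "b \<in> monics j" "[:- c, e:] = a * b" for i j a b
  proof -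
    have "i + j = 1"
      using monics_degree[OF monics_mult[OF that(1,2)]] monics_degree[OF linear_monics[OF c]] that(3) by simp
    thus ?thesis by arith
  qed
  thus ?thesis unfolding Irr_def
    by (intro CollectI exI[of _ 1] conjI allI ballI impI linear_monics c) simp
qed

lemma poly_K: "u \<in> KP \<Longrightarrow> c \<in> K \<Longrightarrow> poly u c \<in> K"
  by (induction u) (auto simp: pCons_KP intro!: corner_add corner_mult)

text \<open>Fermat's theorem modulo the linear irreducible \<open>[:- c, e:]\<close>, applied to the
  variable and evaluated at \<open>c\<close>.\<close>

lemma K_frob: "c \<in> K \<Longrightarrow> c ^ q = c"
proof -
  assume c: "c \<in> K"
  have "[:- c, e:] dvd (monom e 1) ^ (q ^ degree [:- c, e:]) - monom e 1"
    by (rule Irr_fermat[OF linear_Irr[OF c]]) simp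
  then obtain w where w: "(monom e 1) ^ (q ^ degree [:- c, e:]) - monom e 1 = [:- c, e:] * w" by (rule dvdE)
  have "degree [:- c, e:] = 1" using e_nz by simp
  hence "poly ((monom e 1) ^ q - monom e 1) c = poly ([:- c, e:] * w) c" using w by simp
  also have "\<dots> = 0" using K_eq[OF c] unfolding poly_mult by simp
  finally show ?thesis using K_eq[OF c] by (simp add: poly_monom)
qed

lemma K_frob_power: "c \<in> K \<Longrightarrow> c ^ (q ^ n) = c"
proof (induction n)
  case (Suc n)
  have "c ^ (q ^ Suc n) = (c ^ (q ^ n)) ^ q" by (simp add: power_mult[symmetric] mult.commute)
  then show ?case using Suc K_frob by simp
qed auto

lemma root_factor:
  assumes "P \<in> KP" "c \<in> K" "poly P c = 0"
  obtains w where "w \<in> KP" "P = [:- c, e:] * w"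
proof -
  obtain w r where wr: "w \<in> KP" "r \<in> KPlt 1" "P = w * [:- c, e:] + r"
    using KP_division[OF linear_monics[OF assms(2)] assms(1)] by blast
  obtain a where a: "r = [:a:]" using wr(2) by (auto simp: KPlt_Suc)
  have "poly [:- c, e:] c = 0" using K_eq[OF assms(2)] by simp
  hence "poly P c = a" unfolding wr(3) a poly_add poly_mult by simp
  thus ?thesis using that[OF wr(1)] wr(3) a assms(3) by (simp add: mult.commute)
qed

lemma roots_prod_factor:
  assumes "finite S" "S \<subseteq> K" "P \<in> KP" "\<And>c. c \<in> S \<Longrightarrow> poly P c = 0"
  shows "\<exists>w\<in>KP. P = (\<Prod>c\<in>S. [:- c, e:]) * w"
  using assms
proof (induction S arbitrary: P rule: finite_induct)
  case empty
  then show ?case by auto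
next
  case (insert x S)
  have x: "x \<in> K" using insert by auto
  obtain w where w: "w \<in> KP" "P = [:- x, e:] * w" using root_factor[OF insert.prems(2) x] insert.prems(3) by auto
  have "poly w c = 0" if "c \<in> S" for c
  proof -
    have c: "c \<in> K" "c \<noteq> x" using that insert by auto
    have "poly [:- x, e:] c = c - x" using K_eq[OF c(1)] by simp
    hence "(c - x) * poly w c = poly P c" unfolding w(2) poly_mult by simp
    hence "(c - x) * poly w c = 0" using insert.prems(3)[of c] that by simp
    thus ?thesis using K_integral[OF corner_diff[OF c(1) x] poly_K[OF w(1) c(1)]] c(2) by auto
  qed
  then obtain v where v: "v \<in> KP" "w = (\<Prod>c\<in>S. [:- c, e:]) * v" using insert.IH[OF _ w(1)] insert.prems by auto
  have "P = (\<Prod>c\<in>insert x S. [:- c, e:]) * v"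
    unfolding prod.insert[OF insert.hyps(1,2)] w(2) v(2) by (simp only: mult.assoc)
  with v(1) show ?case by (rule bexI[rotated])
qed

lemma monics_prod:
  assumes "finite A" "A \<noteq> {}" "\<And>i. i \<in> A \<Longrightarrow> F i \<in> monics (N i)"
  shows "prod F A \<in> monics (sum N A)"
  using assms by (induction A rule: finite_ne_induct) (auto intro!: monics_mult)

lemma card_roots_le:
  assumes "P \<in> KP" "P \<noteq> 0"
  shows "card {c \<in> K. poly P c = 0} \<le> degree P"
proof (cases "{c \<in> K. poly P c = 0} = {}")
  case False
  define S where "S = {c \<in> K. poly P c = 0}"
  have S: "finite S" "S \<noteq> {}" using K_fin False by (auto simp: S_def)
  have "\<exists>w\<in>KP. P = (\<Prod>c\<in>S. [:- c, e:]) * w"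
    by (rule roots_prod_factor[OF S(1) _ assms(1)]) (auto simp: S_def)
  then obtain w where w: "w \<in> KP" "P = (\<Prod>c\<in>S. [:- c, e:]) * w" ..
  have m: "(\<Prod>c\<in>S. [:- c, e:]) \<in> monics (card S)"
    using monics_prod[OF S, of "\<lambda>c. [:- c, e:]" "\<lambda>_. 1"] linear_monics by (auto simp: S_def)
  have "w \<noteq> 0" using w(2) assms(2) by fastforce
  hence "degree P = card S + degree w"
    using KP_lead_mult(2)[OF monics_KP[OF m] w(1) monics_nz[OF m]] w(2) monics_degree[OF m] by simp
  thus ?thesis by (simp add: S_def)
qed (simp only: card.empty)

text \<open>All elements of \<open>K\<close> are roots of the right-hand side, so the product
  divides it, and both are monic of degree q.\<close>

lemma prod_K_linear: "(\<Prod>c\<in>K. [:- c, e:]) = monom e q - monom e 1"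
proof -
  have KP: "monom e q - monom e 1 \<in> KP" by (intro corner_diff monom_KP e_K)
  have c: "coeff (monom e q - monom e 1) q = e" using q_gt1 by (simp add: coeff_monom)
  have "degree (monom e q - monom e 1) = q"
    by (rule antisym[OF degree_le le_degree]) (use q_gt1 c e_nz in \<open>auto simp: coeff_monom\<close>)
  hence m: "monom e q - monom e 1 \<in> monics q" using KP c by (simp add: monics_def)
  have m': "(\<Prod>c\<in>K. [:- c, e:]) \<in> monics q"
    using monics_prod[of K "\<lambda>c. [:- c, e:]" "\<lambda>_. 1"] K_fin K_card linear_monics K_ne by auto
  have "\<exists>w\<in>KP. monom e q - monom e 1 = (\<Prod>c\<in>K. [:- c, e:]) * w"
    by (rule roots_prod_factor[OF K_fin _ KP])
       (use K_frob K_eq in \<open>auto simp: poly_monom\<close>)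
  hence "(\<Prod>c\<in>K. [:- c, e:]) dvd monom e q - monom e 1" by auto
  then obtain w where "w \<in> monics (q - q)" "monom e q - monom e 1 = (\<Prod>c\<in>K. [:- c, e:]) * w"
    using monics_quot[OF m' m] by blast
  thus ?thesis using KP_eq(2)[OF monics_KP[OF m']] by simp
qed

lemma prod_K_sub:
  assumes "u \<in> KP"
  shows "(\<Prod>c\<in>K. u - [:c:]) = u ^ q - u"
proof -
  have 1: "pcompose [:- c, e:] u = u - [:c:]" for c
    using KP_eq(3)[OF assms] by (simp add: pcompose_pCons)
  have uq: "u ^ q \<in> KP" using corner_power[OF assms, of q] by simp
  show ?thesis
    using arg_cong[OF prod_K_linear, of "\<lambda>P. pcompose P u"] KP_eq(3)[OF assms] KP_eq(3)[OF uq]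
    by (simp add: pcompose_prod 1 pcompose_diff pcompose_monom)
qed

text \<open>In the residue field of \<open>f\<close>, the fixed points of Frobenius are the
  constants: u^q - u is the product of all u - c, and the prime \<open>f\<close> divides one
  factor.\<close>

lemma Irr_frob_const:
  assumes "f \<in> Irr" "u \<in> KP" "f dvd u ^ q - u"
  shows "\<exists>c\<in>K. f dvd u - [:c:]"
proof -
  have "(\<Prod>c\<in>K. u - [:c:]) \<in> KP"
    using K_fin by (rule corner_prod[of _ 0]) (use assms in auto)
  hence "f dvd (\<Prod>c\<in>K. u - [:c:]) * [:e:]"
    using assms prod_K_sub[OF assms(2)] by (simp add: KP_eq)
  moreover have "\<not> f dvd [:e:]" using KPlt_not_dvd[OF Irr_monics[OF assms(1)], of "[:e:]"] E_KPlt[OF Irr_degree[OF assms(1)]] e_nz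
    by auto
  moreover have "u - [:c:] \<in> KP" if "c \<in> K" for c
    using that assms by (intro corner_diff) (auto simp: pCons_KP)
  ultimately show ?thesis
    using Irr_dvd_prod[OF assms(1) K_fin _ E_KP, of "\<lambda>c. u - [:c:]"] by blast
qed

text \<open>The sum of the j-th powers of the roots of a monic \<open>h\<close>, computed from its
  coefficients without a splitting field.\<close>

definition psum :: "'b poly \<Rightarrow> nat \<Rightarrow> 'b" where
  "psum h j = newton (rcoeff (degree h) h) j"

lemma rcoeff_K: "h \<in> KP \<Longrightarrow> rcoeff n h i \<in> K"
  by (simp add: rcoeff_def KP_coeff)

lemma psum_K: "h \<in> KP \<Longrightarrow> psum h j \<in> K"
  unfolding psum_def by (intro newton_corner rcoeff_K)

lemma psum_mult:
  assumes "a \<in> monics i" "b \<in> monics j"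
  shows "psum (a * b) n = psum a n + psum b n"
proof -
  have "psum (a * b) n = newton (rcoeff (i + j) (a * b)) n"
    using monics_degree[OF monics_mult[OF assms]] by (simp add: psum_def)
  also have "\<dots> = newton (rcoeff i a) n + newton (rcoeff j b) n"
    by (rule newton_mult[where \<epsilon> = e, OF rcoeff_K _ rcoeff_K _ rcoeff_mult])
       (use assms in \<open>auto simp: monics_KP monics_degree rcoeff_def monics_coeff\<close>)
  finally show ?thesis using assms by (simp add: psum_def monics_degree)
qed

lemma monom_e_power: "n > 0 \<Longrightarrow> monom e i ^ n = monom e (i * n)"
  by (simp add: monom_power e_power)

text \<open>The coefficients of \<open>\<Prod>i<r. Y - X^(q^i)\<close> are invariant under Frobenius modulo \<open>f\<close>,
  hence constants, and the constant polynomial they form is \<open>f(Y)\<close>.\<close>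

lemma Irr_psum:
  assumes f: "f \<in> Irr" and j: "j > 0"
  shows "f dvd [:psum f j:] - (\<Sum>i<degree f. monom e (j * q ^ i))"
proof -
  define r where "r = degree f"
  have r: "f \<in> monics r" "r > 0" using Irr_monics[OF f] Irr_degree[OF f] by (auto simp: r_def)
  define xp where "xp i = monom e (q ^ i)" for i
  define G where "G = (\<Prod>i<r. [:- xp i, [:e:]:])"
  have XK: "xp i \<in> KP" for i by (simp add: xp_def)
  have ne: "{..<r} \<noteq> {}" using r(2) by auto
  have Gdeg: "degree G \<le> r" and Grc: "\<And>i. rcoeff r G i \<in> KP" and G0: "rcoeff r G 0 = [:e:]"
    and Gn: "newton (rcoeff r G) j = (\<Sum>i<r. xp i ^ j)"
    using newton_prod_linear[OF E_idem finite_lessThan ne, of xp] XK j by (auto simp: G_def)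
  have Xq: "xp i ^ q = xp (Suc i)" for i
    unfolding xp_def using q_gt1 by (subst monom_e_power) (auto simp: mult.commute)
  have Gcoeff: "coeff G n \<in> KP" for n
  proof (cases "n \<le> r")
    case True
    then show ?thesis using Grc[of "r - n"] by (simp add: rcoeff_def)
  next
    case False
    then show ?thesis using Gdeg by (simp add: coeff_eq_0)
  qed
  have frob: "f dvd coeff G n ^ q - coeff G n" for n
  proof -
    obtain r' where r': "r = Suc r'" using r(2) by (cases r) auto
    let ?L = "\<lambda>i. [:- xp i, [:e:]:]"
    have "f dvd xp r - xp 0" using Irr_fermat[OF f, of "xp 0"] q_gt1
      by (simp add: xp_def r_def monom_e_power)
    then obtain c where c: "xp r - xp 0 = f * c" by (rule dvdE)
    have "coeff G n ^ q = coeff (\<Prod>i<r. ?L (Suc i)) n"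
      unfolding G_def by (subst frob_prod_linear[OF p_prime p_char_E E_idem XK]) (simp only: Xq)
    \<comment> \<open>Frobenius shifts the factors, which trades X^(q^0) for X^(q^r); these two
      agree modulo \<open>f\<close> by Fermat.\<close>
    moreover have "(\<Prod>i<r. ?L (Suc i)) - G = (?L r - ?L 0) * (\<Prod>i<r'. ?L (Suc i))"
      unfolding G_def r' by (subst (2) prod.lessThan_Suc_shift) (simp only: prod.lessThan_Suc left_diff_distrib, simp only: mult.commute)
    moreover have "?L r - ?L 0 = [:f:] * [:- c:]" using c by (simp add: algebra_simps)
    ultimately have "coeff G n ^ q - coeff G n = coeff ([:f:] * ([:- c:] * (\<Prod>i<r'. ?L (Suc i)))) n"
      by (simp only: coeff_diff[symmetric] mult.assoc)
    thus ?thesis by simp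
  qed
  have "\<exists>c\<in>K. f dvd coeff G n - [:c:]" for n
    by (rule Irr_frob_const[OF f Gcoeff frob])
  then obtain c0 where c0: "\<And>n. c0 n \<in> K" "\<And>n. f dvd coeff G n - [:c0 n:]" by metis
  \<comment> \<open>The value at \<open>r\<close> is fixed as \<open>e\<close>, in agreement with
    \<open>G0\<close>, so that the polynomial \<open>g\<close> built from these constants is
    monic.\<close>
  define c where "c n = (if n = r then e else c0 n)" for n
  have cK: "c n \<in> K" for n using c0 by (simp add: c_def)
  have cf: "f dvd coeff G n - [:c n:]" for n
    using c0 G0 by (auto simp: c_def rcoeff_def)
  define g where "g = (\<Sum>n\<le>r. monom (c n) n)"
  have gc: "coeff g n = (if n \<le> r then c n else 0)" for n
    by (simp add: g_def coeff_sum coeff_monom)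
  have "degree g = r"
    by (rule antisym[OF degree_le le_degree]) (use e_nz in \<open>auto simp: gc c_def\<close>)
  hence gm: "g \<in> monics r"
    by (auto simp: monics_def corner_poly_iff gc cK c_def c0)
  define xp1 where "xp1 = monom e 1"
  have mon: "monom (c n) n = [:c n:] * xp1 ^ n" for n
    using K_eq[OF cK[of n]] by (cases "n = 0") (auto simp: xp1_def monom_0 monom_e_power smult_monom)
  have "f dvd (\<Sum>n\<le>r. coeff G n * xp1 ^ n) - (\<Sum>n\<le>r. [:c n:] * xp1 ^ n)"
  proof (rule sum_mod_cong)
    fix n
    show "f dvd coeff G n * xp1 ^ n - [:c n:] * xp1 ^ n"
      unfolding left_diff_distrib[symmetric] by (rule dvd_mult2[OF cf])
  qed
  moreover have "(\<Sum>n\<le>r. coeff G n * xp1 ^ n) = poly G xp1"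
    unfolding poly_altdef by (rule sum.mono_neutral_right) (use Gdeg in \<open>auto simp: coeff_eq_0 not_le\<close>)
  moreover have "poly G xp1 = 0"
  proof -
    have "poly [:- xp 0, [:e:]:] xp1 = 0" by (simp add: xp_def xp1_def smult_monom idem)
    thus ?thesis unfolding G_def poly_prod using r(2) by (intro prod_zero) auto
  qed
  \<comment> \<open>The variable is a root of \<open>G\<close>, whose coefficients agree with those
    of \<open>g\<close> modulo \<open>f\<close>. Both \<open>f\<close> and \<open>g\<close> are
    monic of degree \<open>r\<close>, so they coincide.\<close>
  ultimately have "f dvd g" unfolding g_def mon by simp
  then obtain w where w: "w \<in> monics (r - r)" "g = f * w" using monics_quot[OF r(1) gm] by blast
  hence "g = f" using KP_eq(2)[OF monics_KP[OF r(1)]] by simp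
  hence fc: "coeff f n = c n" if "n \<le> r" for n using gc[of n] that by simp
  have "f dvd [:rcoeff r f i:] - rcoeff r G i" for i
    using mod_sym[OF cf[of "r - i"]] fc by (simp add: rcoeff_def)
  hence "f dvd newton (\<lambda>i. [:rcoeff r f i:]) j - newton (rcoeff r G) j"
    by (rule newton_mod_cong)
  thus ?thesis using j unfolding newton_const_poly Gn
    by (simp add: psum_def r_def xp_def monom_e_power mult.commute)
qed

end

section \<open>Traces of a polynomial at the roots of an irreducible polynomial\<close>

context finite_field_component begin

text \<open>For irreducible \<open>h\<close> with root x this is the trace of P(x) from
  \<open>F_q(x)\<close> to \<open>F_q\<close>, up to the constant term of \<open>P\<close>, which
  the sum leaves out. Through power sums it makes sense for every monic \<open>h\<close>.\<close>

definition trace_form :: "'b poly \<Rightarrow> 'b poly \<Rightarrow> 'b" where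
  "trace_form P h = (\<Sum>j=1..degree P. coeff P j * psum h j)"

text \<open>The conjugate P(X^(q^i)) without constant term; the coefficients are fixed by Frobenius,
  so over \<open>K\<close> this is also a Frobenius power of P - P(0).\<close>

definition Tterm :: "'b poly \<Rightarrow> nat \<Rightarrow> 'b poly" where
  "Tterm P i = (\<Sum>j=1..degree P. monom (coeff P j) (j * q ^ i))"

definition Tsum :: "'b poly \<Rightarrow> nat \<Rightarrow> 'b poly" where
  "Tsum P n = (\<Sum>i<n. Tterm P i)"

lemma trace_form_K: "h \<in> KP \<Longrightarrow> trace_form P h \<in> K"
  unfolding trace_form_def by (intro corner_sum corner_mult2 psum_K)

lemma trace_form_mult:
  "a \<in> monics i \<Longrightarrow> b \<in> monics j \<Longrightarrow> trace_form P (a * b) = trace_form P a + trace_form P b"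
  by (simp add: trace_form_def psum_mult distrib_left sum.distrib)

lemma Tterm_KP: "P \<in> KP \<Longrightarrow> Tterm P i \<in> KP"
  unfolding Tterm_def by (intro corner_sum monom_KP KP_coeff)

lemma Tsum_KP: "P \<in> KP \<Longrightarrow> Tsum P i \<in> KP"
  unfolding Tsum_def by (intro corner_sum Tterm_KP)

lemma Irr_trace:
  assumes "f \<in> Irr" "P \<in> KP"
  shows "f dvd [:trace_form P f:] - Tsum P (degree f)"
proof -
  have 1: "[:trace_form P f:] = (\<Sum>j=1..degree P. [:coeff P j:] * [:psum f j:])"
    unfolding trace_form_def const_poly_sum by (simp add: mult.commute)
  have "Tsum P (degree f) = (\<Sum>j=1..degree P. \<Sum>i<degree f. monom (coeff P j) (j * q ^ i))"
    unfolding Tsum_def Tterm_def by (rule sum.swap)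
  also have "\<dots> = (\<Sum>j=1..degree P. [:coeff P j:] * (\<Sum>i<degree f. monom e (j * q ^ i)))"
    using K_eq(2)[OF KP_coeff[OF assms(2)]]
    by (simp only: sum_distrib_left) (simp add: smult_monom)
  finally have 2: "Tsum P (degree f) = \<dots>" .
  show ?thesis unfolding 1 2
  proof (rule sum_mod_cong)
    fix j assume "j \<in> {1..degree P}"
    hence "f dvd [:coeff P j:] * ([:psum f j:] - (\<Sum>i<degree f. monom e (j * q ^ i)))"
      by (intro dvd_mult Irr_psum assms) auto
    thus "f dvd [:coeff P j:] * [:psum f j:] - [:coeff P j:] * (\<Sum>i<degree f. monom e (j * q ^ i))"
      by (simp only: right_diff_distrib)
  qed
qed

text \<open>By Fermat modulo \<open>f\<close> the conjugates are periodic with period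
  \<open>degree f\<close>.\<close>

lemma Tterm_shift:
  assumes "f \<in> Irr" "P \<in> KP"
  shows "f dvd Tterm P (degree f * l + i) - Tterm P i"
proof (induction l)
  case (Suc l)
  have "f dvd Tterm P (m + degree f) - Tterm P m" for m
    unfolding Tterm_def
  proof (rule sum_mod_cong)
    fix j
    have c: "coeff P j \<in> K" using KP_coeff[OF assms(2)] .
    have "monom (coeff P j) (j * q ^ m) ^ (q ^ degree f) = monom (coeff P j) (j * q ^ (m + degree f))"
      using K_frob_power[OF c] by (simp add: monom_power power_add mult.assoc)
    thus "f dvd monom (coeff P j) (j * q ^ (m + degree f)) - monom (coeff P j) (j * q ^ m)"
      using Irr_fermat[OF assms(1) monom_KP[OF c], of "j * q ^ m"] by simp
  qed
  from mod_trans[OF this[of "degree f * l + i"] Suc] show ?case by (simp add: algebra_simps)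
qed auto

text \<open>The trace from \<open>F_(q^n)\<close> of an element of the subfield of degree r is n/r
  times its trace from that subfield; here n = r l.\<close>

lemma Irr_trace_multiple:
  assumes "f \<in> Irr" "P \<in> KP"
  shows "f dvd [:of_nat l * trace_form P f:] - Tsum P (degree f * l)"
proof (induction l)
  case 0
  then show ?case by (simp add: Tsum_def)
next
  case (Suc l)
  define r where "r = degree f"
  have "Tsum P (r * Suc l) = Tsum P (r * l) + (\<Sum>i<r. Tterm P (r * l + i))"
  proof -
    have "(\<Sum>i<a + c. F i) = (\<Sum>i<a. F i) + (\<Sum>i<c. F (a + i))" for F :: "nat \<Rightarrow> 'b poly" and a c
      by (induction c) (auto simp: add.assoc)
    from this[of "Tterm P" "r * l" r] show ?thesis by (simp add: Tsum_def add.commute)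
  qed
  moreover have "f dvd (\<Sum>i<r. Tterm P i) - (\<Sum>i<r. Tterm P (r * l + i))"
    unfolding r_def by (intro sum_mod_cong mod_sym[OF Tterm_shift] assms)
  moreover have "f dvd [:trace_form P f:] - (\<Sum>i<r. Tterm P i)"
    using Irr_trace[OF assms] by (simp add: Tsum_def r_def)
  ultimately have "f dvd ([:of_nat l * trace_form P f:] - Tsum P (r * l))
      + ([:trace_form P f:] - (\<Sum>i<r. Tterm P (r * l + i)))"
    using Suc mod_trans unfolding r_def by (intro dvd_add) blast+
  thus ?case using \<open>Tsum P (r * Suc l) = _\<close> by (simp add: r_def algebra_simps)
qed

lemma Irr_fermat_power:
  assumes "f \<in> Irr" "x \<in> KP"
  shows "f dvd x ^ (q ^ (degree f * l)) - x"
proof (induction l)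
  case (Suc l)
  have "q ^ (degree f * l) > 0" by simp
  hence "x ^ (q ^ (degree f * l)) \<in> KP" using corner_power[OF assms(2)] by blast
  from mod_trans[OF Irr_fermat[OF assms(1) this] Suc] show ?case
    by (simp add: power_mult[symmetric] power_add[symmetric] algebra_simps)
qed auto

lemma Irr_prod_dvd:
  assumes "finite A" "A \<subseteq> Irr" "u \<in> KP" "\<And>f. f \<in> A \<Longrightarrow> f dvd u"
  shows "\<exists>w\<in>KP. u = prod (\<lambda>f. f) A * w"
  using assms
proof (induction A rule: finite_induct)
  case (insert f A)
  then obtain w where w: "w \<in> KP" "u = prod (\<lambda>f. f) A * w" by auto
  have f: "f \<in> Irr" "f dvd u" using insert by auto
  have "\<not> f dvd g" if "g \<in> A" for g
  proof
    assume "f dvd g"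
    moreover have "g \<in> Irr" "g \<noteq> f" using that insert.hyps insert.prems by auto
    ultimately have "f = [:e:]" using Irr_dvd_cases[of g, OF _ Irr_monics[OF f(1)]] by auto
    thus False using Irr_degree[OF f(1)] by simp
  qed
  moreover have "g \<in> KP" if "g \<in> A" for g using that insert Irr_KP by auto
  ultimately have "f dvd w"
    using Irr_dvd_prod[OF f(1) insert.hyps(1), of "\<lambda>f. f" w] w f(2) by auto
  then obtain v where v: "v \<in> KP" "w = f * v" using KP_dvdE w(1) by blast
  have "u = prod (\<lambda>f. f) (insert f A) * v"
    unfolding prod.insert[OF insert.hyps(1,2)] w(2) v(2) by (simp only: ac_simps)
  with v(1) show ?case by (rule bexI[rotated])
qed auto

section \<open>The L-function of an additive character sum\<close>

definition add_char :: "('b \<Rightarrow> complex) \<Rightarrow> bool" where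
  "add_char \<psi> \<longleftrightarrow> (\<forall>a\<in>K. \<forall>b\<in>K. \<psi> (a + b) = \<psi> a * \<psi> b) \<and> (\<forall>a\<in>K. norm (\<psi> a) = 1)"

lemma add_char_add: "add_char \<psi> \<Longrightarrow> a \<in> K \<Longrightarrow> b \<in> K \<Longrightarrow> \<psi> (a + b) = \<psi> a * \<psi> b"
  and add_char_norm: "add_char \<psi> \<Longrightarrow> a \<in> K \<Longrightarrow> norm (\<psi> a) = 1"
  by (auto simp: add_char_def)

lemma add_char_0: "add_char \<psi> \<Longrightarrow> \<psi> 0 = 1"
  using add_char_add[of \<psi> 0 0] add_char_norm[of \<psi> 0] by auto

lemma add_char_of_nat:
  assumes "add_char \<psi>" "a \<in> K"
  shows "\<psi> (of_nat l * a) = \<psi> a ^ l"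
proof (induction l)
  case (Suc l)
  have "\<psi> (of_nat (Suc l) * a) = \<psi> (a + of_nat l * a)" by (simp add: algebra_simps)
  also have "\<dots> = \<psi> a * \<psi> (of_nat l * a)" by (rule add_char_add[OF assms corner_mult2[OF assms(2)]])
  finally show ?case using Suc by simp
qed (simp add: add_char_0[OF assms(1)])

lemma add_char_sum:
  assumes "add_char \<psi>" "\<exists>c\<in>K. \<psi> c \<noteq> 1"
  shows "(\<Sum>a\<in>K. \<psi> a) = 0"
proof -
  obtain c where c: "c \<in> K" "\<psi> c \<noteq> 1" using assms(2) by auto
  have "(\<Sum>a\<in>K. \<psi> a) = (\<Sum>a\<in>K. \<psi> (c + a))"
    by (rule sum.reindex_bij_witness[of _ "\<lambda>a. c + a" "\<lambda>a. a - c"])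
       (use c in \<open>auto intro: corner_add corner_diff\<close>)
  also have "\<dots> = \<psi> c * (\<Sum>a\<in>K. \<psi> a)"
    unfolding sum_distrib_left by (intro sum.cong refl add_char_add[OF assms(1) c(1)])
  finally show ?thesis using c(2) by (metis mult_cancel_right1)
qed

definition trace_char :: "('b \<Rightarrow> complex) \<Rightarrow> 'b poly \<Rightarrow> 'b poly \<Rightarrow> complex" where
  "trace_char \<psi> P h = \<psi> (trace_form P h)"

lemma mult_char_trace_char: "add_char \<psi> \<Longrightarrow> mult_char (trace_char \<psi> P)"
  by (simp add: mult_char_def trace_char_def trace_form_mult add_char_add trace_form_K monics_KP)

lemma newton_zero: "newton (\<lambda>_. 0) j = (0 :: 'c::comm_ring_1)"
  by (subst newton.simps) simp

lemma Lcoeff_trace_char_0: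
  assumes "add_char \<psi>"
  shows "Lcoeff (trace_char \<psi> P) 0 = 1"
proof -
  have "psum [:e:] j = 0" for j
  proof -
    have "psum [:e:] j = newton (\<lambda>_. 0) j"
      unfolding psum_def by (rule newton_cong) (simp add: rcoeff_def)
    thus ?thesis by (simp add: newton_zero)
  qed
  thus ?thesis by (simp add: Lcoeff_def trace_char_def trace_form_def add_char_0[OF assms])
qed

text \<open>This connects the L-function with the sum to be estimated: the power sums of X - c are
  c^j, so its trace form is P(c).\<close>

lemma Lcoeff_trace_char_1:
  assumes "P \<in> KP" "coeff P 0 = 0"
  shows "Lcoeff (trace_char \<psi> P) 1 = (\<Sum>c\<in>K. \<psi> (poly P c))"
proof -
  have eq: "monics 1 = (\<lambda>c. [:- c, e:]) ` K"
  proof (intro equalityI subsetI)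
    fix h assume h: "h \<in> monics 1"
    have hc: "coeff h i = coeff [:- (- coeff h 0), e:] i" for i
      using h by (cases "i = 0"; cases "i = 1") (auto simp: monics_def coeff_pCons coeff_eq_0 split: nat.splits)
    hence "h = [:- (- coeff h 0), e:]" by (intro poly_eqI) blast
    thus "h \<in> (\<lambda>c. [:- c, e:]) ` K"
      using corner_uminus[OF KP_coeff[OF monics_KP[OF h]]] by (rule image_eqI)
  qed (use linear_monics in auto)
  have tf: "trace_form P [:- c, e:] = poly P c" if "c \<in> K" for c
  proof -
    have "psum [:- c, e:] j = c ^ j" if "j > 0" for j
      unfolding psum_def using e_nz that by (intro newton_linear) (auto simp: rcoeff_def)
    hence "trace_form P [:- c, e:] = (\<Sum>j=1..degree P. coeff P j * c ^ j)"
      unfolding trace_form_def by (intro sum.cong) auto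
    also have "\<dots> = (\<Sum>j\<le>degree P. coeff P j * c ^ j)"
      using assms(2) by (intro sum.mono_neutral_left) (auto simp: not_less_eq_eq)
    finally show ?thesis by (simp add: poly_altdef)
  qed
  have "inj_on (\<lambda>c. [:- c, e:]) K" by (auto simp: inj_on_def)
  thus ?thesis unfolding Lcoeff_def eq by (simp add: sum.reindex trace_char_def tf)
qed

lemma of_nat_e_nz:
  assumes "0 < d" "d < p"
  shows "of_nat d * e \<noteq> 0"
proof
  assume 0: "of_nat d * e = 0"
  have "coprime d p" using assms p_prime
    by (metis coprime_commute nat_dvd_not_less prime_imp_coprime_nat)
  hence "gcd (int d) (int p) = 1" by simp
  then obtain u v where "u * int d + v * int p = 1" using bezout_int by metis
  hence "e = of_int (u * int d + v * int p) * e" by simp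
  also have "\<dots> = of_int u * (of_nat d * e) + of_int v * (of_nat p * e)" by (simp add: algebra_simps)
  finally show False using 0 p_char e_nz by simp
qed

text \<open>Adding c X^(n-d) permutes the monic polynomials of degree n. It keeps the power sums of
  index below d and changes the one of index d by -d c, so the trace form moves by -d a c, with a
  the leading coefficient of P. As d is invertible in \<open>K\<close>, c can be chosen such that
  this shift is an element on which \<psi> is not 1; the sum then equals a nontrivial multiple of
  itself.\<close>

lemma Lcoeff_trace_char_vanish:
  assumes \<psi>: "add_char \<psi>" "\<exists>c\<in>K. \<psi> c \<noteq> 1" and P: "P \<in> KP" and d: "0 < degree P" "degree P < p" "degree P \<le> n"
  shows "Lcoeff (trace_char \<psi> P) n = 0"
proof -
  obtain c0 where c0: "c0 \<in> K" "\<psi> c0 \<noteq> 1" using \<psi>(2) by auto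
  define d a where "d = degree P" and "a = coeff P (degree P)"
  have aK: "a \<in> K" "a \<noteq> 0" using P d KP_coeff by (auto simp: a_def)
  have "of_nat d * e * a \<noteq> 0"
    using K_integral[OF corner_mult2[OF e_K] aK(1), of "of_nat d"] of_nat_e_nz d aK(2) by (auto simp: d_def)
  hence "of_nat d * a \<noteq> 0" using K_eq[OF aK(1)] by (simp add: mult.assoc)
  then obtain b where b: "b \<in> K" "of_nat d * a * b = e" using K_inv[OF corner_mult2[OF aK(1)]] by blast
  define c where "c = - (b * c0)"
  have cK: "c \<in> K" unfolding c_def by (intro corner_uminus corner_mult b)
  have dac: "of_nat d * a * c = - c0"
  proof -
    have "of_nat d * a * c = - (of_nat d * a * b * c0)" by (simp add: c_def mult.assoc)
    thus ?thesis using b(2) K_eq(1)[OF c0(1)] by simp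
  qed
  define g where "g h = h + monom c (n - d)" for h
  have g_coeff: "coeff (g h) i = (if i = n - d then coeff h i + c else coeff h i)" for h i
    by (simp add: g_def coeff_monom)
  have g: "g h \<in> monics n" if h: "h \<in> monics n" for h
  proof -
    have cn: "coeff (g h) n = e" using h d by (auto simp: g_coeff monics_coeff d_def)
    have "degree (g h) = n"
      by (rule antisym[OF degree_le le_degree])
         (use cn e_nz h d in \<open>auto simp: g_coeff monics_degree coeff_eq_0\<close>)
    moreover have "g h \<in> KP" unfolding g_def using monics_KP[OF h] cK by (intro corner_add monom_KP)
    ultimately show ?thesis using cn by (auto simp: monics_def)
  qed
  have inj: "inj_on g (monics n)" by (auto simp: inj_on_def g_def)
  have surj: "g ` monics n = monics n" using g inj monics_card by (intro endo_inj_surj) auto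
  have tg: "trace_form P (g h) = trace_form P h + c0" if h: "h \<in> monics n" for h
  proof -
    have rg: "rcoeff n (g h) i = (if i = d then rcoeff n h i + c else rcoeff n h i)" if "i \<le> n" for i
      using that d by (auto simp: rcoeff_def g_coeff d_def)
    have deg: "degree (g h) = n" "degree h = n" using g[OF h] h monics_degree by auto
    have 1: "psum (g h) j = psum h j" if "j < d" for j
      unfolding psum_def deg using that d rg by (intro newton_cong) (auto simp: d_def)
    have 2: "psum (g h) d = psum h d - of_nat d * c"
      unfolding psum_def deg using d rg by (intro newton_top) (auto simp: d_def)
    have S: "{1..degree P} = insert d {1..<d}" using d by (auto simp: d_def)
    have "trace_form P (g h) = coeff P d * (psum h d - of_nat d * c) + (\<Sum>j=1..<d. coeff P j * psum h j)"
      unfolding trace_form_def S using 1 2 by simp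
    also have "\<dots> = trace_form P h - of_nat d * a * c"
      unfolding trace_form_def S by (simp add: d_def a_def algebra_simps)
    finally show ?thesis using dac by simp
  qed
  have "Lcoeff (trace_char \<psi> P) n = (\<Sum>h\<in>monics n. trace_char \<psi> P (g h))"
    unfolding Lcoeff_def by (subst surj[symmetric]) (simp add: sum.reindex[OF inj])
  also have "\<dots> = (\<Sum>h\<in>monics n. trace_char \<psi> P h * \<psi> c0)"
    by (intro sum.cong refl)
       (simp add: trace_char_def tg add_char_add[OF \<psi>(1)] trace_form_K monics_KP c0)
  also have "\<dots> = Lcoeff (trace_char \<psi> P) n * \<psi> c0" by (simp add: Lcoeff_def sum_distrib_right)
  finally show ?thesis using c0(2) by (metis mult_cancel_left2)
qed

text \<open>Minimal polynomials of the points of \<open>F_(q^n)\<close> at which the trace of P down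
  to \<open>F_q\<close> is \<open>b\<close>; the factor \<open>n div degree f\<close> passes from
  the residue field of f to \<open>F_(q^n)\<close>.\<close>

definition trace_class :: "'b poly \<Rightarrow> nat \<Rightarrow> 'b \<Rightarrow> 'b poly set" where
  "trace_class P n b = {f \<in> Irr. degree f dvd n \<and> of_nat (n div degree f) * trace_form P f = b}"

lemma finite_Irr_dvd: "n > 0 \<Longrightarrow> finite {f \<in> Irr. degree f dvd n}"
  by (rule finite_subset[OF _ finite_Irr_le[of n]]) (auto dest: dvd_imp_le)

lemma finite_trace_class: "n > 0 \<Longrightarrow> finite (trace_class P n b)"
  by (rule finite_subset[OF _ finite_Irr_dvd[of n]]) (auto simp: trace_class_def)

lemma sum_trace_class:
  fixes F :: "'b poly \<Rightarrow> 'd::comm_monoid_add"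
  assumes "n > 0"
  shows "(\<Sum>f | f \<in> Irr \<and> degree f dvd n. F f) = (\<Sum>b\<in>K. \<Sum>f\<in>trace_class P n b. F f)"
proof -
  have "(\<Sum>b\<in>K. \<Sum>f\<in>{f \<in> {f \<in> Irr. degree f dvd n}. of_nat (n div degree f) * trace_form P f = b}. F f)
      = (\<Sum>f | f \<in> Irr \<and> degree f dvd n. F f)"
    by (rule sum.group[OF finite_Irr_dvd[OF assms] K_fin])
       (auto intro!: corner_mult2 trace_form_K Irr_KP)
  thus ?thesis by (simp add: trace_class_def conj_assoc)
qed

lemma Lsum_trace_char:
  assumes "add_char \<psi>" "n > 0"
  shows "Lsum (trace_char \<psi> P) n = (\<Sum>b\<in>K. \<psi> b * of_nat (\<Sum>f\<in>trace_class P n b. degree f))"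
proof -
  have "Lsum (trace_char \<psi> P) n = (\<Sum>b\<in>K. \<Sum>f\<in>trace_class P n b.
          of_nat (degree f) * trace_char \<psi> P f ^ (n div degree f))"
    unfolding Lsum_def by (rule sum_trace_class[OF assms(2)])
  also have "\<dots> = (\<Sum>b\<in>K. \<Sum>f\<in>trace_class P n b. \<psi> b * of_nat (degree f))"
    by (intro sum.cong refl)
       (auto simp: trace_class_def trace_char_def add_char_of_nat[OF assms(1), symmetric] trace_form_K Irr_KP)
  finally show ?thesis by (simp add: sum_distrib_left)
qed

text \<open>Distinct irreducibles are coprime, so congruences valid modulo each of them hold modulo
  their product. An empty product would be the ambient \<open>1\<close>, not the unit
  \<open>[:e:]\<close>, hence the assumption \<open>ne\<close>.\<close>

lemma trace_class_prod:
  assumes P: "P \<in> KP" and n: "n > 0" and ne: "trace_class P n b \<noteq> {}" and b: "b \<in> K"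
  obtains h where "h \<in> monics (\<Sum>f\<in>trace_class P n b. degree f)"
    "h dvd monom e (q ^ n) - monom e 1" "h dvd Tsum P n - [:b:]"
proof -
  define A where "A = trace_class P n b"
  have A: "finite A" "A \<subseteq> Irr" using finite_trace_class[OF n] by (auto simp: A_def trace_class_def)
  define h where "h = prod (\<lambda>f. f) A"
  have 1: "h \<in> monics (\<Sum>f\<in>A. degree f)"
    unfolding h_def using A ne Irr_monics by (intro monics_prod) (auto simp: A_def)
  have l: "degree f * (n div degree f) = n" if "f \<in> A" for f
    using that by (auto simp: A_def trace_class_def)
  have "f dvd monom e (q ^ n) - monom e 1" if "f \<in> A" for f
  proof -
    have "f dvd monom e 1 ^ (q ^ n) - monom e 1"
      using Irr_fermat_power[of f "monom e 1" "n div degree f"] that A l by auto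
    thus ?thesis by (simp add: monom_e_power)
  qed
  moreover have "monom e (q ^ n) - monom e 1 \<in> KP" by (intro corner_diff monom_KP e_K)
  ultimately have 2: "h dvd monom e (q ^ n) - monom e 1"
    unfolding h_def using Irr_prod_dvd[OF A] by (metis dvd_triv_left)
  have "f dvd Tsum P n - [:b:]" if f: "f \<in> A" for f
    using mod_sym[OF Irr_trace_multiple[of f P "n div degree f"]] f A l[OF f] P
    by (auto simp: A_def trace_class_def)
  moreover have "Tsum P n - [:b:] \<in> KP" using b by (intro corner_diff Tsum_KP P) (auto simp: pCons_KP)
  ultimately have 3: "h dvd Tsum P n - [:b:]"
    unfolding h_def using Irr_prod_dvd[OF A] by (metis dvd_triv_left)
  show ?thesis by (rule that[OF 1[unfolded A_def] 2 3])
qed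

end

section \<open>Bombieri's form of the Stepanov method\<close>

text \<open>Bivariate monomials c x^i y^j: x is the inner variable and y the outer one.\<close>

definition bm :: "'c::comm_ring_1 \<Rightarrow> nat \<Rightarrow> nat \<Rightarrow> 'c poly poly" where
  "bm c i j = monom (monom c i) j"

definition bc :: "'c::comm_ring_1 poly poly \<Rightarrow> nat \<Rightarrow> nat \<Rightarrow> 'c" where
  "bc v i j = coeff (coeff v j) i"

lemma bm_mult: "bm c i j * bm c' i' j' = bm (c * c') (i + i') (j + j')"
  by (simp add: bm_def mult_monom)

lemma bm_power: "bm c i j ^ n = bm (c ^ n) (i * n) (j * n)"
  by (simp add: bm_def monom_power)

lemma bc_bm: "bc (bm c k l) i j = (if i = k \<and> j = l then c else 0)"
  by (auto simp: bc_def bm_def coeff_monom)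

lemma bc_simps [simp]: "bc (u + v) i j = bc u i j + bc v i j" "bc (u - v) i j = bc u i j - bc v i j"
  "bc 0 i j = 0" "bc (- u) i j = - bc u i j"
  by (simp_all add: bc_def)

lemma bc_sum: "bc (sum F I) i j = (\<Sum>x\<in>I. bc (F x) i j)"
  by (simp add: bc_def coeff_sum)

lemma bc_eqI: "(\<And>i j. bc u i j = bc v i j) \<Longrightarrow> u = v"
  by (auto simp: bc_def intro!: poly_eqI)

lemma bc_mult: "bc (u * v) i j = (\<Sum>j'\<le>j. \<Sum>i'\<le>i. bc u i' j' * bc v (i - i') (j - j'))"
  by (simp add: bc_def coeff_mult coeff_sum)

lemma bc_bm_mult: "bc (bm c k l * v) i j = (if k \<le> i \<and> l \<le> j then c * bc v (i - k) (j - l) else 0)"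
  by (simp add: bc_def bm_def coeff_monom_mult)

lemma bivariate_sum: "v = (\<Sum>j\<le>degree v. \<Sum>i\<le>degree (coeff v j). bm (bc v i j) i j)"
proof (rule bc_eqI)
  fix i j
  have "bc (\<Sum>j\<le>degree v. \<Sum>i\<le>degree (coeff v j). bm (bc v i j) i j) i j
      = (\<Sum>j'\<le>degree v. if j' = j then (\<Sum>i'\<le>degree (coeff v j). if i' = i then bc v i j else 0) else 0)"
    unfolding bc_sum bc_bm by (intro sum.cong) (auto intro!: sum.cong sum.neutral)
  also have "\<dots> = bc v i j"
    by (auto simp: bc_def coeff_eq_0)
  finally show "bc v i j = bc (\<Sum>j\<le>degree v. \<Sum>i\<le>degree (coeff v j). bm (bc v i j) i j) i j" ..
qed

text \<open>The cofactors range over the whole ambient ring; they are projected to the corner only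
  where their coefficients matter.\<close>

definition pair_ideal :: "'c::comm_ring_1 \<Rightarrow> 'c \<Rightarrow> 'c set" where
  "pair_ideal f g = {f * a + g * b | a b. True}"

lemma pair_idealI: "f * a + g * b \<in> pair_ideal f g"
  unfolding pair_ideal_def by blast

lemma pair_ideal_fst: "f * a \<in> pair_ideal f g" and pair_ideal_snd: "g * a \<in> pair_ideal f g"
  using pair_idealI[of f a g 0] pair_idealI[of f 0 g a] by auto

lemma pair_ideal_0: "0 \<in> pair_ideal f g"
  using pair_idealI[of f 0 g 0] by simp

lemma pair_ideal_add:
  assumes "u \<in> pair_ideal f g" "v \<in> pair_ideal f g"
  shows "u + v \<in> pair_ideal f g"
proof -
  obtain a b a' b' where "u = f * a + g * b" "v = f * a' + g * b'"
    using assms unfolding pair_ideal_def by blast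
  hence "u + v = f * (a + a') + g * (b + b')" by (simp add: algebra_simps)
  thus ?thesis by (metis pair_idealI)
qed

lemma pair_ideal_mult:
  assumes "u \<in> pair_ideal f g"
  shows "u * x \<in> pair_ideal f g"
proof -
  obtain a b where "u = f * a + g * b" using assms unfolding pair_ideal_def by blast
  hence "u * x = f * (a * x) + g * (b * x)" by (simp add: algebra_simps)
  thus ?thesis by (metis pair_idealI)
qed

lemma pair_ideal_uminus: "u \<in> pair_ideal f g \<Longrightarrow> - u \<in> pair_ideal f g"
  using pair_ideal_mult[of u f g "-1"] by simp

lemma pair_ideal_sum: "(\<And>i. i \<in> I \<Longrightarrow> F i \<in> pair_ideal f g) \<Longrightarrow> sum F I \<in> pair_ideal f g"
  by (induction I rule: infinite_finite_induct) (auto intro: pair_ideal_add pair_ideal_0)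

lemma pair_ideal_trans:
  "u - v \<in> pair_ideal f g \<Longrightarrow> v - w \<in> pair_ideal f g \<Longrightarrow> u - w \<in> pair_ideal f g"
  using pair_ideal_add[of "u - v" f g "v - w"] by simp

lemma pair_ideal_power_cong:
  assumes "u - v \<in> pair_ideal f g"
  shows "u ^ n - v ^ n \<in> pair_ideal f g"
proof -
  have "u - v dvd u ^ n - v ^ n" by (rule power_mod_cong) simp
  then obtain c where "u ^ n - v ^ n = (u - v) * c" by (rule dvdE)
  thus ?thesis using pair_ideal_mult[OF assms] by simp
qed

lemma pair_ideal_mult_cong:
  assumes "u - u' \<in> pair_ideal f g" "v - v' \<in> pair_ideal f g"
  shows "u * v - u' * v' \<in> pair_ideal f g"
proof -
  have "u * v - u' * v' = (u - u') * v + (v - v') * u'" by (simp add: algebra_simps)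
  thus ?thesis using assms by (simp add: pair_ideal_add pair_ideal_mult)
qed

locale artin_schreier = finite_field_component +
  fixes P :: "'a poly"
  assumes P: "P \<in> KP" and P0: "coeff P 0 = 0" and d_pos: "0 < degree P" and d_less: "degree P < p"
begin

abbreviation "d \<equiv> degree P"
abbreviation "a \<equiv> coeff P (degree P)"
abbreviation "VK \<equiv> corner [:[:e:]:]"

lemma p_k_simps [simp]: "p \<noteq> 0" "p \<noteq> Suc 0" "k \<noteq> 0" "0 < k" "Suc 0 \<le> q" "Suc 0 < q" "q \<noteq> Suc 0"
  using p_prime k_pos q_gt1 by (auto dest: prime_gt_1_nat simp del: One_nat_def)

lemma VK_iff: "v \<in> VK \<longleftrightarrow> (\<forall>i j. bc v i j \<in> K)"
  by (auto simp: corner_poly_iff bc_def)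

lemma a_K: "a \<in> K" and a_nz: "a \<noteq> 0"
  using P d_pos by (auto simp: KP_coeff)

lemma coprime_d: "coprime d q"
proof -
  have "\<not> p dvd d" using d_pos d_less by (auto dest: dvd_imp_le)
  hence "coprime p d" using p_prime by (rule prime_imp_coprime_nat[rotated])
  thus ?thesis by (simp add: coprime_commute)
qed

text \<open>The weights of the two coordinates are the pole orders of \<open>x\<close> and \<open>y\<close> at the point at
  infinity of \<open>y^q - y = P(x)\<close>.\<close>

definition wt :: "nat \<Rightarrow> nat \<Rightarrow> 'a poly poly set" where
  "wt c m = {v \<in> VK. \<forall>i j. bc v i j \<noteq> 0 \<longrightarrow> i * q + j * d + c \<le> m}"

lemma wt_VK: "v \<in> wt c m \<Longrightarrow> v \<in> VK"
  by (simp add: wt_def)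

lemma wtD: "v \<in> wt c m \<Longrightarrow> bc v i j \<noteq> 0 \<Longrightarrow> i * q + j * d + c \<le> m"
  by (simp add: wt_def)

lemma wt_0: "0 \<in> wt c m"
  by (simp add: wt_def)

lemma wt_add: "u \<in> wt c m \<Longrightarrow> v \<in> wt c m \<Longrightarrow> u + v \<in> wt c m"
  unfolding wt_def by (auto intro!: corner_add) (metis add.right_neutral)

lemma wt_uminus: "u \<in> wt c m \<Longrightarrow> - u \<in> wt c m"
  unfolding wt_def by (auto intro!: corner_uminus)

lemma wt_diff: "u \<in> wt c m \<Longrightarrow> v \<in> wt c m \<Longrightarrow> u - v \<in> wt c m"
  using wt_add[of u c m "- v"] wt_uminus by simp

lemma wt_sum: "(\<And>i. i \<in> I \<Longrightarrow> F i \<in> wt c m) \<Longrightarrow> sum F I \<in> wt c m"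
  by (induction I rule: infinite_finite_induct) (auto intro: wt_add wt_0)

text \<open>Membership in \<open>wt c m\<close> means weight at most m - c, written additively to
  avoid truncated subtraction; for c > m only 0 remains.\<close>

lemma wt_mult:
  assumes "u \<in> wt c m" "v \<in> wt c' m'"
  shows "u * v \<in> wt (c + c') (m + m')"
proof -
  have "i * q + j * d + (c + c') \<le> m + m'" if nz: "bc (u * v) i j \<noteq> 0" for i j
  proof -
    from nz obtain j' where j': "j' \<in> {..j}" "(\<Sum>i'\<le>i. bc u i' j' * bc v (i - i') (j - j')) \<noteq> 0"
      unfolding bc_mult by (rule sum.not_neutral_contains_not_neutral)
    from j'(2) obtain i' where i': "i' \<in> {..i}" "bc u i' j' * bc v (i - i') (j - j') \<noteq> 0"
      by (rule sum.not_neutral_contains_not_neutral)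
    have "bc u i' j' \<noteq> 0" "bc v (i - i') (j - j') \<noteq> 0"
      using i'(2) by (intro notI; simp)+
    hence "i' * q + j' * d + c \<le> m" "(i - i') * q + (j - j') * d + c' \<le> m'"
      using wtD[OF assms(1), of i' j'] wtD[OF assms(2), of "i - i'" "j - j'"] by auto
    moreover have "i * q = i' * q + (i - i') * q" "j * d = j' * d + (j - j') * d"
      using i' j' by (simp_all flip: add_mult_distrib)
    ultimately show ?thesis by linarith
  qed
  thus ?thesis using corner_mult[OF wt_VK[OF assms(1)], of v] by (auto simp: wt_def)
qed

lemma wt_mult_power:
  assumes "u \<in> wt 0 m" "v \<in> wt 0 m'"
  shows "u * v ^ n \<in> wt 0 (m + n * m')"
proof (induction n)
  case (Suc n)
  from wt_mult[OF Suc assms(2)] show ?case by (simp add: algebra_simps)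
qed (use assms in simp)

lemma wt_power: "u \<in> wt 0 m \<Longrightarrow> n > 0 \<Longrightarrow> u ^ n \<in> wt 0 (n * m)"
  using wt_mult_power[of u m u m "n - 1"] by (cases n) auto

lemma wt_bm: "c \<in> K \<Longrightarrow> i * q + j * d + c' \<le> m \<Longrightarrow> bm c i j \<in> wt c' m"
  by (auto simp: wt_def VK_iff bc_bm split: if_splits)

lemma wt_mono: "v \<in> wt c m \<Longrightarrow> m \<le> m' \<Longrightarrow> v \<in> wt c m'"
  unfolding wt_def by fastforce

lemma VK_wt: "v \<in> VK \<Longrightarrow> \<exists>m. v \<in> wt 0 m"
proof -
  assume v: "v \<in> VK"
  have "i * q + j * d \<le> (\<Sum>j\<le>degree v. degree (coeff v j)) * q + degree v * d" if "bc v i j \<noteq> 0" for i j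
  proof -
    have j: "j \<le> degree v" using that by (auto simp: bc_def intro!: le_degree)
    have "i \<le> degree (coeff v j)" using that by (auto simp: bc_def intro!: le_degree)
    also have "\<dots> \<le> (\<Sum>j\<le>degree v. degree (coeff v j))" by (rule member_le_sum) (use j in auto)
    finally show ?thesis using j by (intro add_mono mult_le_mono) auto
  qed
  thus ?thesis using v by (intro exI[of _ "(\<Sum>j\<le>degree v. degree (coeff v j)) * q + degree v * d"]) (auto simp: wt_def)
qed

text \<open>The equation of the curve. Its terms y^q and a x^d both have the top weight d q, all
  other terms have smaller weight.\<close>

definition F where "F = bm e 0 q - bm e 0 1 - [:P:]"

lemma P_bm: "[:P:] = (\<Sum>i\<le>d. bm (coeff P i) i 0)"
proof (rule bc_eqI)
  fix i j
  have "bc (\<Sum>i\<le>d. bm (coeff P i) i 0) i j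
      = (\<Sum>i'\<le>d. if i' = i then (if j = 0 then coeff P i else 0) else 0)"
    unfolding bc_sum bc_bm by (intro sum.cong) auto
  also have "\<dots> = bc [:P:] i j"
    by (auto simp: bc_def coeff_pCons coeff_eq_0 split: nat.splits)
  finally show "bc [:P:] i j = bc (\<Sum>i\<le>d. bm (coeff P i) i 0) i j" ..
qed

lemma P_wt: "[:P:] \<in> wt 0 (d * q)"
  unfolding P_bm by (intro wt_sum wt_bm KP_coeff P) auto

lemma F_wt: "F \<in> wt 0 (d * q)"
  unfolding F_def by (intro wt_diff P_wt wt_bm e_K) auto

lemma F_coeff: "coeff F n = (if n = q then [:e:] else 0) - (if n = 1 then [:e:] else 0) - (if n = 0 then P else 0)"
  by (auto simp: F_def bm_def coeff_pCons monom_0 split: nat.splits)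

lemma F_degree: "degree F = q"
  by (rule antisym[OF degree_le le_degree]) (use q_gt1 e_nz in \<open>auto simp: F_coeff\<close>)

text \<open>\<open>F\<close> is monic of degree q in y, so a nonzero multiple has y-degree at least
  q.\<close>

lemma F_mult_small:
  assumes "w \<in> VK" "\<forall>j\<ge>q. coeff (F * w) j = 0"
  shows "w = 0"
proof (rule ccontr)
  assume w: "w \<noteq> 0"
  have "coeff (F * w) (q + degree w) = [:e:] * coeff w (degree w)"
    using coeff_mult_degree_sum[of F w] q_gt1 by (simp add: F_degree F_coeff)
  also have "\<dots> = coeff w (degree w)"
    using assms(1) by (intro KP_eq) (auto simp: corner_poly_iff)
  finally show False using assms(2) w by simp
qed

text \<open>Division by \<open>F\<close> with respect to y. No term of \<open>F\<close> outweighs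
  y^q, so eliminating the highest power of y does not raise the weight; the induction is on the
  excess \<open>D\<close> of the y-degree.\<close>

lemma wt_reduce:
  assumes "v \<in> wt 0 m"
  shows "\<exists>v' w. v = v' + F * w \<and> v' \<in> wt 0 m \<and> (\<forall>j\<ge>q. coeff v' j = 0) \<and> w \<in> wt (d * q) m"
proof -
  have "\<exists>v' w. v = v' + F * w \<and> v' \<in> wt 0 m \<and> (\<forall>j\<ge>q. coeff v' j = 0) \<and> w \<in> wt (d * q) m"
    if "\<forall>j\<ge>q + D. coeff v j = 0" "v \<in> wt 0 m" for D v
    using that
  proof (induction D arbitrary: v)
    case 0
    then show ?case by (intro exI[of _ v] exI[of _ 0]) (auto simp: wt_0)
  next
    case (Suc D)
    define u where "u = coeff v (q + D)"
    have uK: "u \<in> KP" using wt_VK[OF Suc.prems(2)] by (auto simp: u_def corner_poly_iff)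
    have w: "monom u D \<in> wt (d * q) m"
    proof -
      have "i * q + j * d + d * q \<le> m" if "bc (monom u D) i j \<noteq> 0" for i j
      proof -
        have ij: "j = D" "coeff u i \<noteq> 0" using that by (auto simp: bc_def coeff_monom split: if_splits)
        hence "i * q + (q + D) * d + 0 \<le> m"
          using wtD[OF Suc.prems(2), of i "q + D"] by (auto simp: bc_def u_def)
        thus ?thesis using ij by (simp add: algebra_simps)
      qed
      moreover have "monom u D \<in> VK" using uK by (auto simp: corner_poly_iff coeff_monom)
      ultimately show ?thesis by (auto simp: wt_def)
    qed
    have Fw: "F * monom u D \<in> wt 0 m"
      using wt_mult[OF F_wt w] by (auto simp: wt_def)
    have c: "coeff (F * monom u D) j = (if j < D then 0 else u * coeff F (j - D))" for j
      by (simp add: coeff_monom_mult mult.commute[of F])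
    have "coeff (v - F * monom u D) j = 0" if "j \<ge> q + D" for j
    proof (cases "j = q + D")
      case True
      then show ?thesis using KP_eq(2)[OF uK] by (simp add: c F_coeff u_def[symmetric])
    next
      case False
      then have jD: "j > q + D" using that by linarith
      hence "coeff v j = 0" using Suc.prems(1) by simp
      moreover have "j - D \<noteq> q" "j - D \<noteq> 1" "j - D \<noteq> 0" "\<not> j < D"
        using jD q_gt1 by linarith+
      ultimately show ?thesis by (simp add: c F_coeff)
    qed
    then obtain v' w' where IH: "v - F * monom u D = v' + F * w'" "v' \<in> wt 0 m"
        "\<forall>j\<ge>q. coeff v' j = 0" "w' \<in> wt (d * q) m"
      using Suc.IH[of "v - F * monom u D"] wt_diff[OF Suc.prems(2) Fw] by blast
    have "v = v' + F * (w' + monom u D)" using IH(1) by (simp add: algebra_simps)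
    thus ?case using IH wt_add[OF IH(4) w] by blast
  qed
  from this[of "degree v + 1" v] show ?thesis using assms by (auto simp: coeff_eq_0)
qed

section \<open>Reduced functions on the curve, counted by pole order\<close>

definition can :: "nat \<Rightarrow> 'a poly poly set" where
  "can m = {v \<in> wt 0 m. \<forall>j\<ge>q. coeff v j = 0}"

definition idx :: "nat \<Rightarrow> (nat \<times> nat) set" where
  "idx m = {(i, j). j < q \<and> i * q + j * d \<le> m}"

lemma finite_idx: "finite (idx m)"
proof -
  have "i \<le> m" if "i * q + j * d \<le> m" for i j
  proof -
    have "i * 1 \<le> i * q" using q_gt1 by (intro mult_le_mono) auto
    thus ?thesis using that by linarith
  qed
  hence "idx m \<subseteq> {..m} \<times> {..<q}" by (auto simp: idx_def)
  thus ?thesis by (rule finite_subset) auto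
qed

text \<open>Equal weights force q to divide (j' - j) d, and d is coprime to q while j' - j is
  smaller than q in absolute value.\<close>

lemma inj_weight:
  assumes "i * q + j * d = i' * q + j' * d" "j < q" "j' < q"
  shows "i = i' \<and> j = j'"
proof -
  have "j = j'" if "i * q + j * d = i' * q + j' * d" "j < q" "j' < q" "j \<le> j'" for i i' j j'
  proof -
    have "(j' - j) * d = j' * d - j * d" by (simp add: diff_mult_distrib)
    also have "\<dots> = i * q - i' * q" using that(1) mult_le_mono1[OF that(4), of d] by linarith
    also have "\<dots> = (i - i') * q" by (simp add: diff_mult_distrib)
    finally have "q dvd (j' - j) * d" by simp
    hence "q dvd j' - j"
      using coprime_d by (metis coprime_commute coprime_dvd_mult_left_iff)
    moreover have "j' - j < q" using that by simp
    ultimately have "j' - j = 0" by (meson dvd_imp_le not_le neq0_conv)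
    thus ?thesis using that by simp
  qed
  hence "j = j'" using assms by (metis nat_le_linear)
  thus ?thesis using assms(1) q_gt1 by simp
qed

text \<open>A crude Riemann-Roch estimate for functions with poles only at infinity. Distinct pole
  orders give the upper bound. For the lower one, every n >= d q is a pole order: choose j < q with
  j d congruent to n modulo q, and then j d <= q d <= n leaves a nonnegative multiple of q.\<close>

lemma card_idx: "card (idx m) \<le> m + 1" "m + 1 \<le> card (idx m) + d * q"
proof -
  define w where "w = (\<lambda>(i, j). i * q + j * d)"
  have inj: "inj_on w (idx m)" by (auto simp: inj_on_def w_def idx_def dest: inj_weight)
  have "card (idx m) = card (w ` idx m)" using inj by (simp add: card_image)
  also have "\<dots> \<le> card {..m}" by (rule card_mono) (auto simp: w_def idx_def)
  finally show "card (idx m) \<le> m + 1" by simp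
  have "n \<in> w ` idx m" if n: "n \<in> {d * q..m}" for n
  proof -
    have "inj_on (\<lambda>j. j * d mod q) {..<q}"
    proof -
      have *: "j = j'" if "j * d mod q = j' * d mod q" "j < q" "j' < q" "j \<le> j'" for j j'
      proof -
        have "q dvd j' * d - j * d" using that(1) mult_le_mono1[OF that(4), of d] by (metis mod_eq_dvd_iff_nat)
        hence "q dvd (j' - j) * d" by (simp add: diff_mult_distrib)
        hence "q dvd j' - j"
          using coprime_d by (metis coprime_commute coprime_dvd_mult_left_iff)
        moreover have "j' - j < q" using that by simp
        ultimately have "j' - j = 0" by (meson dvd_imp_le not_le neq0_conv)
        thus ?thesis using that by simp
      qed
      show ?thesis
      proof (rule inj_onI)
        fix x y assume "x \<in> {..<q}" "y \<in> {..<q}" "x * d mod q = y * d mod q"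
        thus "x = y" using *[of x y] *[of y x] by (cases "x \<le> y") auto
      qed
    qed
    hence "(\<lambda>j. j * d mod q) ` {..<q} = {..<q}" by (intro endo_inj_surj) auto
    moreover have "n mod q \<in> {..<q}" by simp
    ultimately have "n mod q \<in> (\<lambda>j. j * d mod q) ` {..<q}" by (simp only:)
    then obtain j where "n mod q = j * d mod q" "j \<in> {..<q}" by (rule imageE)
    hence j: "j < q" "j * d mod q = n mod q" by simp_all
    have "j * d \<le> q * d" using j by (intro mult_le_mono) auto
    also have "q * d = d * q" by (rule mult.commute)
    also have "\<dots> \<le> n" using n by simp
    finally have jd: "j * d \<le> n" .
    have "q dvd n - j * d" by (rule mod_eq_dvd_iff_nat[OF jd, THEN iffD1, OF j(2)[symmetric]])
    then obtain i where "n - j * d = q * i" by (rule dvdE)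
    hence "n = w (i, j)" using jd by (simp add: w_def mult.commute)
    thus ?thesis using j n by (intro image_eqI[of _ _ "(i, j)"]) (auto simp: idx_def w_def)
  qed
  hence "card {d * q..m} \<le> card (w ` idx m)" by (intro card_mono finite_imageI finite_idx) auto
  thus "m + 1 \<le> card (idx m) + d * q" using inj by (simp add: card_image)
qed

lemma card_can: "finite (can m)" "card (can m) = q ^ card (idx m)"
proof -
  define B where "B = idx m \<rightarrow>\<^sub>E K"
  define f where "f v = restrict (\<lambda>(i, j). bc v i j) (idx m)" for v :: "'a poly poly"
  define g where "g c = (\<Sum>(i, j)\<in>idx m. bm (c (i, j)) i j)" for c :: "nat \<times> nat \<Rightarrow> 'a"
  have bcg: "bc (g c) i j = (if (i, j) \<in> idx m then c (i, j) else 0)" for c i j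
  proof -
    have "bc (g c) i j = (\<Sum>x\<in>idx m. if x = (i, j) then c (i, j) else 0)"
      unfolding g_def bc_sum by (intro sum.cong) (auto simp: bc_bm split: if_splits)
    thus ?thesis using finite_idx by simp
  qed
  have out: "bc v i j = 0" if "v \<in> can m" "(i, j) \<notin> idx m" for v i j
  proof (rule ccontr)
    assume nz: "bc v i j \<noteq> 0"
    have "j < q" using that(1) nz by (auto simp: can_def bc_def not_le[symmetric])
    thus False using that wtD[OF _ nz, of 0 m] by (auto simp: can_def idx_def)
  qed
  have fB: "f v \<in> B" if "v \<in> can m" for v
    using wt_VK[of v 0 m] that by (auto simp: B_def f_def can_def VK_iff)
  have gC: "g c \<in> can m" if c: "c \<in> B" for c
  proof -
    have "g c \<in> wt 0 m" using c
      unfolding g_def by (intro wt_sum) (auto simp: B_def idx_def intro!: wt_bm)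
    moreover have "coeff (g c) j = 0" if "j \<ge> q" for j
      by (rule poly_eqI) (use bcg[of c _ j] that in \<open>auto simp: bc_def idx_def\<close>)
    ultimately show ?thesis by (simp add: can_def)
  qed
  have "bij_betw f (can m) B"
  proof (rule bij_betw_byWitness[of _ g])
    show "\<forall>v\<in>can m. g (f v) = v"
      using out by (auto intro!: bc_eqI simp: bcg f_def)
    show "\<forall>c\<in>B. f (g c) = c"
      by (auto simp: f_def bcg B_def fun_eq_iff PiE_def extensional_def restrict_def)
  qed (use fB gC in auto)
  moreover have "finite B" "card B = q ^ card (idx m)"
    unfolding B_def using finite_idx K_fin K_card by (auto intro!: finite_PiE simp: card_PiE)
  ultimately show "finite (can m)" "card (can m) = q ^ card (idx m)"
    using bij_betw_finite bij_betw_same_card by metis+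
qed

lemma can_diff: "u \<in> can m \<Longrightarrow> v \<in> can m \<Longrightarrow> u - v \<in> can m"
  by (auto simp: can_def wt_diff)

text \<open>The coefficient of t^m after the substitution x = t^q, y = a t^d. Since a^q = a, it
  sends the top part y^q - a x^d of \<open>F\<close> to 0, so leading coefficients at infinity
  survive reduction modulo \<open>F\<close>.\<close>

definition lead :: "nat \<Rightarrow> 'a poly poly \<Rightarrow> 'a" where
  "lead m v = (\<Sum>(i, j) | i * q + j * d = m. bc v i j * a ^ j)"

lemma finite_weight_eq: "finite {(i, j). i * q + j * d = m}"
proof -
  have "i \<le> m \<and> j \<le> m" if "i * q + j * d = m" for i j
  proof -
    have "i * 1 \<le> i * q" "j * 1 \<le> j * d" using q_gt1 d_pos by (intro mult_le_mono; simp)+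
    thus ?thesis using that by linarith
  qed
  hence "{(i, j). i * q + j * d = m} \<subseteq> {..m} \<times> {..m}" by auto
  thus ?thesis by (rule finite_subset) auto
qed

lemma lead_add: "lead m (u + v) = lead m u + lead m v"
  and lead_diff: "lead m (u - v) = lead m u - lead m v"
  by (simp_all add: lead_def split_beta distrib_right left_diff_distrib sum.distrib sum_subtractf)

lemma lead_0 [simp]: "lead m 0 = 0"
  by (simp add: lead_def)

lemma lead_sum: "lead m (sum G I) = (\<Sum>x\<in>I. lead m (G x))"
  by (induction I rule: infinite_finite_induct) (auto simp: lead_add)

lemma lead_eq_0: "v \<in> wt c m' \<Longrightarrow> m' < m + c \<Longrightarrow> lead m v = 0"
proof -
  assume *: "v \<in> wt c m'" "m' < m + c"
  have "bc v i j = 0" if "i * q + j * d = m" for i j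
  proof (rule ccontr)
    assume "bc v i j \<noteq> 0"
    thus False using wtD[OF *(1)] *(2) that by fastforce
  qed
  thus ?thesis unfolding lead_def by (intro sum.neutral) auto
qed

lemma lead_bm_mult:
  "lead m (bm c i0 j0 * v) = (if i0 * q + j0 * d \<le> m then c * a ^ j0 * lead (m - (i0 * q + j0 * d)) v else 0)"
proof (cases "i0 * q + j0 * d \<le> m")
  case True
  have "lead m (bm c i0 j0 * v)
      = (\<Sum>(i, j)\<in>{x\<in>{(i, j). i * q + j * d = m}. i0 \<le> fst x \<and> j0 \<le> snd x}. c * bc v (i - i0) (j - j0) * a ^ j)"
    unfolding lead_def bc_bm_mult
    by (rule sum.mono_neutral_cong_right[OF finite_weight_eq]) (auto split: if_splits)
  also have "\<dots> = (\<Sum>(i, j) | i * q + j * d = m - (i0 * q + j0 * d). c * a ^ j0 * (bc v i j * a ^ j))"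
  proof (rule sum.reindex_bij_witness[of _ "\<lambda>(i, j). (i + i0, j + j0)" "\<lambda>(i, j). (i - i0, j - j0)"])
    fix x assume "x \<in> {x\<in>{(i, j). i * q + j * d = m}. i0 \<le> fst x \<and> j0 \<le> snd x}"
    then obtain i j where x: "x = (i, j)" "i * q + j * d = m" "i0 \<le> i" "j0 \<le> j" by auto
    obtain i' j' where ij: "i = i0 + i'" "j = j0 + j'" using x by (metis le_add_diff_inverse)
    show "(case case x of (i, j) \<Rightarrow> (i - i0, j - j0) of (i, j) \<Rightarrow> (i + i0, j + j0)) = x"
      using x by simp
    show "(case x of (i, j) \<Rightarrow> (i - i0, j - j0)) \<in> {(i, j). i * q + j * d = m - (i0 * q + j0 * d)}"
      using x(2) unfolding x(1) ij by (simp add: algebra_simps)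
    show "(case case x of (i, j) \<Rightarrow> (i - i0, j - j0) of (i, j) \<Rightarrow> c * a ^ j0 * (bc v i j * a ^ j)) =
          (case x of (i, j) \<Rightarrow> c * bc v (i - i0) (j - j0) * a ^ j)"
      unfolding x(1) ij by (simp add: power_add ac_simps)
  qed (use True in \<open>auto simp: algebra_simps\<close>)
  also have "\<dots> = c * a ^ j0 * lead (m - (i0 * q + j0 * d)) v"
    by (simp add: lead_def sum_distrib_left split_beta)
  finally show ?thesis using True by simp
next
  case False
  have "bc (bm c i0 j0 * v) i j = 0" if "i * q + j * d = m" for i j
  proof -
    have "\<not> (i0 \<le> i \<and> j0 \<le> j)"
    proof
      assume "i0 \<le> i \<and> j0 \<le> j"
      hence "i0 * q + j0 * d \<le> i * q + j * d" by (intro add_mono mult_le_mono) auto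
      thus False using False that by simp
    qed
    thus ?thesis by (simp only: bc_bm_mult if_False)
  qed
  thus ?thesis using False unfolding lead_def by (auto intro!: sum.neutral)
qed

text \<open>As \<open>w\<close> has weight at most m - d q, only y^q and a x^d can contribute in
  weight m, and these two contributions cancel because a^q = a.\<close>

lemma lead_F_mult:
  assumes "w \<in> wt (d * q) m"
  shows "lead m (F * w) = 0"
proof -
  have qd: "d < d * q" using q_gt1 d_pos by simp
  have e_lead: "e * x = x" if "x \<in> K" for x using that by (rule corner_mult_id)
  have leadK: "lead n w \<in> K" for n
    unfolding lead_def using wt_VK[OF assms]
    by (intro corner_sum) (auto simp: VK_iff intro!: corner_mult)
  have "F * w = bm e 0 q * w - bm e 0 1 * w - (\<Sum>i\<le>d. bm (coeff P i) i 0 * w)"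
    unfolding F_def P_bm by (simp add: algebra_simps sum_distrib_left)
  hence "lead m (F * w) = lead m (bm e 0 q * w) - lead m (bm e 0 1 * w)
       - (\<Sum>i\<le>d. lead m (bm (coeff P i) i 0 * w))"
    by (simp add: lead_diff lead_sum)
  also have "lead m (bm e 0 1 * w) = 0"
  proof (cases "d \<le> m")
    case True
    hence "m < m - d + d * q" using qd by linarith
    thus ?thesis using lead_eq_0[OF assms, of "m - d"] by (simp add: lead_bm_mult)
  qed (simp add: lead_bm_mult)
  also have "(\<Sum>i\<le>d. lead m (bm (coeff P i) i 0 * w)) = (\<Sum>i\<le>d. if i = d then lead m (bm a d 0 * w) else 0)"
  proof (rule sum.cong[OF refl])
    fix i assume i: "i \<in> {..d}"
    show "lead m (bm (coeff P i) i 0 * w) = (if i = d then lead m (bm a d 0 * w) else 0)"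
    proof (cases "i = d")
      case False
      hence "i * q < d * q" using i q_gt1 by simp
      hence "i * q \<le> m \<Longrightarrow> m < m - i * q + d * q" by linarith
      hence "lead m (bm (coeff P i) i 0 * w) = 0"
        using lead_eq_0[OF assms, of "m - i * q"] by (auto simp: lead_bm_mult)
      thus ?thesis using False by simp
    qed simp
  qed
  also have "\<dots> = lead m (bm a d 0 * w)" by simp
  also have "lead m (bm e 0 q * w) - 0 - lead m (bm a d 0 * w) = 0"
    using K_frob[OF a_K] e_lead[OF corner_mult[OF a_K]]
    by (simp add: lead_bm_mult mult.commute[of q d] mult.assoc)
  finally show ?thesis .
qed

lemma K_power_mult_nz: "c \<in> K \<Longrightarrow> c \<noteq> 0 \<Longrightarrow> x \<in> K \<Longrightarrow> x \<noteq> 0 \<Longrightarrow> c ^ n * x \<noteq> 0"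
proof (induction n)
  case (Suc n)
  have "c ^ n * x \<in> K" using Suc by (intro corner_mult2)
  from K_integral[OF Suc.prems(1) this] Suc show ?case by (auto simp: mult.assoc)
qed auto

text \<open>The monomials of a reduced function have distinct weights, so its top weight is attained
  once and nothing can cancel.\<close>

lemma lead_can_nz:
  assumes "v \<in> can l" "v \<noteq> 0"
  obtains m where "m \<le> l" "v \<in> wt 0 m" "lead m v \<in> K" "lead m v \<noteq> 0"
proof -
  define S where "S = {(i, j). bc v i j \<noteq> 0}"
  have S: "S \<subseteq> idx l"
  proof
    fix x assume "x \<in> S"
    then obtain i j where x: "x = (i, j)" "bc v i j \<noteq> 0" by (auto simp: S_def)
    have "j < q" using assms(1) x by (auto simp: can_def bc_def not_le[symmetric])
    thus "x \<in> idx l" using assms(1) wtD[OF _ x(2), of 0 l] x by (auto simp: can_def idx_def)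
  qed
  hence fin: "finite S" using finite_idx finite_subset by blast
  have ne: "S \<noteq> {}"
  proof
    assume "S = {}"
    hence "v = 0" by (intro bc_eqI) (auto simp: S_def)
    thus False using assms by simp
  qed
  define m where "m = Max ((\<lambda>(i, j). i * q + j * d) ` S)"
  have "m \<in> (\<lambda>(i, j). i * q + j * d) ` S" unfolding m_def using fin ne by (intro Max_in) auto
  then obtain i0 j0 where ij0: "(i0, j0) \<in> S" "m = i0 * q + j0 * d" by auto
  have le: "i * q + j * d \<le> m" if "bc v i j \<noteq> 0" for i j
    unfolding m_def by (rule Max_ge) (use fin that in \<open>auto simp: S_def intro!: image_eqI[of _ _ "(i, j)"]\<close>)
  have vV: "v \<in> VK" using assms(1) wt_VK by (auto simp: can_def)
  have "lead m v = (\<Sum>x | case x of (i, j) \<Rightarrow> i * q + j * d = m. if x = (i0, j0) then bc v i0 j0 * a ^ j0 else 0)"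
    unfolding lead_def
  proof (rule sum.cong[OF refl])
    fix x assume "x \<in> {(i, j). i * q + j * d = m}"
    then obtain i j where x: "x = (i, j)" "i * q + j * d = m" by auto
    show "(case x of (i, j) \<Rightarrow> bc v i j * a ^ j) = (if x = (i0, j0) then bc v i0 j0 * a ^ j0 else 0)"
    proof (cases "bc v i j = 0")
      case False
      hence "(i, j) \<in> idx l" using S by (auto simp: S_def)
      hence "i = i0 \<and> j = j0" using inj_weight[of i j i0 j0] x ij0 S by (auto simp: idx_def)
      thus ?thesis using x by simp
    next
      case True
      then show ?thesis using x ij0 by (auto simp: S_def)
    qed
  qed
  also have "\<dots> = bc v i0 j0 * a ^ j0"
    using ij0 finite_weight_eq[of m] by (subst sum.delta) auto
  finally have lead: "lead m v = bc v i0 j0 * a ^ j0" .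
  have bK: "bc v i0 j0 \<in> K" "bc v i0 j0 \<noteq> 0" using vV ij0 by (auto simp: VK_iff S_def)
  show ?thesis
  proof (rule that[of m])
    show "m \<le> l" using S ij0 by (auto simp: idx_def)
    show "v \<in> wt 0 m" using le vV by (auto simp: wt_def)
    show "lead m v \<in> K" unfolding lead by (intro corner_mult bK)
    show "lead m v \<noteq> 0" unfolding lead
      using K_power_mult_nz[OF a_K a_nz bK, of j0] by (simp add: mult.commute)
  qed
qed

end

section \<open>Frobenius on the curve and the Stepanov estimate\<close>

context artin_schreier begin

abbreviation "y \<equiv> bm e 0 1"
abbreviation "cc b \<equiv> [:[:b:]:]"

lemma p_kill_VK: "v \<in> VK \<Longrightarrow> of_nat p * v = 0"
  by (rule corner_kill[of p "[:[:e:]:]"]) (use p_char in \<open>simp_all add: of_nat_poly mult.commute\<close>)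

lemma bm_VK: "c \<in> K \<Longrightarrow> bm c i j \<in> VK"
  by (auto simp: VK_iff bc_bm)

lemma const_VK: "u \<in> KP \<Longrightarrow> [:u:] \<in> VK"
  by (auto simp: corner_poly_iff[of _ "[:e:]"] coeff_pCons split: nat.splits)

lemma cc_VK: "b \<in> K \<Longrightarrow> cc b \<in> VK"
  by (intro const_VK) (auto simp: pCons_KP)

lemma VK_mult_e: "v \<in> VK \<Longrightarrow> cc e * v = v"
  by (rule corner_mult_id)

lemma frob_add: "u \<in> VK \<Longrightarrow> v \<in> VK \<Longrightarrow> (u + v) ^ (p ^ n) = u ^ (p ^ n) + v ^ (p ^ n)"
  by (intro freshman_power p_prime p_kill_VK)

lemma frob_diff: "u \<in> VK \<Longrightarrow> v \<in> VK \<Longrightarrow> (u - v) ^ (p ^ n) = u ^ (p ^ n) - v ^ (p ^ n)"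
  using frob_add[of u "- v" n] freshman_power_uminus[OF p_prime p_kill_VK, of v n] by (simp add: corner_uminus)

lemma frob_add_q: "u \<in> VK \<Longrightarrow> v \<in> VK \<Longrightarrow> (u + v) ^ (q ^ n) = u ^ (q ^ n) + v ^ (q ^ n)"
  using frob_add[of u v "k * n"] by (simp add: power_mult)

lemma frob_diff_q: "u \<in> VK \<Longrightarrow> v \<in> VK \<Longrightarrow> (u - v) ^ (q ^ n) = u ^ (q ^ n) - v ^ (q ^ n)"
  using frob_diff[of u v "k * n"] by (simp add: power_mult)

lemma frob_sum_q:
  assumes "\<And>i. i \<in> I \<Longrightarrow> G i \<in> VK"
  shows "(sum G I) ^ (q ^ n) = (\<Sum>i\<in>I. G i ^ (q ^ n))"
  using freshman_power_sum[OF p_prime, of I G "k * n"] assms by (simp add: power_mult p_kill_VK)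

lemma frob_KP_sum_q:
  assumes "\<And>i. i \<in> I \<Longrightarrow> G i \<in> KP"
  shows "(sum G I) ^ (q ^ n) = (\<Sum>i\<in>I. G i ^ (q ^ n))"
  using freshman_power_sum[OF p_prime, of I G "k * n"] assms
  by (simp add: power_mult corner_kill[OF p_char_E])

lemma Tterm_frob: "Tterm P i ^ q = Tterm P (Suc i)"
proof -
  have "Tterm P i ^ (q ^ 1) = (\<Sum>j=1..d. monom (coeff P j) (j * q ^ i) ^ (q ^ 1))"
    unfolding Tterm_def by (rule frob_KP_sum_q) (intro monom_KP KP_coeff P)
  also have "\<dots> = Tterm P (Suc i)"
    unfolding Tterm_def using K_frob[OF KP_coeff[OF P]]
    by (intro sum.cong) (auto simp: monom_power ac_simps)
  finally show ?thesis by simp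
qed

lemma Tterm_0: "Tterm P 0 = P"
proof -
  have "Tterm P 0 = (\<Sum>j\<le>d. monom (coeff P j) j)"
    unfolding Tterm_def using P0
    by (simp, intro sum.mono_neutral_left) (auto simp: not_less_eq_eq)
  thus ?thesis by (simp add: poly_as_sum_of_monoms)
qed

lemma Tsum_Suc_frob: "Tsum P n ^ q + P = Tsum P (Suc n)"
proof -
  have "Tsum P n ^ (q ^ 1) = (\<Sum>i<n. Tterm P i ^ (q ^ 1))"
    unfolding Tsum_def by (rule frob_KP_sum_q) (rule Tterm_KP[OF P])
  hence "Tsum P n ^ q = (\<Sum>i<n. Tterm P (Suc i))" by (simp add: Tterm_frob)
  thus ?thesis unfolding Tsum_def by (subst sum.lessThan_Suc_shift) (simp add: Tterm_0 add.commute)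
qed

lemma const_power: "[:u:] ^ n = [:u ^ n:]"
  by (induction n) (auto simp: mult.commute one_pCons)

lemma e_pow_q: "e ^ (q ^ n) = e"
  by (rule e_power) simp

text \<open>On the curve y^q = y + P(x), and each further Frobenius adds the next conjugate of
  P.\<close>

lemma y_frob: "bm e 0 (q ^ n) - (y + [:Tsum P n:]) \<in> pair_ideal F g"
proof (induction n)
  case 0
  then show ?case by (simp add: Tsum_def pair_ideal_0)
next
  case (Suc n)
  have 1: "bm e 0 (q ^ n) ^ q = bm e 0 (q ^ Suc n)"
    using e_pow_q[of 1] by (simp add: bm_power mult.commute)
  have "(y + [:Tsum P n:]) ^ (q ^ 1) = y ^ (q ^ 1) + [:Tsum P n:] ^ (q ^ 1)"
    by (intro frob_add_q bm_VK e_K const_VK Tsum_KP P)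
  hence 2: "(y + [:Tsum P n:]) ^ q = bm e 0 q + [:Tsum P n ^ q:]"
    using e_pow_q[of 1] by (simp add: bm_power const_power)
  have "bm e 0 q + [:Tsum P n ^ q:] - (y + [:Tsum P (Suc n):]) = F * 1"
    unfolding F_def Tsum_Suc_frob[symmetric] by (simp add: algebra_simps)
  hence 3: "bm e 0 q + [:Tsum P n ^ q:] - (y + [:Tsum P (Suc n):]) \<in> pair_ideal F g"
    by (metis pair_ideal_fst)
  show ?case
    using pair_ideal_trans[OF pair_ideal_power_cong[OF Suc, of q, unfolded 1 2] 3] .
qed

text \<open>Modulo \<open>F\<close> and a divisor \<open>h\<close> of \<open>X^(q^n) - X\<close> and \<open>T_n - b\<close>, the \<open>q^n\<close>-power map sends
  \<open>x, y\<close> to \<open>x, y + b\<close>; its \<open>p\<close>-th iterate is therefore the identity, and the quotient is reduced.\<close>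

context
  fixes h n b
  assumes h1: "h dvd monom e (q ^ n) - monom e 1" and h2: "h dvd Tsum P n - [:b:]" and bK: "b \<in> K"
begin

abbreviation "J \<equiv> pair_ideal F [:h:]"

lemma const_dvd_J: "h dvd u \<Longrightarrow> [:u:] \<in> J"
proof -
  assume "h dvd u"
  then obtain c where "u = h * c" by (rule dvdE)
  hence "[:u:] = [:h:] * [:c:]" by (simp add: mult.commute)
  thus ?thesis by (simp only: pair_ideal_snd)
qed

lemma x_J: "bm e (i * q ^ n) 0 - bm e i 0 \<in> J"
proof (cases "i = 0")
  case False
  have "bm e (q ^ n) 0 - bm e 1 0 \<in> J"
    using const_dvd_J[OF h1] by (simp add: bm_def monom_0)
  from pair_ideal_power_cong[OF this, of i] show ?thesis
    using False by (simp add: bm_power e_power mult.commute)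
qed (simp add: pair_ideal_0)

lemma y_J: "bm e 0 (q ^ n) - (y + cc b) \<in> J"
proof (rule pair_ideal_trans[OF y_frob[of n "[:h:]"]])
  show "y + [:Tsum P n:] - (y + cc b) \<in> J"
    using const_dvd_J[OF h2] by simp
qed

lemma xy_J: "bm e (i * q ^ n) (j * q ^ n) - bm e i 0 * (y + cc b) ^ j \<in> J"
proof -
  have "bm e (i * q ^ n) (j * q ^ n) = bm e (i * q ^ n) 0 * bm e 0 (q ^ n) ^ j"
  proof (cases "j = 0")
    case False
    then show ?thesis by (simp add: bm_power bm_mult e_power idem mult.commute)
  qed simp
  thus ?thesis using pair_ideal_mult_cong[OF x_J[of i] pair_ideal_power_cong[OF y_J, of j]] by simp
qed

lemma y_J_iter: "bm e 0 (q ^ (n * t)) - (y + of_nat t * cc b) \<in> J"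
proof (induction t)
  case (Suc t)
  have 1: "bm e 0 (q ^ (n * t)) ^ (q ^ n) = bm e 0 (q ^ (n * Suc t))"
    using e_pow_q[of n] by (simp add: bm_power power_add mult.commute)
  have "of_nat t * cc b = cc (of_nat t * b)" by (simp add: of_nat_poly mult.commute)
  moreover have tb: "of_nat t * b \<in> K" using bK by (rule corner_mult2)
  ultimately have "(y + of_nat t * cc b) ^ (q ^ n) = y ^ (q ^ n) + cc (of_nat t * b) ^ (q ^ n)"
    by (simp only: frob_add_q[OF bm_VK[OF e_K] cc_VK[OF tb]])
  also have "cc (of_nat t * b) ^ (q ^ n) = of_nat t * cc b"
    using K_frob_power[OF tb, of n] \<open>of_nat t * cc b = _\<close> by (simp add: const_power)
  also have "y ^ (q ^ n) = bm e 0 (q ^ n)"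
    using e_pow_q[of n] by (simp add: bm_power)
  finally have 2: "(y + of_nat t * cc b) ^ (q ^ n) = bm e 0 (q ^ n) + of_nat t * cc b" .
  have 3: "bm e 0 (q ^ n) + of_nat t * cc b - (y + of_nat (Suc t) * cc b) \<in> J"
  proof -
    have "A + T * C - (Y + (1 + T) * C) = A - (Y + C)" for A T C Y :: "'a poly poly"
      by (simp add: algebra_simps)
    thus ?thesis using y_J by (simp only: of_nat_Suc)
  qed
  show ?case using pair_ideal_trans[OF pair_ideal_power_cong[OF Suc, of "q ^ n", unfolded 1 2] 3] .
qed (simp add: pair_ideal_0)

lemma x_J_iter: "bm e (q ^ (n * t)) 0 - bm e 1 0 \<in> J"
proof (induction t)
  case (Suc t)
  from pair_ideal_trans[OF x_J[of "q ^ (n * t)"] Suc] show ?case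
    by (simp add: power_add mult.commute)
qed (simp add: pair_ideal_0)

lemma frob_J:
  assumes "v \<in> VK"
  shows "v ^ (q ^ (n * p)) - v \<in> J"
proof -
  let ?N = "q ^ (n * p)"
  have N0: "?N > 0" by simp
  have y: "bm e 0 ?N - y \<in> J"
    using y_J_iter[of p] p_kill_VK[OF cc_VK[OF bK]] by simp
  have mon: "bm c i j ^ ?N - bm c i j \<in> J" if c: "c \<in> K" for c i j
  proof -
    have cp: "c ^ ?N = c" using K_frob_power[OF c] .
    \<comment> \<open>For exponent 0 the power is the ambient \<open>1\<close>; the coefficient
      \<open>c\<close> absorbs both cases.\<close>
    have e: "c * e ^ i' = c" for i' using K_eq[OF c] by (cases "i' = 0") (auto simp: e_power)
    have 1: "bm c i j ^ ?N = bm c 0 0 * (bm e ?N 0 ^ i * bm e 0 ?N ^ j)"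
      using e cp by (simp add: bm_power bm_mult mult.assoc[symmetric] mult.commute[of _ ?N])
    have 2: "bm c i j = bm c 0 0 * (bm e 1 0 ^ i * y ^ j)"
      using e by (simp add: bm_power bm_mult mult.assoc[symmetric])
    have "bm e ?N 0 ^ i * bm e 0 ?N ^ j - bm e 1 0 ^ i * y ^ j \<in> J"
      by (intro pair_ideal_mult_cong pair_ideal_power_cong x_J_iter y)
    from pair_ideal_mult[OF this, of "bm c 0 0"] show ?thesis
      unfolding 1 by (subst 2) (simp only: right_diff_distrib mult.commute[of "bm c 0 0"] left_diff_distrib)
  qed
  have bK': "bc v i j \<in> K" for i j using assms by (auto simp: VK_iff)
  have inner: "(\<Sum>i\<le>m. bm (bc v i j) i j) \<in> VK" for m j by (intro corner_sum bm_VK bK')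
  have "v ^ ?N = (\<Sum>j\<le>degree v. \<Sum>i\<le>degree (coeff v j). bm (bc v i j) i j) ^ ?N"
    using bivariate_sum[of v] by simp
  also have "\<dots> = (\<Sum>j\<le>degree v. \<Sum>i\<le>degree (coeff v j). bm (bc v i j) i j ^ ?N)"
    by (simp only: frob_sum_q inner bm_VK bK')
  finally have vN: "v ^ ?N = \<dots>" .
  have "v ^ ?N - v = (\<Sum>j\<le>degree v. \<Sum>i\<le>degree (coeff v j). bm (bc v i j) i j ^ ?N - bm (bc v i j) i j)"
    unfolding vN by (subst (4) bivariate_sum[of v]) (simp only: sum_subtractf)
  also have "\<dots> \<in> J" by (intro pair_ideal_sum mon bK')
  finally show ?thesis .
qed

text \<open>As a function on the curve, h(x) has pole order q N at infinity. The argument produces a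
  nonzero function of pole order at most l + r m that is divisible by h, which gives q N <= l + r
  m.\<close>

theorem stepanov:
  assumes N: "h \<in> monics N" and \<nu>\<mu>: "n = \<nu> + \<mu>" "\<mu> \<le> \<nu>"
    and large: "q ^ \<mu> > (d * q) ^ 2 + 3 * (d * q) + 1"
  shows "q * N \<le> q ^ n + (2 * (d * q) + 1) * q ^ \<nu>"
proof -
  define g s r where "g = d * q" and "s = q ^ \<mu>" and "r = q ^ \<nu>"
  have s0: "s > 0" and r0: "r > 0" by (simp_all add: s_def r_def)
  have rs: "r * s = q ^ n" by (simp add: r_def s_def \<nu>\<mu> power_add)
  have sr: "s \<le> r" unfolding s_def r_def using \<nu>\<mu>(2) by (intro power_increasing) auto
  have s_large: "s > g ^ 2 + 3 * g + 1" using large by (simp add: s_def g_def)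
  \<comment> \<open>By \<open>card_idx\<close> the family below has q^(A B) members with A >= l + 1
    - g = s - g and B >= m + 1 - g = s + g + 1, while the target has at most q^(l s + m + 1). For
    these l and m, (s - g)(s + g + 1) exceeds l s + m + 1 by s - g^2 - 3 g - 1, which is positive by
    \<open>large\<close>. Moreover l < r will keep the leading weights of \<open>G\<close>
    apart.\<close>
  define l m where "l = s - 1" and "m = s + 2 * g"
  have lr: "l < r" using sr s0 by (simp add: l_def)
  \<comment> \<open>The images of x^i y^j under the q^n-power map modulo \<open>J\<close>, as in
    \<open>xy_J\<close>.\<close>
  define Y where "Y = (\<lambda>(i, j). bm e i 0 * (y + cc b) ^ j)"
  have Y_wt: "Y x \<in> wt 0 m" if "x \<in> idx m" for x
  proof -
    obtain i j where x: "x = (i, j)" "i * q + j * d \<le> m" using \<open>x \<in> idx m\<close> by (auto simp: idx_def)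
    have "cc b = bm b 0 0" by (simp add: bm_def monom_0)
    hence "y + cc b \<in> wt 0 d" by (simp only:) (intro wt_add wt_bm e_K bK; simp)
    hence "bm e i 0 * (y + cc b) ^ j \<in> wt 0 (i * q + j * d)"
      by (intro wt_mult_power wt_bm e_K) simp
    thus ?thesis using x wt_mono by (auto simp: Y_def)
  qed
  define E where "E \<phi> = (\<Sum>x\<in>idx m. \<phi> x ^ s * Y x)" for \<phi>
  define Fam where "Fam = idx m \<rightarrow>\<^sub>E can l"
  have E_wt: "E \<phi> \<in> wt 0 (l * s + m)" if "\<phi> \<in> Fam" for \<phi>
    unfolding E_def
  proof (rule wt_sum)
    fix x assume x: "x \<in> idx m"
    have "\<phi> x \<in> wt 0 l" using that x by (auto simp: Fam_def can_def)
    from wt_mult[OF wt_power[OF this s0] Y_wt[OF x]]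
    show "\<phi> x ^ s * Y x \<in> wt 0 (l * s + m)" by (simp add: mult.commute)
  qed
  have "\<exists>v. v \<in> can (l * s + m) \<and> (\<exists>w\<in>VK. E \<phi> = v + F * w)" if "\<phi> \<in> Fam" for \<phi>
    using wt_reduce[OF E_wt[OF that]] wt_VK unfolding can_def by blast
  then obtain \<Phi> where \<Phi>: "\<And>\<phi>. \<phi> \<in> Fam \<Longrightarrow> \<Phi> \<phi> \<in> can (l * s + m)"
      "\<And>\<phi>. \<phi> \<in> Fam \<Longrightarrow> \<exists>w\<in>VK. E \<phi> = \<Phi> \<phi> + F * w" by metis
  have card_ineq: "card (can (l * s + m)) < card Fam"
  proof -
    have g_eq: "g * g + 3 * g + 2 \<le> s" using s_large by (simp add: power2_eq_square)
    then obtain z where z: "s = g * g + 3 * g + 2 + z" by (metis le_add_diff_inverse)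
    define A where "A = card (idx l)"
    define B where "B = card (idx m)"
    have A: "s \<le> A + g" using card_idx(2)[of l] s0 by (simp add: l_def A_def g_def)
    have B: "s + g + 1 \<le> B" using card_idx(2)[of m] by (simp add: m_def B_def g_def)
    have "card (idx (l * s + m)) \<le> l * s + m + 1" by (rule card_idx(1))
    also have "\<dots> < (s - g) * (s + g + 1)"
      unfolding l_def m_def z by (simp add: algebra_simps)
    also have "\<dots> \<le> A * B" using A B by (intro mult_le_mono) auto
    finally have "q ^ card (idx (l * s + m)) < q ^ (A * B)"
      using q_gt1 by (intro power_strict_increasing) auto
    thus ?thesis
      unfolding card_can Fam_def using finite_idx card_can
      by (simp add: card_PiE A_def B_def power_mult)
  qed
  have "\<not> inj_on \<Phi> Fam"
  proof
    assume "inj_on \<Phi> Fam"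
    hence "card Fam \<le> card (can (l * s + m))"
      by (rule card_inj_on_le) (use \<Phi>(1) card_can in auto)
    thus False using card_ineq by simp
  qed
  then obtain \<phi>1 \<phi>2 where \<phi>: "\<phi>1 \<in> Fam" "\<phi>2 \<in> Fam" "\<phi>1 \<noteq> \<phi>2" "\<Phi> \<phi>1 = \<Phi> \<phi>2"
    by (auto simp: inj_on_def)
  define \<delta> where "\<delta> x = \<phi>1 x - \<phi>2 x" for x
  have \<phi>c: "\<phi>1 x \<in> can l" "\<phi>2 x \<in> can l" if "x \<in> idx m" for x
    using \<phi>(1,2) that by (auto simp: Fam_def)
  have \<delta>c: "\<delta> x \<in> can l" if "x \<in> idx m" for x
    unfolding \<delta>_def using \<phi>c[OF that] by (rule can_diff)
  have \<delta>V: "\<delta> x \<in> VK" if "x \<in> idx m" for x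
    using \<delta>c[OF that] wt_VK by (auto simp: can_def)
  obtain w1 w2 where w12: "w1 \<in> VK" "w2 \<in> VK" "E \<phi>1 = \<Phi> \<phi>1 + F * w1" "E \<phi>2 = \<Phi> \<phi>2 + F * w2"
    using \<Phi>(2) \<phi>(1,2) by meson
  have "E \<delta> = E \<phi>1 - E \<phi>2"
    unfolding E_def \<delta>_def sum_subtractf[symmetric]
  proof (rule sum.cong[OF refl])
    fix x assume "x \<in> idx m"
    from \<phi>c[OF this] have "\<phi>1 x \<in> VK" "\<phi>2 x \<in> VK" using wt_VK by (auto simp: can_def)
    thus "(\<phi>1 x - \<phi>2 x) ^ s * Y x = \<phi>1 x ^ s * Y x - \<phi>2 x ^ s * Y x"
      unfolding s_def by (simp add: frob_diff_q left_diff_distrib)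
  qed
  also have "\<dots> = F * (w1 - w2)" using w12 \<phi>(4) by (simp add: algebra_simps)
  finally have E\<delta>: "E \<delta> \<in> J" by (simp only: pair_ideal_fst)
  \<comment> \<open>The same combination with x^(i r) y^(j r) in place of \<open>Y\<close>. As r s =
    q^n, its s-th power is congruent to \<open>E \<delta>\<close>, which is a multiple of
    \<open>F\<close>.\<close>
  define G where "G = (\<Sum>x\<in>idx m. case x of (i, j) \<Rightarrow> bm e (i * r) (j * r) * \<delta> x)"
  have Gterm: "(case x of (i, j) \<Rightarrow> bm e (i * r) (j * r) * \<delta> x) \<in> VK" if "x \<in> idx m" for x
    using \<delta>V[OF that] by (auto intro: corner_mult2 split: prod.splits)
  have GV: "G \<in> VK" unfolding G_def using Gterm by (rule corner_sum)
  have "G ^ s = (\<Sum>x\<in>idx m. (case x of (i, j) \<Rightarrow> bm e (i * r) (j * r) * \<delta> x) ^ s)"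
    unfolding G_def s_def using Gterm by (rule frob_sum_q)
  hence "G ^ s - E \<delta> = (\<Sum>x\<in>idx m. (case x of (i, j) \<Rightarrow> bm e (i * r) (j * r) * \<delta> x) ^ s - \<delta> x ^ s * Y x)"
    by (simp add: E_def sum_subtractf)
  also have "\<dots> \<in> J"
  proof (rule pair_ideal_sum)
    fix x assume "x \<in> idx m"
    obtain i j where x: "x = (i, j)" by (cases x)
    have "bm e (i * r) (j * r) ^ s = bm e (i * q ^ n) (j * q ^ n)"
      using s0 by (simp add: bm_power e_power mult.assoc rs)
    thus "(case x of (i, j) \<Rightarrow> bm e (i * r) (j * r) * \<delta> x) ^ s - \<delta> x ^ s * Y x \<in> J"
      using pair_ideal_mult[OF xy_J[of i j], of "\<delta> x ^ s"]
      by (simp add: x Y_def power_mult_distrib algebra_simps)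
  qed
  finally have "G ^ s - E \<delta> + E \<delta> \<in> J" using E\<delta> by (rule pair_ideal_add)
  hence Gs: "G ^ s \<in> J" by simp
  \<comment> \<open>The quotient by \<open>J\<close> is reduced: a high Frobenius power of
    \<open>G\<close> is congruent to \<open>G\<close> by \<open>frob_J\<close> and at the same time
    a multiple of \<open>G ^ s\<close>.\<close>
  have GJ: "G \<in> J"
  proof -
    have "\<mu> \<le> n * p" using \<nu>\<mu>(1) p_pos by (cases p) auto
    hence "s dvd q ^ (n * p)" unfolding s_def by (rule le_imp_power_dvd)
    then obtain t where t: "q ^ (n * p) = s * t" by (rule dvdE)
    hence "t > 0" by (metis gr0I mult_0_right p_pos zero_less_power less_irrefl)
    hence "G ^ (s * t) = G ^ s * (G ^ s) ^ (t - 1)"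
      unfolding power_mult by (cases t) auto
    hence "G ^ (q ^ (n * p)) = G ^ s * (G ^ s) ^ (t - 1)" by (simp only: t)
    hence "G ^ (q ^ (n * p)) \<in> J" using pair_ideal_mult[OF Gs] by simp
    from pair_ideal_add[OF this pair_ideal_uminus[OF frob_J[OF GV]]] show ?thesis by simp
  qed
  then obtain \<alpha>0 \<beta>0 where G0: "G = F * \<alpha>0 + [:h:] * \<beta>0" unfolding pair_ideal_def by blast
  \<comment> \<open>Projection of the ambient cofactors to polynomials over
    \<open>K\<close>.\<close>
  define \<alpha> \<beta> where "\<alpha> = cc e * \<alpha>0" and "\<beta> = cc e * \<beta>0"
  have \<alpha>\<beta>: "\<alpha> \<in> VK" "\<beta> \<in> VK" unfolding \<alpha>_def \<beta>_def by (intro corner_mult cc_VK e_K)+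
  have G1: "G = F * \<alpha> + [:h:] * \<beta>"
  proof -
    have "G = cc e * G" using VK_mult_e[OF GV] by simp
    also have "\<dots> = F * \<alpha> + [:h:] * \<beta>" unfolding \<alpha>_def \<beta>_def by (subst G0) (simp only: distrib_left mult.left_commute)
    finally show ?thesis .
  qed
  define S where "S = {x \<in> idx m. \<delta> x \<noteq> 0}"
  define W where "W = (\<lambda>(i, j). i * q + j * d)"
  have S: "finite S" "S \<noteq> {}"
  proof -
    show "finite S" unfolding S_def using finite_idx by auto
    show "S \<noteq> {}"
    proof
      assume "S = {}"
      hence "\<phi>1 x = \<phi>2 x" if "x \<in> idx m" for x
        using that by (cases x) (auto simp: S_def \<delta>_def)
      hence "\<phi>1 = \<phi>2" using \<phi>(1,2) unfolding Fam_def by (intro PiE_ext)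
      thus False using \<phi>(3) by simp
    qed
  qed
  define w0 where "w0 = Max (W ` S)"
  have "w0 \<in> W ` S" unfolding w0_def using S by (intro Max_in) auto
  then obtain i0 j0 where ij0: "(i0, j0) \<in> S" "w0 = i0 * q + j0 * d" by (auto simp: W_def)
  have Wle: "W x \<le> w0" if "x \<in> S" for x unfolding w0_def using S that by (intro Max_ge) auto
  have Wlt: "W x < w0" if "x \<in> S" "x \<noteq> (i0, j0)" for x
  proof -
    have "W x \<noteq> w0"
    proof
      assume "W x = w0"
      hence "x = (i0, j0)" using ij0 that(1) inj_weight[of "fst x" "snd x" i0 j0]
        by (cases x) (auto simp: W_def S_def idx_def)
      thus False using that by simp
    qed
    thus ?thesis using Wle[OF that(1)] by simp
  qed
  define \<delta>0 where "\<delta>0 = \<delta> (i0, j0)"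
  obtain m0 where m0: "m0 \<le> l" "\<delta>0 \<in> wt 0 m0" "lead m0 \<delta>0 \<in> K" "lead m0 \<delta>0 \<noteq> 0"
    using lead_can_nz[of \<delta>0 l] \<delta>c[of "(i0, j0)"] ij0(1) by (auto simp: S_def \<delta>0_def)
  define M where "M = m0 + r * w0"
  \<comment> \<open>Distinct values of \<open>W\<close> differ by at least 1, hence by at least r >
    l after multiplication by r. The coefficient \<delta> of another term, of weight at most l,
    cannot make up for this, so the term at (i0, j0) alone determines the leading coefficient of
    \<open>G\<close>.\<close>
  have other: "l + r * W x \<le> M \<and> l < M - r * W x" if "x \<in> S" "x \<noteq> (i0, j0)" for x
  proof -
    have "r * (W x + 1) \<le> r * w0" using Wlt[OF that] by (intro mult_le_mono) auto
    hence "r * W x + r \<le> M" by (simp add: M_def)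
    thus ?thesis using lr by linarith
  qed
  have \<delta>wt: "\<delta> x \<in> wt 0 l" if "x \<in> idx m" for x using \<delta>c[OF that] by (simp add: can_def)
  have GM: "G \<in> wt 0 M" unfolding G_def
  proof (rule wt_sum)
    fix x assume x: "x \<in> idx m"
    obtain i j where xij: "x = (i, j)" by (cases x)
    have b: "bm e (i * r) (j * r) \<in> wt 0 (r * W x)"
      by (rule wt_bm[OF e_K]) (simp add: xij W_def algebra_simps)
    show "(case x of (i, j) \<Rightarrow> bm e (i * r) (j * r) * \<delta> x) \<in> wt 0 M"
    proof (cases "x = (i0, j0)")
      case True
      have "bm e (i * r) (j * r) * \<delta> x \<in> wt (0 + 0) (r * W x + m0)"
        using m0(2) True by (intro wt_mult b) (simp add: \<delta>0_def)
      thus ?thesis using True xij ij0 by (simp add: M_def W_def add.commute)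
    next
      case False
      show ?thesis
      proof (cases "\<delta> x = 0")
        case True
        then show ?thesis by (simp add: xij wt_0)
      next
        case nz: False
        have "bm e (i * r) (j * r) * \<delta> x \<in> wt (0 + 0) (r * W x + l)"
          by (intro wt_mult b \<delta>wt x)
        moreover have "r * W x + l \<le> M" using other[of x] False nz x by (simp add: S_def)
        ultimately show ?thesis using wt_mono by (simp add: xij)
      qed
    qed
  qed
  have leadG: "lead M G \<noteq> 0"
  proof -
    have "lead M G = (\<Sum>x\<in>idx m. if x = (i0, j0) then e * a ^ (j0 * r) * lead m0 \<delta>0 else 0)"
      unfolding G_def lead_sum
    proof (rule sum.cong[OF refl])
      fix x assume x: "x \<in> idx m"
      obtain i j where xij: "x = (i, j)" by (cases x)
      have rW: "i * r * q + j * r * d = r * W (i, j)" by (simp add: W_def algebra_simps)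
      have L: "lead M (case x of (i, j) \<Rightarrow> bm e (i * r) (j * r) * \<delta> x)
          = (if r * W x \<le> M then e * a ^ (j * r) * lead (M - r * W x) (\<delta> x) else 0)"
        by (simp only: xij prod.case lead_bm_mult rW)
      show "lead M (case x of (i, j) \<Rightarrow> bm e (i * r) (j * r) * \<delta> x)
          = (if x = (i0, j0) then e * a ^ (j0 * r) * lead m0 \<delta>0 else 0)"
      proof (cases "x = (i0, j0)")
        case True
        hence "W x = w0" "j = j0" using ij0 xij by (simp_all add: W_def)
        thus ?thesis unfolding L using True by (simp add: M_def \<delta>0_def)
      next
        case False
        have "lead (M - r * W x) (\<delta> x) = 0"
        proof (cases "\<delta> x = 0")
          case nz: False
          hence "l < M - r * W x" using other[of x] False x by (simp add: S_def)
          thus ?thesis using lead_eq_0[OF \<delta>wt[OF x]] by simp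
        qed simp
        thus ?thesis unfolding L using False by simp
      qed
    qed
    also have "\<dots> = e * a ^ (j0 * r) * lead m0 \<delta>0"
      using finite_idx ij0 by (simp add: S_def)
    also have "\<dots> = a ^ (j0 * r) * lead m0 \<delta>0"
      using K_eq(1)[OF corner_mult2[OF m0(3)]] by (simp only: mult.assoc)
    finally show ?thesis using K_power_mult_nz[OF a_K a_nz m0(3,4)] by simp
  qed
  \<comment> \<open>Both \<open>G\<close> and the cofactor of h are reduced modulo \<open>F\<close>.
    Multiplication by h(x) does not affect the y-degree, so \<open>G' - [:h:] * \<beta>'\<close> is
    a multiple of \<open>F\<close> of y-degree below q and vanishes: the congruence becomes an
    honest divisibility.\<close>
  obtain G' u0 where G': "G = G' + F * u0" "G' \<in> wt 0 M" "\<forall>j\<ge>q. coeff G' j = 0" "u0 \<in> wt (d * q) M"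
    using wt_reduce[OF GM] by blast
  obtain mb where "\<beta> \<in> wt 0 mb" using VK_wt[OF \<alpha>\<beta>(2)] by blast
  then obtain \<beta>' u1 where \<beta>': "\<beta> = \<beta>' + F * u1" "\<beta>' \<in> wt 0 mb" "\<forall>j\<ge>q. coeff \<beta>' j = 0" "u1 \<in> wt (d * q) mb"
    using wt_reduce by blast
  have G'nz: "G' \<noteq> 0" using leadG lead_F_mult[OF G'(4)] G'(1) by (auto simp: lead_add)
  have eq: "G' - [:h:] * \<beta>' = F * (\<alpha> + [:h:] * u1 - u0)"
    using G1 unfolding G'(1) \<beta>'(1) by (simp only: algebra_simps)
  have hK: "[:h:] \<in> VK" using monics_KP[OF N] by (rule const_VK)
  have "\<alpha> + [:h:] * u1 - u0 = 0"
  proof (rule F_mult_small)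
    show "\<alpha> + [:h:] * u1 - u0 \<in> VK"
      using \<alpha>\<beta>(1) wt_VK[OF G'(4)] hK by (intro corner_diff corner_add corner_mult)
    show "\<forall>j\<ge>q. coeff (F * (\<alpha> + [:h:] * u1 - u0)) j = 0"
      unfolding eq[symmetric] using G'(3) \<beta>'(3) by simp
  qed
  hence Gh: "G' = [:h:] * \<beta>'" using eq by simp
  \<comment> \<open>A nonzero y-coefficient of \<open>G'\<close> is a multiple of h, so its x-degree
    is at least N and its weight at least q N.\<close>
  then obtain j where j: "coeff \<beta>' j \<noteq> 0" using G'nz by (metis leading_coeff_0_iff mult_zero_right)
  have bj: "coeff \<beta>' j \<in> KP" using wt_VK[OF \<beta>'(2)] by (auto simp: corner_poly_iff[of _ "[:e:]"])
  have cj: "coeff G' j = h * coeff \<beta>' j" unfolding Gh by simp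
  have nz: "h * coeff \<beta>' j \<noteq> 0" "degree (h * coeff \<beta>' j) = N + degree (coeff \<beta>' j)"
    using KP_lead_mult[OF monics_KP[OF N] bj monics_nz[OF N] j] monics_degree[OF N] by auto
  have "bc G' (degree (coeff G' j)) j \<noteq> 0" using nz(1) by (simp add: bc_def cj)
  from wtD[OF G'(2) this] have "degree (coeff G' j) * q + j * d \<le> M" by simp
  moreover have "N * q \<le> degree (coeff G' j) * q" using nz(2) by (simp add: cj)
  ultimately have "N * q \<le> M" by linarith
  also have "M \<le> l + r * m"
    using m0(1) ij0 by (auto simp: M_def S_def idx_def intro!: add_mono mult_le_mono)
  also have "l + r * m = l + r * s + 2 * g * r" by (simp add: m_def algebra_simps)
  also have "\<dots> \<le> r * s + (2 * g + 1) * r" using lr by simp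
  finally have "q * N \<le> r * s + (2 * g + 1) * r" by (simp only: mult.commute[of q])
  thus ?thesis by (simp only: rs) (simp only: g_def r_def)
qed

end

end

section \<open>From power sums to the linear coefficient\<close>

text \<open>Vieta: the coefficient is minus the sum of the D roots. They are split off one at a time
  by the fundamental theorem of algebra.\<close>

lemma monic_root_bound:
  fixes R :: "complex poly"
  assumes "degree R = D" "coeff R D = 1" "D > 0" "\<And>w. poly R w = 0 \<Longrightarrow> norm w \<le> B"
  shows "norm (coeff R (D - 1)) \<le> D * B"
  using assms
proof (induction D arbitrary: R)
  case (Suc D)
  have "\<not> constant (poly R)" using Suc.prems by (simp add: constant_degree)
  then obtain w where w: "poly R w = 0" using fundamental_theorem_of_algebra by blast
  then obtain R' where R': "R = [:- w, 1:] * R'" by (metis dvd_def poly_eq_0_iff_dvd)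
  have R'0: "R' \<noteq> 0" using Suc.prems R' by auto
  have deg: "degree R' = D" using Suc.prems(1) R'0 unfolding R' by (subst (asm) degree_mult_eq) auto
  have c: "coeff R (Suc n) = coeff R' n - w * coeff R' (Suc n)" for n unfolding R' by simp
  have lc: "coeff R' D = 1" using Suc.prems(2) deg c[of D] by (simp add: coeff_eq_0)
  show ?case
  proof (cases D)
    case 0
    have "coeff R 0 = - w * coeff R' 0" unfolding R' by simp
    thus ?thesis using 0 lc Suc.prems(4)[OF w] by simp
  next
    case (Suc D')
    have "norm (coeff R' (D - 1)) \<le> D * B"
      using Suc.IH[OF deg lc] Suc Suc.prems(4) unfolding R' by auto
    moreover have eq: "coeff R D = coeff R' (D - 1) - w" using c[of D'] lc Suc by simp
    moreover have "norm (coeff R' (D - 1) - w) \<le> norm (coeff R' (D - 1)) + norm w" by (rule norm_triangle_ineq4)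
    ultimately have "norm (coeff R D) \<le> D * B + B" using Suc.prems(4)[OF w] by simp
    thus ?thesis by (simp add: algebra_simps)
  qed
qed simp

text \<open>The recurrence says \<open>L' = L F\<close> with \<open>F = \<Sum> S_n t^n\<close> holomorphic for \<open>|t| < 1/B\<close>, whereas
  \<open>L'/L\<close> has a pole at every zero of \<open>L\<close>.\<close>

lemma no_root_in_disc:
  fixes L :: "complex poly" and S :: "nat \<Rightarrow> complex"
  assumes L0: "coeff L 0 = 1" and B: "B > 0"
    and rec: "\<And>n. of_nat (Suc n) * coeff L (Suc n) = (\<Sum>i\<le>n. coeff L i * S (n - i))"
    and bd: "\<And>n. norm (S n) \<le> C * B ^ n"
    and z: "poly L z = 0"
  shows "norm z * B \<ge> 1"
proof (rule ccontr)
  assume "\<not> norm z * B \<ge> 1"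
  hence zB: "norm z * B < 1" by simp
  define F where "F t = (\<Sum>n. S n * t ^ n)" for t
  define L' where "L' = pderiv L"
  \<comment> \<open>A disc around 0 with \<open>z\<close> in its interior on which the series of
    \<open>F\<close> still converges, so that \<open>F\<close> is continuous at
    \<open>z\<close>.\<close>
  obtain \<rho> where \<rho>: "norm z < \<rho>" "\<rho> < 1 / B" using dense[of "norm z" "1 / B"] zB B by (auto simp: field_simps)
  have \<rho>0: "\<rho> > 0" using \<rho>(1) norm_ge_zero[of z] by linarith
  have summ: "summable (\<lambda>n. norm (S n * t ^ n))" if "norm t \<le> \<rho>" for t
  proof (rule summable_comparison_test')
    have "norm (\<rho> * B) < 1" using \<rho> \<rho>0 B by (simp add: field_simps)
    thus "summable (\<lambda>n. C * (\<rho> * B) ^ n)" by (intro summable_mult summable_geometric)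
    fix n
    have C0: "C * B ^ n \<ge> 0" using bd[of n] norm_ge_zero[of "S n"] by linarith
    have "norm (S n) * norm t ^ n \<le> (C * B ^ n) * \<rho> ^ n"
      using bd[of n] that C0 by (intro mult_mono power_mono) auto
    thus "norm (norm (S n * t ^ n)) \<le> C * (\<rho> * B) ^ n"
      by (simp add: norm_mult norm_power power_mult_distrib mult_ac)
  qed
  have Leq: "(\<lambda>n. coeff p n * t ^ n) sums poly p t" for p :: "complex poly" and t
  proof -
    have "(\<lambda>n. coeff p n * t ^ n) sums (\<Sum>n\<le>degree p. coeff p n * t ^ n)"
      by (rule sums_finite) (auto simp: coeff_eq_0)
    thus ?thesis by (simp add: poly_altdef)
  qed
  have Lsumm: "summable (\<lambda>n. norm (coeff L n * t ^ n))" for t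
    by (rule summable_finite[of "{..degree L}"]) (auto simp: coeff_eq_0)
  have LF: "poly L' t = poly L t * F t" if t: "norm t \<le> \<rho>" for t
  proof -
    have "(\<lambda>n. \<Sum>i\<le>n. (coeff L i * t ^ i) * (S (n - i) * t ^ (n - i))) sums
          ((\<Sum>n. coeff L n * t ^ n) * (\<Sum>n. S n * t ^ n))"
      by (rule Cauchy_product_sums[OF Lsumm summ[OF t]])
    moreover have "(\<Sum>i\<le>n. (coeff L i * t ^ i) * (S (n - i) * t ^ (n - i))) = coeff L' n * t ^ n" for n
    proof -
      have "(\<Sum>i\<le>n. (coeff L i * t ^ i) * (S (n - i) * t ^ (n - i))) = (\<Sum>i\<le>n. coeff L i * S (n - i) * t ^ n)"
        by (intro sum.cong refl) (simp add: power_add[symmetric] mult.assoc mult.left_commute)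
      thus ?thesis using rec[of n] by (simp add: L'_def coeff_pderiv sum_distrib_right)
    qed
    ultimately have "(\<lambda>n. coeff L' n * t ^ n) sums (poly L t * F t)"
      using sums_unique[OF Leq[of L t]] by (simp add: F_def)
    thus ?thesis using Leq[of L' t] sums_unique2 by blast
  qed
  have Lnz: "L \<noteq> 0" using L0 by auto
  define m where "m = order z L"
  have m: "m > 0" using z Lnz by (simp add: m_def order_gt_0_iff)
  obtain M where M: "L = [:- z, 1:] ^ m * M" "\<not> [:- z, 1:] dvd M"
    using order_decomp[OF Lnz, of z] by (auto simp: m_def)
  have Mz: "poly M z \<noteq> 0" using M(2) by (simp add: poly_eq_0_iff_dvd)
  obtain m' where m': "m = Suc m'" using m by (cases m) auto
  have L'eq: "poly L' t = (t - z) ^ m' * (of_nat m * poly M t + (t - z) * poly (pderiv M) t)" for t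
    unfolding L'_def M(1) m' by (simp add: pderiv_mult pderiv_power_Suc pderiv_pCons algebra_simps del: power_Suc)
       (simp add: algebra_simps)
  \<comment> \<open>The equation L' = L F divided by (t - z)^(m - 1), where m is the order of the
    zero. \<open>H\<close> vanishes near \<open>z\<close> except possibly at \<open>z\<close>,
    whereas its value there is -m M(z), which is nonzero; continuity gives the
    contradiction.\<close>
  define H where "H t = (t - z) * (poly M t * F t - poly (pderiv M) t) - of_nat m * poly M t" for t
  have H0: "H t = 0" if t: "norm t \<le> \<rho>" "t \<noteq> z" for t
  proof -
    have "poly [:- z, 1:] t = t - z" by simp
    hence Lt: "poly L t = (t - z) ^ m' * ((t - z) * poly M t)"
      unfolding M(1) m' poly_mult poly_power by (simp only: power_Suc mult_ac)
    have "(t - z) ^ m' * (of_nat m * poly M t + (t - z) * poly (pderiv M) t) = (t - z) ^ m' * ((t - z) * poly M t * F t)"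
      using LF[OF t(1)] unfolding L'eq Lt by (simp only: mult_ac)
    hence "of_nat m * poly M t + (t - z) * poly (pderiv M) t = (t - z) * poly M t * F t"
      using t(2) by simp
    thus ?thesis by (simp add: H_def algebra_simps)
  qed
  have "isCont F z" unfolding F_def
  proof (rule isCont_powser)
    show "summable (\<lambda>n. S n * (of_real \<rho>) ^ n)"
      by (rule summable_norm_cancel[OF summ]) (use \<rho>0 in simp)
    show "norm z < norm (complex_of_real \<rho>)" using \<rho> \<rho>0 by simp
  qed
  hence "isCont H z" unfolding H_def by (intro continuous_intros)
  hence "(H \<longlongrightarrow> H z) (at z)" by (simp add: isCont_def)
  moreover have "eventually (\<lambda>t. H t = 0) (at z)"
  proof -
    have "eventually (\<lambda>t. norm t < \<rho>) (nhds z)"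
      by (rule order_tendstoD(2)[OF _ \<rho>(1)]) (intro tendsto_norm filterlim_ident)
    hence "eventually (\<lambda>t. norm t < \<rho>) (at z)" by (simp add: eventually_at_filter eventually_mono)
    moreover have "eventually (\<lambda>t. t \<noteq> z) (at z)" by (simp add: eventually_at_filter)
    ultimately show ?thesis by eventually_elim (simp add: H0)
  qed
  ultimately have "((\<lambda>_. 0) \<longlongrightarrow> H z) (at z)" by (rule Lim_transform_eventually)
  hence "H z = 0" by (rule tendsto_unique[OF at_neq_bot _ tendsto_const])
  thus False using Mz m by (simp add: H_def)
qed

text \<open>The \<open>c i\<close> are the coefficients of a polynomial of degree at most d - 1, and
  \<open>c 1\<close> is minus the sum of its inverse roots. Every value of \<open>C\<close> gives
  the same radius of convergence 1/B, hence \<open>C\<close> does not occur in the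
  conclusion.\<close>

lemma recurrence_bound:
  fixes c S :: "nat \<Rightarrow> complex"
  assumes c0: "c 0 = 1" and cz: "\<And>n. n \<ge> d \<Longrightarrow> c n = 0" and d: "d > 0" and B: "B > 0"
    and rec: "\<And>n. of_nat n * c n = (\<Sum>j=1..n. S j * c (n - j))"
    and bd: "\<And>n. n > 0 \<Longrightarrow> norm (S n) \<le> C * B ^ n"
  shows "norm (c 1) \<le> real (d - 1) * B"
proof (cases "d = 1")
  case True
  then show ?thesis using cz[of 1] by simp
next
  case False
  define D where "D = d - 1"
  have D: "D > 0" "d = Suc D" using False d by (auto simp: D_def)
  define L where "L = (\<Sum>i\<le>D. monom (c i) i)"
  have Lc: "coeff L n = c n" for n
    using cz[of n] D by (auto simp: L_def coeff_sum coeff_monom)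
  \<comment> \<open>The reversed polynomial w^D L(1/w): monic because \<open>c 0 = 1\<close>, with
    the inverse zeros of L as its nonzero roots. Roots at 0 account for a degree of L below
    D.\<close>
  define R where "R = (\<Sum>i\<le>D. monom (c i) (D - i))"
  have Rc: "coeff R n = (if n \<le> D then c (D - n) else 0)" for n
  proof -
    have "coeff R n = (\<Sum>i\<le>D. if i = D - n \<and> n \<le> D then c i else 0)"
      unfolding R_def coeff_sum coeff_monom by (intro sum.cong) auto
    thus ?thesis by (cases "n \<le> D") auto
  qed
  have degR: "degree R = D"
    by (rule antisym[OF degree_le le_degree]) (auto simp: Rc c0)
  have "norm (coeff R (D - 1)) \<le> D * B"
  proof (rule monic_root_bound[OF degR _ D(1)])
    show "coeff R D = 1" by (simp add: Rc c0)
    fix w assume w: "poly R w = 0"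
    show "norm w \<le> B"
    proof (cases "w = 0")
      case False
      have "poly R w = (\<Sum>i\<le>D. c i * w ^ (D - i))" by (simp add: R_def poly_sum poly_monom)
      also have "\<dots> = w ^ D * poly L (inverse w)"
        unfolding L_def poly_sum poly_monom sum_distrib_left
        by (intro sum.cong refl) (use False in \<open>simp add: power_diff power_inverse field_simps\<close>)
      finally have "poly L (inverse w) = 0" using w False by simp
      have "norm (inverse w) * B \<ge> 1"
      proof (rule no_root_in_disc[where S = "\<lambda>n. S (Suc n)" and C = "C * B"])
        fix n
        have "of_nat (Suc n) * c (Suc n) = (\<Sum>j=1..Suc n. S j * c (Suc n - j))" by (rule rec)
        also have "\<dots> = (\<Sum>i\<le>n. c i * S (Suc (n - i)))"
          by (rule sum.reindex_bij_witness[of _ "\<lambda>i. Suc (n - i)" "\<lambda>j. Suc n - j"])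
             (auto simp: Suc_diff_le)
        finally show "of_nat (Suc n) * coeff L (Suc n) = (\<Sum>i\<le>n. coeff L i * S (Suc (n - i)))"
          by (simp only: Lc)
        show "norm (S (Suc n)) \<le> C * B * B ^ n" using bd[of "Suc n"] by (simp add: mult.assoc)
      qed (use c0 B in \<open>simp_all add: Lc \<open>poly L (inverse w) = 0\<close>\<close>)
      hence "norm w * 1 \<le> norm w * (norm (inverse w) * B)" by (intro mult_left_mono) auto
      also have "\<dots> = norm (w * inverse w) * B" by (simp only: norm_mult mult.assoc)
      finally show ?thesis using False by simp
    qed (use B in simp)
  qed
  thus ?thesis using D by (simp add: Rc)
qed

section \<open>Weil's bound\<close>

context artin_schreier begin

text \<open>The error term of \<open>stepanov\<close> grows with q^\<nu>, and \<mu> <= \<nu> is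
  required there; splitting n into halves makes it of order q^(n/2).\<close>

lemma class_count_bound:
  assumes "q ^ (n div 2) > (d * q) ^ 2 + 3 * (d * q) + 1" and b: "b \<in> K" and n: "n > 0"
  shows "q * (\<Sum>f\<in>trace_class P n b. degree f) \<le> q ^ n + (2 * (d * q) + 1) * q ^ (n - n div 2)"
proof (cases "trace_class P n b = {}")
  case False
  obtain h where h: "h \<in> monics (\<Sum>f\<in>trace_class P n b. degree f)"
    "h dvd monom e (q ^ n) - monom e 1" "h dvd Tsum P n - [:b:]"
    using trace_class_prod[OF P n False b] .
  show ?thesis
    by (rule stepanov[OF h(2,3) b h(1) _ _ assms(1)]) auto
qed simp

text \<open>The deviations \<open>D b\<close> from the expected count add up to 0 over the q values
  of b, so the upper bound U for each implies a lower bound of order -q U. The common main term is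
  killed by the vanishing sum of \<psi>.\<close>

lemma Lsum_bound:
  assumes \<psi>: "add_char \<psi>" "\<exists>c\<in>K. \<psi> c \<noteq> 1"
    and large: "q ^ (n div 2) > (d * q) ^ 2 + 3 * (d * q) + 1" and n: "n > 0"
  shows "norm (Lsum (trace_char \<psi> P) n) \<le> q * (2 * (d * q) + 1) * real (q ^ (n - n div 2))"
proof -
  define N where "N b = (\<Sum>f\<in>trace_class P n b. degree f)" for b
  define U where "U = (2 * (d * q) + 1) * real (q ^ (n - n div 2))"
  define D where "D b = real q * real (N b) - real q ^ n" for b
  have U0: "U \<ge> 0" by (simp add: U_def)
  have up: "D b \<le> U" if "b \<in> K" for b
  proof -
    have "real (q * N b) \<le> real (q ^ n + (2 * (d * q) + 1) * q ^ (n - n div 2))"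
      unfolding N_def by (intro of_nat_mono class_count_bound large that n)
    thus ?thesis by (simp add: D_def U_def algebra_simps)
  qed
  have "(\<Sum>b\<in>K. N b) = q ^ n"
    using sum_trace_class[OF n, of degree P] sum_degree_Irr[OF n] by (simp add: N_def)
  hence "real q * (\<Sum>b\<in>K. real (N b)) = real q * real q ^ n" by (metis of_nat_power of_nat_sum)
  hence sumD: "(\<Sum>b\<in>K. D b) = 0"
    using K_card by (simp add: D_def sum_subtractf sum_distrib_left)
  have abs: "\<bar>D b\<bar> \<le> real q * U" if b: "b \<in> K" for b
  proof -
    have "D b + (\<Sum>b'\<in>K - {b}. D b') = 0" using sumD K_fin b by (simp add: sum.remove)
    moreover have "(\<Sum>b'\<in>K - {b}. D b') \<le> (\<Sum>b'\<in>K - {b}. U)" by (intro sum_mono up) auto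
    moreover have "(\<Sum>b'\<in>K - {b}. U) \<le> real q * U"
      using K_fin K_card U0 b by (auto intro!: mult_right_mono simp: card_Diff_singleton simp del: of_nat_power)
    moreover have "real 1 \<le> real q" by (rule of_nat_mono) (use q_gt1 in linarith)
    hence "U \<le> real q * U" using U0 mult_right_mono[of 1 "real q" U] by (simp only: of_nat_1 mult_1_left)
    ultimately show ?thesis using up[OF b] by linarith
  qed
  have "of_nat q * Lsum (trace_char \<psi> P) n = (\<Sum>b\<in>K. \<psi> b * (of_nat q * of_nat (N b)))"
    unfolding Lsum_trace_char[OF \<psi>(1) n] N_def[symmetric] by (simp add: sum_distrib_left mult_ac)
  also have "\<dots> = (\<Sum>b\<in>K. \<psi> b * of_real (D b)) + (\<Sum>b\<in>K. \<psi> b) * of_nat q ^ n"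
    by (simp add: D_def sum_distrib_right sum.distrib[symmetric] algebra_simps)
  also have "(\<Sum>b\<in>K. \<psi> b) = 0" by (rule add_char_sum[OF \<psi>])
  finally have "real q * norm (Lsum (trace_char \<psi> P) n) = norm (\<Sum>b\<in>K. \<psi> b * of_real (D b))"
    by (metis add.right_neutral mult_zero_left norm_mult norm_of_nat)
  also have "\<dots> \<le> (\<Sum>b\<in>K. norm (\<psi> b * of_real (D b)))" by (rule norm_sum)
  also have "\<dots> = (\<Sum>b\<in>K. \<bar>D b\<bar>)"
    by (intro sum.cong refl) (simp add: norm_mult add_char_norm[OF \<psi>(1)])
  also have "\<dots> \<le> (\<Sum>b\<in>K. real q * U)" by (intro sum_mono abs)
  also have "\<dots> = real q * (real q * U)" using K_card by simp
  finally have "real q * norm (Lsum (trace_char \<psi> P) n) \<le> real q * (real q * U)" .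
  moreover have "real q > 0" using q_gt1 by simp
  ultimately have "norm (Lsum (trace_char \<psi> P) n) \<le> real q * U" by (meson mult_le_cancel_left_pos)
  thus ?thesis by (simp add: U_def algebra_simps)
qed

theorem weil_bound:
  assumes \<psi>: "add_char \<psi>" "\<exists>c\<in>K. \<psi> c \<noteq> 1"
  shows "norm (\<Sum>x\<in>K. \<psi> (poly P x)) \<le> real (d - 1) * sqrt (real q)"
proof -
  let ?S = "Lsum (trace_char \<psi> P)"
  define B where "B = sqrt (real q)"
  define t where "t = (d * q) ^ 2 + 3 * (d * q) + 1"
  \<comment> \<open>For n >= n0 one has n div 2 > t, and q^(n div 2) is larger still, so the size
    condition of the point count holds.\<close>
  define n0 where "n0 = 2 * (t + 1)"
  \<comment> \<open>The sum takes care of the finitely many n < n0; the factor \<open>B\<close> in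
    the first summand pays for rounding n/2 up.\<close>
  define C where "C = q * (2 * (d * q) + 1) * B + (\<Sum>j<n0. norm (?S j))"
  have B1: "B \<ge> 1" using q_gt1 by (simp add: B_def del: of_nat_power)
  have Bn: "B ^ n \<ge> 1" for n using B1 by (rule one_le_power)
  have large: "q ^ (n div 2) > t" if "n \<ge> n0" for n
  proof -
    have "t < n div 2" using that by (simp add: n0_def)
    also have "n div 2 < 2 ^ (n div 2)" by (rule less_exp)
    also have "\<dots> \<le> q ^ (n div 2)" by (rule power_mono) (use q_gt1 in linarith, simp)
    finally show ?thesis .
  qed
  have bd: "norm (?S n) \<le> C * B ^ n" if n: "n > 0" for n
  proof (cases "n < n0")
    case True
    have "norm (?S n) \<le> (\<Sum>j<n0. norm (?S j))" using True by (intro member_le_sum) auto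
    also have "\<dots> \<le> C" using B1 by (simp add: C_def)
    also have "\<dots> \<le> C * B ^ n"
    proof -
      have "C \<ge> 0" using B1 by (auto simp: C_def intro!: add_nonneg_nonneg sum_nonneg)
      thus ?thesis using mult_left_mono[OF Bn[of n]] by simp
    qed
    finally show ?thesis .
  next
    case False
    have "norm (?S n) \<le> q * (2 * (d * q) + 1) * real (q ^ (n - n div 2))"
      by (rule Lsum_bound[OF \<psi> _ n]) (use large[of n] False in \<open>simp add: t_def\<close>)
    also have "real (q ^ (n - n div 2)) \<le> B * B ^ n"
    proof -
      have "real q ^ (n - n div 2) = B ^ (2 * (n - n div 2))"
        by (simp add: B_def power_mult)
      also have "\<dots> \<le> B ^ Suc n" using B1 by (intro power_increasing) auto
      finally show ?thesis by simp
    qed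
    hence "q * (2 * (d * q) + 1) * real (q ^ (n - n div 2)) \<le> q * (2 * (d * q) + 1) * (B * B ^ n)"
      by (intro mult_left_mono) auto
    also have "\<dots> \<le> C * B ^ n"
      using B1 unfolding C_def distrib_right mult.assoc
      by (simp add: sum_nonneg)
    finally show ?thesis .
  qed
  have "norm (Lcoeff (trace_char \<psi> P) 1) \<le> real (d - 1) * B"
  proof (rule recurrence_bound[where c = "Lcoeff (trace_char \<psi> P)" and S = ?S and C = C and d = d])
    show "Lcoeff (trace_char \<psi> P) 0 = 1" by (rule Lcoeff_trace_char_0[OF \<psi>(1)])
    show "Lcoeff (trace_char \<psi> P) n = 0" if "d \<le> n" for n
      using Lcoeff_trace_char_vanish[OF \<psi> P d_pos d_less that] .
    show "of_nat n * Lcoeff (trace_char \<psi> P) n = (\<Sum>j=1..n. ?S j * Lcoeff (trace_char \<psi> P) (n - j))" for n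
      by (rule Lcoeff_recurrence[OF mult_char_trace_char[OF \<psi>(1)]])
  qed (use B1 bd d_pos in auto)
  thus ?thesis unfolding Lcoeff_trace_char_1[OF P P0] B_def .
qed

end

section \<open>A nontrivial additive character\<close>

context finite_field_component begin

lemma K_of_nat: "of_nat j * e \<in> K"
  by (intro corner_mult2 e_K)

lemma of_nat_e_inj:
  assumes "i < p" "j < p" "of_nat i * e = of_nat j * e"
  shows "i = j"
proof -
  have "i = j" if "i \<le> j" "i < p" "j < p" "of_nat i * e = of_nat j * e" for i j
  proof -
    have 0: "of_nat (j - i) * e = 0" using that by (simp add: of_nat_diff algebra_simps)
    have "\<not> 0 < j - i"
    proof
      assume "0 < j - i"
      moreover have "j - i < p" using that by simp
      ultimately show False using of_nat_e_nz 0 by blast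
    qed
    thus ?thesis using that by simp
  qed
  from this[of i j] this[of j i] assms show ?thesis by (cases "i \<le> j") auto
qed

lemma K_add_p_power: "a \<in> K \<Longrightarrow> b \<in> K \<Longrightarrow> (a + b) ^ (p ^ n) = a ^ (p ^ n) + b ^ (p ^ n)"
  by (intro freshman_power p_prime corner_kill[OF p_char])

text \<open>X^p - X has at most p roots in \<open>K\<close>, and the p multiples of \<open>e\<close>
  are already roots.\<close>

lemma K_prime_subfield:
  assumes t: "t \<in> K" "t ^ p = t"
  shows "\<exists>j<p. t = of_nat j * e"
proof -
  have p1: "p > 1" using p_prime by (rule prime_gt_1_nat)
  define H where "H = monom e p - monom e 1"
  have H: "H \<in> KP" unfolding H_def by (intro corner_diff monom_KP e_K)
  have "coeff H p = e" using p1 by (simp add: H_def coeff_monom)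
  hence Hnz: "H \<noteq> 0" using e_nz by auto
  have Hdeg: "degree H \<le> p" unfolding H_def using p1 by (intro degree_le) (auto simp: coeff_monom)
  have root: "poly H c = 0 \<longleftrightarrow> c ^ p = c" if "c \<in> K" for c
  proof -
    have "e * c ^ p = c ^ p" using corner_power[OF that, of p] by (intro corner_mult_id) simp
    thus ?thesis using K_eq[OF that] by (simp add: H_def poly_monom)
  qed
  have frob: "(of_nat j * e) ^ p = of_nat j * e" for j
  proof (induction j)
    case (Suc j)
    have "(of_nat (Suc j) * e) ^ p = (of_nat j * e + e) ^ (p ^ 1)" by (simp add: algebra_simps)
    also have "\<dots> = (of_nat j * e) ^ (p ^ 1) + e ^ (p ^ 1)" by (intro K_add_p_power K_of_nat e_K)
    finally show ?case using Suc by (simp add: e_power algebra_simps)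
  qed (simp add: power_0_left)
  define A where "A = (\<lambda>j. of_nat j * e) ` {..<p}"
  have "inj_on (\<lambda>j. of_nat j * e) {..<p}" by (rule inj_onI) (auto intro: of_nat_e_inj)
  hence "card A = p" by (simp add: A_def card_image)
  moreover have sub: "A \<subseteq> {c \<in> K. poly H c = 0}"
  proof
    fix c assume "c \<in> A"
    then obtain j where "c = of_nat j * e" by (auto simp: A_def)
    thus "c \<in> {c \<in> K. poly H c = 0}" using frob[of j] K_of_nat[of j] root by auto
  qed
  moreover have "card {c \<in> K. poly H c = 0} \<le> p" using card_roots_le[OF H Hnz] Hdeg by linarith
  ultimately have "A = {c \<in> K. poly H c = 0}"
    by (intro card_seteq) (use K_fin in auto)
  hence "t \<in> A" using t root by auto
  thus ?thesis by (auto simp: A_def)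
qed

text \<open>The character is a primitive p-th root of unity raised to the absolute trace
  \<open>T\<close>. The trace is not identically 0, since as a polynomial it is nonzero of degree at
  most p^(k-1), which is less than q.\<close>

lemma exists_add_char: "\<exists>\<psi>. add_char \<psi> \<and> (\<exists>c\<in>K. \<psi> c \<noteq> 1)"
proof -
  define T where "T x = (\<Sum>i<k. x ^ (p ^ i))" for x :: 'b
  have TK: "T x \<in> K" if "x \<in> K" for x
    unfolding T_def using that by (intro corner_sum corner_power) auto
  have T_add: "T (x + y) = T x + T y" if "x \<in> K" "y \<in> K" for x y
    unfolding T_def using that by (simp add: K_add_p_power sum.distrib)
  have T_frob: "T x ^ p = T x" if x: "x \<in> K" for x
  proof -
    have "T x ^ (p ^ 1) = (\<Sum>i<k. (x ^ (p ^ i)) ^ (p ^ 1))"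
      unfolding T_def
      by (rule freshman_power_sum[OF p_prime]) (auto intro!: corner_kill[OF p_char] corner_power x)
    also have "\<dots> = (\<Sum>i<k. x ^ (p ^ Suc i))" by (simp add: power_mult[symmetric] mult.commute)
    also have "\<dots> = (\<Sum>i<Suc k. x ^ (p ^ i)) - x"
      by (subst sum.lessThan_Suc_shift) simp
    also have "\<dots> = T x" using K_frob[OF x] by (simp add: T_def)
    finally show ?thesis by simp
  qed
  have "\<exists>x\<in>K. T x \<noteq> 0"
  proof (rule ccontr)
    assume neg: "\<not> ?thesis"
    define H where "H = (\<Sum>i<k. monom e (p ^ i))"
    have H: "H \<in> KP" unfolding H_def by (intro corner_sum monom_KP e_K)
    have p1: "p > 1" using p_prime by (rule prime_gt_1_nat)
    have "coeff H 1 = (\<Sum>i<k. if i = 0 then e else 0)"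
      unfolding H_def coeff_sum coeff_monom using p1 by (intro sum.cong) auto
    hence "coeff H 1 = e" using k_pos by simp
    hence Hnz: "H \<noteq> 0" using e_nz by auto
    have "degree H \<le> p ^ (k - 1)"
      unfolding H_def using p1 k_pos
      by (intro degree_sum_le) (auto intro!: order.trans[OF degree_monom_le] power_increasing)
    moreover have "{c \<in> K. poly H c = 0} = K"
    proof -
      have "poly H c = T c" if "c \<in> K" for c
        unfolding H_def T_def poly_sum poly_monom using corner_power[OF that]
        by (intro sum.cong refl corner_mult_id) auto
      thus ?thesis using neg by auto
    qed
    ultimately have "q \<le> p ^ (k - 1)" using card_roots_le[OF H Hnz] K_card by simp
    moreover have "p ^ (k - 1) < p ^ k" using p1 k_pos by (intro power_strict_increasing) auto
    ultimately show False by simp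
  qed
  then obtain x0 where x0: "x0 \<in> K" "T x0 \<noteq> 0" by auto
  have "\<exists>j. j < p \<and> T x = of_nat j * e" if "x \<in> K" for x
    using K_prime_subfield[OF TK[OF that] T_frob[OF that]] .
  then obtain J where J: "\<And>x. x \<in> K \<Longrightarrow> J x < p" "\<And>x. x \<in> K \<Longrightarrow> T x = of_nat (J x) * e" by metis
  define \<zeta> where "\<zeta> = cis (2 * pi / p)"
  have \<zeta>p: "\<zeta> ^ p = 1" by (simp add: \<zeta>_def DeMoivre)
  define \<psi> where "\<psi> x = \<zeta> ^ J x" for x
  have "\<psi> (x + y) = \<psi> x * \<psi> y" if xy: "x \<in> K" "y \<in> K" for x y
  proof -
    have eq: "of_nat (J (x + y)) * e = of_nat (J x + J y) * e"
      using J(2)[OF corner_add[OF xy]] J(2)[OF xy(1)] J(2)[OF xy(2)] T_add[OF xy] by (simp add: algebra_simps)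
    have lt: "J x < p" "J y < p" "J (x + y) < p" using J(1) xy corner_add by blast+
    show ?thesis
    proof (cases "J x + J y < p")
      case True
      then show ?thesis using of_nat_e_inj[OF lt(3) True eq] by (simp add: \<psi>_def power_add)
    next
      case False
      then obtain z where z: "J x + J y = p + z" by (metis le_add_diff_inverse not_le)
      have "of_nat (J (x + y)) * e = of_nat z * e" using eq p_char unfolding z by (simp add: algebra_simps)
      hence "J (x + y) = z" using lt z by (intro of_nat_e_inj) auto
      moreover have "\<psi> x * \<psi> y = \<zeta> ^ (p + z)" by (simp only: \<psi>_def power_add[symmetric] z)
      ultimately show ?thesis by (simp add: \<psi>_def power_add \<zeta>p)
    qed
  qed
  moreover have "norm (\<psi> x) = 1" for x by (simp add: \<psi>_def \<zeta>_def norm_power)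
  moreover have "\<psi> x0 \<noteq> 1"
  proof -
    have Jx: "0 < J x0" "J x0 < p" using J[OF x0(1)] x0(2) by (auto intro!: gr0I)
    have "\<psi> x0 = cis (2 * pi * (J x0 / p))" by (simp add: \<psi>_def \<zeta>_def DeMoivre mult_ac)
    moreover have "cis (2 * pi * (J x0 / p)) \<noteq> 1"
    proof
      assume "cis (2 * pi * (J x0 / p)) = 1"
      hence "cos (2 * pi * (J x0 / p)) = 1" by (metis cis.sel(1) one_complex.sel(1))
      then obtain n where n: "2 * pi * (J x0 / p) = of_int n * 2 * pi" by (auto simp: cos_one_2pi_int)
      hence "(2 * pi) * (J x0 / p) = (2 * pi) * of_int n" by (simp only: mult_ac)
      hence "real (J x0) / real p = of_int n" by (subst (asm) mult_cancel_left) simp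
      hence "real (J x0) = real_of_int (n * int p)" using p_pos by (simp add: field_simps)
      hence "int (J x0) = n * int p" by linarith
      hence "int p dvd int (J x0)" by simp
      thus False using Jx by (auto dest: dvd_imp_le)
    qed
    ultimately show ?thesis by simp
  qed
  ultimately show ?thesis using x0(1) by (auto simp: add_char_def)
qed

lemma poly_char_sum_bound:
  assumes \<psi>: "add_char \<psi>" "\<exists>c\<in>K. \<psi> c \<noteq> 1" and H: "H \<in> KP" "coeff H 0 = 0" "H \<noteq> 0" "degree H \<le> D" "D < p"
  shows "norm (\<Sum>x\<in>K - {0}. \<psi> (poly H x)) \<le> D * sqrt q + 1"
proof -
  have "degree H > 0" using H(2,3) by (metis gr0I leading_coeff_0_iff)
  then interpret A: artin_schreier e p k H
    by unfold_locales (use H in auto)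
  have "norm (\<Sum>x\<in>K. \<psi> (poly H x)) \<le> real (degree H - 1) * sqrt q" by (rule A.weil_bound[OF \<psi>])
  also have "\<dots> \<le> D * sqrt q" using H(4) by (intro mult_right_mono) auto
  finally have 1: "norm (\<Sum>x\<in>K. \<psi> (poly H x)) \<le> D * sqrt q" .
  have "poly H 0 = 0" using H(2) by (simp add: poly_0_coeff_0)
  hence "(\<Sum>x\<in>K - {0}. \<psi> (poly H x)) = (\<Sum>x\<in>K. \<psi> (poly H x)) - 1"
    using K_fin add_char_0[OF \<psi>(1)] by (simp add: sum_diff1)
  thus ?thesis using 1 norm_triangle_ineq4[of "\<Sum>x\<in>K. \<psi> (poly H x)" 1] by simp
qed

section \<open>Eigenvalues of the Cayley graph\<close>

definition verts :: "nat \<Rightarrow> (nat \<Rightarrow> 'b) set" where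
  "verts n = {1..n} \<rightarrow>\<^sub>E K"

text \<open>The connection set of the Cayley graph: x = b 1 - a 1 and y = (b 2 - a 2) / x serve as
  parameters, so the second coordinate becomes x y and no division is left.\<close>

definition step :: "(nat \<Rightarrow> 'b poly) \<Rightarrow> (nat \<Rightarrow> 'b poly) \<Rightarrow> 'b \<Rightarrow> 'b \<Rightarrow> nat \<Rightarrow> 'b" where
  "step f g x y i = (if i = 1 then x else if i = 2 then x * y else poly (g i) x * poly (f i) y)"

definition shift :: "nat \<Rightarrow> (nat \<Rightarrow> 'b) \<Rightarrow> (nat \<Rightarrow> 'b) \<Rightarrow> nat \<Rightarrow> 'b" where
  "shift n a s = restrict (\<lambda>i. a i + s i) {1..n}"

definition adj :: "nat \<Rightarrow> (nat \<Rightarrow> 'b poly) \<Rightarrow> (nat \<Rightarrow> 'b poly) \<Rightarrow> (nat \<Rightarrow> 'b) \<Rightarrow> (nat \<Rightarrow> 'b) \<Rightarrow> bool" where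
  "adj n f g a b \<longleftrightarrow> (\<exists>x\<in>K - {0}. \<exists>y\<in>K. b = shift n a (step f g x y))"

definition vchar :: "('b \<Rightarrow> complex) \<Rightarrow> nat \<Rightarrow> (nat \<Rightarrow> 'b) \<Rightarrow> (nat \<Rightarrow> 'b) \<Rightarrow> complex" where
  "vchar \<psi> n w a = \<psi> (\<Sum>i=1..n. w i * a i)"

definition cayley_sum :: "('b \<Rightarrow> complex) \<Rightarrow> nat \<Rightarrow> (nat \<Rightarrow> 'b poly) \<Rightarrow> (nat \<Rightarrow> 'b poly) \<Rightarrow> (nat \<Rightarrow> 'b) \<Rightarrow> complex" where
  "cayley_sum \<psi> n f g w = (\<Sum>(x, y)\<in>(K - {0}) \<times> K. vchar \<psi> n w (step f g x y))"

lemma finite_verts: "finite (verts n)"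
  unfolding verts_def by (intro finite_PiE K_fin) auto

lemma verts_K: "a \<in> verts n \<Longrightarrow> i \<in> {1..n} \<Longrightarrow> a i \<in> K"
  by (auto simp: verts_def)

context
  fixes n :: nat and f g :: "nat \<Rightarrow> 'b poly" and \<psi> :: "'b \<Rightarrow> complex"
  assumes n2: "n \<ge> 2" and fg: "\<And>i. i \<in> {3..n} \<Longrightarrow> f i \<in> KP" "\<And>i. i \<in> {3..n} \<Longrightarrow> g i \<in> KP"
    and \<psi>: "add_char \<psi>" and \<psi>1: "\<exists>c\<in>K. \<psi> c \<noteq> 1"
begin

lemma step_K: "x \<in> K \<Longrightarrow> y \<in> K \<Longrightarrow> i \<in> {1..n} \<Longrightarrow> step f g x y i \<in> K"
  using fg by (auto simp: step_def intro!: corner_mult poly_K)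

lemma shift_verts:
  assumes "\<And>i. i \<in> {1..n} \<Longrightarrow> s i \<in> K" "a \<in> verts n"
  shows "shift n a s \<in> verts n"
  using assms by (auto simp: verts_def shift_def intro!: corner_add)

text \<open>Different pairs give different neighbours, because y can be recovered from x y as x is
  nonzero.\<close>

lemma sum_adj:
  fixes v :: "(nat \<Rightarrow> 'b) \<Rightarrow> 'd::semiring_1"
  assumes a: "a \<in> verts n"
  shows "(\<Sum>b\<in>verts n. (if adj n f g a b then 1 else 0) * v b)
       = (\<Sum>(x, y)\<in>(K - {0}) \<times> K. v (shift n a (step f g x y)))"
proof -
  let ?h = "\<lambda>(x, y). shift n a (step f g x y)"
  have inj: "inj_on ?h ((K - {0}) \<times> K)"
  proof (rule inj_onI)
    fix s t assume st: "s \<in> (K - {0}) \<times> K" "t \<in> (K - {0}) \<times> K" "?h s = ?h t"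
    obtain x y x' y' where xy: "s = (x, y)" "t = (x', y')" by (cases s, cases t)
    have eq: "step f g x y i = step f g x' y' i" if "i \<in> {1..n}" for i
      using fun_cong[OF st(3), of i] that by (simp add: xy shift_def)
    have x: "x = x'" using eq[of 1] n2 by (simp add: step_def)
    have "x * (y - y') = 0" using eq[of 2] n2 x by (simp add: step_def algebra_simps)
    hence "y = y'" using K_integral[of x "y - y'"] st(1,2) xy by (auto intro: corner_diff)
    thus "s = t" using x xy by simp
  qed
  have im: "{b \<in> verts n. adj n f g a b} = ?h ` ((K - {0}) \<times> K)"
    using shift_verts[OF step_K a] by (auto simp: adj_def)
  have "(\<Sum>b\<in>verts n. (if adj n f g a b then 1 else 0) * v b) = (\<Sum>b\<in>{b \<in> verts n. adj n f g a b}. v b)"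
    using finite_verts by (simp add: sum.inter_filter if_distrib[of "\<lambda>x. x * _"] cong: if_cong)
  also have "\<dots> = (\<Sum>s\<in>(K - {0}) \<times> K. v (?h s))" unfolding im using inj by (simp add: sum.reindex)
  finally show ?thesis by (simp add: split_beta)
qed

lemma dot_K: "w \<in> verts n \<Longrightarrow> (\<Sum>i=1..n. w i * s i) \<in> K"
  by (intro corner_sum corner_mult verts_K)

lemma vchar_shift:
  assumes w: "w \<in> verts n"
  shows "vchar \<psi> n w (shift n a s) = vchar \<psi> n w a * vchar \<psi> n w s"
proof -
  have "(\<Sum>i=1..n. w i * shift n a s i) = (\<Sum>i=1..n. w i * a i) + (\<Sum>i=1..n. w i * s i)"
    unfolding sum.distrib[symmetric] by (intro sum.cong) (auto simp: shift_def algebra_simps)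
  thus ?thesis unfolding vchar_def by (simp only: add_char_add[OF \<psi> dot_K[OF w] dot_K[OF w]])
qed

lemma vchar_norm: "w \<in> verts n \<Longrightarrow> norm (vchar \<psi> n w s) = 1"
  unfolding vchar_def by (intro add_char_norm[OF \<psi>] dot_K)

text \<open>Orthogonality: the frequencies are translated by a \<open>u\<close> supported at one
  coordinate where \<open>s\<close> is nonzero, chosen such that its pairing with \<open>s\<close>
  is an element on which \<psi> is not 1.\<close>

lemma sum_vchar_dual:
  assumes s: "\<And>i. i \<in> {1..n} \<Longrightarrow> s i \<in> K" and nz: "\<exists>i\<in>{1..n}. s i \<noteq> 0"
  shows "(\<Sum>w\<in>verts n. vchar \<psi> n w s) = 0"
proof -
  obtain i0 where i0: "i0 \<in> {1..n}" "s i0 \<noteq> 0" using nz by auto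
  obtain c where c: "c \<in> K" "\<psi> c \<noteq> 1" using \<psi>1 by auto
  obtain b where b: "b \<in> K" "s i0 * b = e" using K_inv[OF s[OF i0(1)] i0(2)] by blast
  define u where "u = restrict (\<lambda>i. if i = i0 then c * b else 0) {1..n}"
  have u: "u \<in> verts n" using c by (auto simp: u_def verts_def intro!: corner_mult)
  have "(\<Sum>i=1..n. u i * s i) = (\<Sum>i=1..n. if i = i0 then c * b * s i0 else 0)"
    by (intro sum.cong) (auto simp: u_def)
  also have "\<dots> = c * (s i0 * b)" using i0 by (simp add: ac_simps)
  finally have us: "vchar \<psi> n u s = \<psi> c" using b(2) K_eq(2)[OF c(1)] by (simp add: vchar_def)
  have sv: "shift n w u \<in> verts n" if "w \<in> verts n" for w
    using that verts_K[OF u] by (intro shift_verts)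
  have "(\<Sum>w\<in>verts n. vchar \<psi> n w s) = (\<Sum>w\<in>verts n. vchar \<psi> n (shift n w u) s)"
  proof (rule sum.reindex_bij_witness[of _ "\<lambda>w. shift n w u" "\<lambda>w. shift n w (\<lambda>i. - u i)"])
    fix w assume w: "w \<in> verts n"
    show "shift n w (\<lambda>i. - u i) \<in> verts n"
      using w verts_K[OF u] by (intro shift_verts corner_uminus)
    show "shift n w u \<in> verts n" by (rule sv[OF w])
    show "shift n (shift n w (\<lambda>i. - u i)) u = w" "shift n (shift n w u) (\<lambda>i. - u i) = w"
      using w by (auto simp: shift_def verts_def PiE_def extensional_def)
    then show "vchar \<psi> n (shift n (shift n w (\<lambda>i. - u i)) u) s = vchar \<psi> n w s" by simp
  qed
  also have "\<dots> = (\<Sum>w\<in>verts n. vchar \<psi> n w s * \<psi> c)"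
  proof (rule sum.cong[OF refl])
    fix w assume w: "w \<in> verts n"
    have "(\<Sum>i=1..n. shift n w u i * s i) = (\<Sum>i=1..n. w i * s i) + (\<Sum>i=1..n. u i * s i)"
      unfolding sum.distrib[symmetric] by (intro sum.cong) (auto simp: shift_def algebra_simps)
    thus "vchar \<psi> n (shift n w u) s = vchar \<psi> n w s * \<psi> c"
      unfolding us[symmetric] vchar_def by (simp only: add_char_add[OF \<psi> dot_K[OF w] dot_K[OF u]])
  qed
  also have "\<dots> = (\<Sum>w\<in>verts n. vchar \<psi> n w s) * \<psi> c" by (simp add: sum_distrib_right)
  finally show ?thesis using c(2) by (metis mult_cancel_left2)
qed

text \<open>The Fourier transform \<open>vh\<close> of an eigenvector diagonalises the adjacency
  operator, so \<open>mu\<close> equals the multiplier at any frequency where \<open>vh\<close> is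
  nonzero.\<close>

lemma eigenvalue_cayley_sum:
  fixes v :: "(nat \<Rightarrow> 'b) \<Rightarrow> real"
  assumes nz: "\<exists>a\<in>verts n. v a \<noteq> 0"
    and eig: "\<And>a. a \<in> verts n \<Longrightarrow> (\<Sum>b\<in>verts n. (if adj n f g a b then 1 else 0) * v b) = mu * v a"
  shows "\<exists>w\<in>verts n. of_real mu = cayley_sum \<psi> n f g w"
proof -
  define vh where "vh w = (\<Sum>a\<in>verts n. of_real (v a) * cnj (vchar \<psi> n w a))" for w
  have cc: "vchar \<psi> n w s * cnj (vchar \<psi> n w s) = 1" if "w \<in> verts n" for w s
    using vchar_norm[OF that] by (simp add: complex_norm_square[symmetric])
  have vh_eig: "of_real mu * vh w = cayley_sum \<psi> n f g w * vh w" if w: "w \<in> verts n" for w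
  proof -
    have "of_real mu * vh w = (\<Sum>a\<in>verts n. of_real (mu * v a) * cnj (vchar \<psi> n w a))"
      by (simp add: vh_def sum_distrib_left mult.assoc)
    also have "\<dots> = (\<Sum>a\<in>verts n. \<Sum>(x, y)\<in>(K - {0}) \<times> K.
                       of_real (v (shift n a (step f g x y))) * cnj (vchar \<psi> n w a))"
      by (intro sum.cong refl)
         (simp add: eig[symmetric] sum_adj split_beta sum_distrib_right)
    also have "\<dots> = (\<Sum>(x, y)\<in>(K - {0}) \<times> K. \<Sum>a\<in>verts n.
                       of_real (v (shift n a (step f g x y))) * cnj (vchar \<psi> n w a))"
      by (subst sum.swap) (simp add: split_beta)
    also have "\<dots> = (\<Sum>(x, y)\<in>(K - {0}) \<times> K. vchar \<psi> n w (step f g x y) * vh w)"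
    proof (rule sum.cong[OF refl])
      fix t assume "t \<in> (K - {0}) \<times> K"
      then obtain x y where t: "t = (x, y)" and xy: "x \<in> K" "y \<in> K" by auto
      define s where "s = step f g x y"
      have sK: "s i \<in> K" if "i \<in> {1..n}" for i using step_K[OF xy that] by (simp add: s_def)
      have "(\<Sum>a\<in>verts n. of_real (v (shift n a s)) * cnj (vchar \<psi> n w a))
          = (\<Sum>b\<in>verts n. vchar \<psi> n w s * (of_real (v b) * cnj (vchar \<psi> n w b)))"
      proof (rule sum.reindex_bij_witness[of _ "\<lambda>b. shift n b (\<lambda>i. - s i)" "\<lambda>a. shift n a s"])
        fix a assume a: "a \<in> verts n"
        show "shift n a s \<in> verts n" "shift n a (\<lambda>i. - s i) \<in> verts n"
          using a sK by (auto intro!: shift_verts corner_uminus)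
        show "shift n (shift n a s) (\<lambda>i. - s i) = a" "shift n (shift n a (\<lambda>i. - s i)) s = a"
          using a by (auto simp: shift_def verts_def PiE_def extensional_def)
        show "vchar \<psi> n w s * (of_real (v (shift n a s)) * cnj (vchar \<psi> n w (shift n a s)))
            = of_real (v (shift n a s)) * cnj (vchar \<psi> n w a)"
          using cc[OF w, of s] by (simp add: vchar_shift[OF w] mult.left_commute)
      qed
      thus "(case t of (x, y) \<Rightarrow> \<Sum>a\<in>verts n. of_real (v (shift n a (step f g x y))) * cnj (vchar \<psi> n w a))
          = (case t of (x, y) \<Rightarrow> vchar \<psi> n w (step f g x y) * vh w)"
        by (simp add: t s_def vh_def sum_distrib_left)
    qed
    also have "\<dots> = cayley_sum \<psi> n f g w * vh w"
      by (simp add: cayley_sum_def sum_distrib_right split_beta)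
    finally show ?thesis .
  qed
  \<comment> \<open>Fourier inversion at a vertex with \<open>v a\<close> nonzero: if all
    \<open>vh w\<close> vanished, so would \<open>v a\<close> times the number of vertices.\<close>
  have "\<exists>w\<in>verts n. vh w \<noteq> 0"
  proof (rule ccontr)
    assume "\<not> ?thesis"
    hence vh0: "vh w = 0" if "w \<in> verts n" for w using that by auto
    obtain a where a: "a \<in> verts n" "v a \<noteq> 0" using nz by auto
    have "0 = (\<Sum>w\<in>verts n. vh w * vchar \<psi> n w a)" using vh0 by simp
    also have "\<dots> = (\<Sum>b\<in>verts n. \<Sum>w\<in>verts n. of_real (v b) * cnj (vchar \<psi> n w b) * vchar \<psi> n w a)"
      unfolding vh_def sum_distrib_right by (rule sum.swap)
    also have "\<dots> = (\<Sum>b\<in>verts n. if b = a then of_real (v a) * of_nat (card (verts n)) else 0)"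
    proof (rule sum.cong[OF refl])
      fix b assume b: "b \<in> verts n"
      define s where "s i = a i - b i" for i
      have "cnj (vchar \<psi> n w b) * vchar \<psi> n w a = vchar \<psi> n w s" if w: "w \<in> verts n" for w
      proof -
        have "shift n b s = a" using a b by (auto simp: shift_def s_def verts_def PiE_def extensional_def)
        hence "vchar \<psi> n w a = vchar \<psi> n w b * vchar \<psi> n w s" using vchar_shift[OF w, of b s] by simp
        thus ?thesis using cc[OF w, of b] by (simp add: mult.assoc[symmetric] mult.commute)
      qed
      hence 1: "(\<Sum>w\<in>verts n. of_real (v b) * cnj (vchar \<psi> n w b) * vchar \<psi> n w a)
             = of_real (v b) * (\<Sum>w\<in>verts n. vchar \<psi> n w s)"
        by (simp add: sum_distrib_left mult.assoc)
      show "(\<Sum>w\<in>verts n. of_real (v b) * cnj (vchar \<psi> n w b) * vchar \<psi> n w a)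
          = (if b = a then of_real (v a) * of_nat (card (verts n)) else 0)"
      proof (cases "b = a")
        case True
        hence "vchar \<psi> n w s = 1" for w
          by (simp add: s_def vchar_def add_char_0[OF \<psi>])
        thus ?thesis unfolding 1 using True by simp
      next
        case False
        have "\<exists>i\<in>{1..n}. s i \<noteq> 0"
        proof (rule ccontr)
          assume "\<not> ?thesis"
          hence "b = a" using a b unfolding verts_def by (intro PiE_ext) (auto simp: s_def)
          thus False using False by simp
        qed
        moreover have "s i \<in> K" if "i \<in> {1..n}" for i
          using verts_K[OF a(1) that] verts_K[OF b that] by (simp add: s_def corner_diff)
        ultimately show ?thesis unfolding 1 using sum_vchar_dual[of s] False by simp
      qed
    qed
    also have "\<dots> = of_real (v a) * of_nat (card (verts n))" using a finite_verts by simp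
    finally have "card (verts n) = 0" using a(2) by simp
    thus False using a finite_verts by auto
  qed
  thus ?thesis using vh_eig by auto
qed

text \<open>The frequency (1, 0, ..., 0) sees only the first coordinate, so its multiplier is q
  times the sum of \<psi> over the nonzero elements, that is -q. As this is real, the real part of
  the character is an eigenvector, and it takes the value 1 at the origin.\<close>

lemma minus_q_eigenvector:
  obtains v :: "(nat \<Rightarrow> 'b) \<Rightarrow> real" where "\<exists>a\<in>verts n. v a \<noteq> 0"
    "\<And>a. a \<in> verts n \<Longrightarrow> (\<Sum>b\<in>verts n. (if adj n f g a b then 1 else 0) * v b) = - real q * v a"
proof -
  define w where "w = restrict (\<lambda>i. if i = 1 then e else 0) {1..n}"
  have w: "w \<in> verts n" by (auto simp: w_def verts_def)
  have ws: "vchar \<psi> n w (step f g x y) = \<psi> x" if "x \<in> K" for x y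
  proof -
    have "(\<Sum>i=1..n. w i * step f g x y i) = (\<Sum>i=1..n. if i = 1 then e * x else 0)"
      by (intro sum.cong) (auto simp: w_def step_def)
    thus ?thesis using n2 K_eq(1)[OF that] by (simp add: vchar_def)
  qed
  have s1: "(\<Sum>x\<in>K - {0}. \<psi> x) = - 1"
    using add_char_sum[OF \<psi> \<psi>1] K_fin add_char_0[OF \<psi>] by (simp add: sum_diff1)
  have L: "cayley_sum \<psi> n f g w = - of_nat q"
  proof -
    have "cayley_sum \<psi> n f g w = (\<Sum>(x, y)\<in>(K - {0}) \<times> K. \<psi> x)"
      unfolding cayley_sum_def by (intro sum.cong refl) (auto simp: ws)
    also have "\<dots> = (\<Sum>x\<in>K - {0}. \<Sum>y\<in>K. \<psi> x)" by (rule sum.cartesian_product[symmetric])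
    also have "\<dots> = - of_nat q" using s1 K_card by (simp add: sum_distrib_left[symmetric])
    finally show ?thesis .
  qed
  define v where "v a = Re (vchar \<psi> n w a)" for a
  show ?thesis
  proof (rule that[of v])
    have "v (restrict (\<lambda>_. 0) {1..n}) = 1"
      by (simp add: v_def vchar_def add_char_0[OF \<psi>])
    moreover have "restrict (\<lambda>_. 0) {1..n} \<in> verts n" by (auto simp: verts_def)
    ultimately show "\<exists>a\<in>verts n. v a \<noteq> 0" by (metis zero_neq_one)
    fix a assume a: "a \<in> verts n"
    have "(\<Sum>b\<in>verts n. (if adj n f g a b then 1 else 0) * v b)
        = Re (\<Sum>(x, y)\<in>(K - {0}) \<times> K. vchar \<psi> n w (shift n a (step f g x y)))"
      unfolding sum_adj[OF a] by (simp add: v_def split_beta)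
    also have "(\<Sum>(x, y)\<in>(K - {0}) \<times> K. vchar \<psi> n w (shift n a (step f g x y)))
        = vchar \<psi> n w a * cayley_sum \<psi> n f g w"
      by (simp add: vchar_shift[OF w] cayley_sum_def sum_distrib_left split_beta)
    also have "Re \<dots> = - real q * v a" unfolding L by (simp add: v_def)
    finally show "(\<Sum>b\<in>verts n. (if adj n f g a b then 1 else 0) * v b) = - real q * v a" .
  qed
qed

lemma cayley_sum_bound:
  assumes w: "w \<in> verts n" and g0: "\<And>i. i \<in> {3..n} \<Longrightarrow> coeff (g i) 0 = 0"
    and df: "\<And>i. i \<in> {3..n} \<Longrightarrow> degree (f i) \<le> df" "1 \<le> df"
    and dg: "\<And>i. i \<in> {3..n} \<Longrightarrow> degree (g i) \<le> dg" "1 \<le> dg" "dg < p"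
    and ne: "cayley_sum \<psi> n f g w \<noteq> of_nat q * (of_nat q - 1)"
  shows "norm (cayley_sum \<psi> n f g w) \<le> real df * real q + real q * (real dg * sqrt (real q) + 1)"
proof -
  define P where "P y = monom (w 1 + w 2 * y) 1 + (\<Sum>i=3..n. smult (w i * poly (f i) y) (g i))" for y
  have wK: "w i \<in> K" if "i \<in> {1..n}" for i using verts_K[OF w that] .
  have smK: "smult c u \<in> KP" if "u \<in> KP" for c u using corner_mult2[OF that, of "[:c:]"] by simp
  have PK: "P y \<in> KP" if "y \<in> K" for y
    unfolding P_def using n2 by (intro corner_add monom_KP corner_sum smK corner_mult wK fg) auto
  have P0: "coeff (P y) 0 = 0" for y
    by (simp add: P_def coeff_sum g0)
  have Pdeg: "degree (P y) \<le> dg" for y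
  proof -
    have "degree (\<Sum>i=3..n. smult (w i * poly (f i) y) (g i)) \<le> dg"
      by (intro degree_sum_le) (auto intro: order.trans[OF degree_smult_le dg(1)])
    moreover have "degree (monom (w 1 + w 2 * y) 1) \<le> dg"
      using degree_monom_le[of "w 1 + w 2 * y" 1] dg(2) by linarith
    ultimately show ?thesis unfolding P_def by (intro degree_add_le)
  qed
  have vP: "vchar \<psi> n w (step f g x y) = \<psi> (poly (P y) x)" for x y
  proof -
    have "{1..n} = insert 1 (insert 2 {3..n})" using n2 by auto
    hence "(\<Sum>i=1..n. w i * step f g x y i) = w 1 * x + (w 2 * (x * y) + (\<Sum>i=3..n. w i * (poly (g i) x * poly (f i) y)))"
      by (simp add: step_def)
    also have "\<dots> = poly (P y) x"
      by (simp add: P_def poly_monom poly_sum algebra_simps)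
    finally show ?thesis by (simp add: vchar_def)
  qed
  define I where "I y = (\<Sum>x\<in>K - {0}. \<psi> (poly (P y) x))" for y
  have L: "cayley_sum \<psi> n f g w = (\<Sum>y\<in>K. I y)"
    unfolding cayley_sum_def I_def vP sum.cartesian_product[symmetric] by (rule sum.swap)
  define Z where "Z = {y \<in> K. P y = 0}"
  have cK: "card (K - {0}) = q - 1" using K_fin K_card by (simp add: card_Diff_singleton)
  have I0: "I y = of_nat (q - 1)" if "y \<in> Z" for y
    using that cK by (simp add: I_def Z_def add_char_0[OF \<psi>])
  have "Z \<noteq> K"
  proof
    assume "Z = K"
    hence "cayley_sum \<psi> n f g w = of_nat q * of_nat (q - 1)" unfolding L using I0 K_card by simp
    also have "\<dots> = of_nat q * (of_nat q - 1)" using q_gt1 by (subst of_nat_diff) auto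
    finally show False using ne by simp
  qed
  then obtain y0 where y0: "y0 \<in> K" "P y0 \<noteq> 0" by (auto simp: Z_def)
  obtain j where j: "coeff (P y0) j \<noteq> 0" using y0(2) by (metis leading_coeff_0_iff)
  \<comment> \<open>The coefficient of X^j in P_y as a polynomial in y, for an index j at which some
    P_y does not vanish. It is zero at every y in \<open>Z\<close>; \<open>1 <= df\<close> makes
    room for the part w 1 + w 2 y.\<close>
  define H where "H = (if j = 1 then [:w 1, w 2:] else 0) + (\<Sum>i=3..n. smult (w i * coeff (g i) j) (f i))"
  have Hy: "poly H y = coeff (P y) j" for y
    by (auto simp: H_def P_def poly_sum coeff_sum coeff_monom mult_ac)
  have HK: "H \<in> KP"
    unfolding H_def using n2 by (intro corner_add corner_sum smK fg) (auto simp: pCons_KP intro!: wK)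
  have Hnz: "H \<noteq> 0" using Hy[of y0] j by auto
  have Hdeg: "degree H \<le> df"
  proof -
    have "degree (\<Sum>i=3..n. smult (w i * coeff (g i) j) (f i)) \<le> df"
      by (intro degree_sum_le) (auto intro: order.trans[OF degree_smult_le df(1)])
    moreover have "degree (if j = 1 then [:w 1, w 2:] else 0) \<le> df"
      using df(2) by (auto simp: degree_pCons_eq_if)
    ultimately show ?thesis unfolding H_def by (intro degree_add_le)
  qed
  have "card Z \<le> card {y \<in> K. poly H y = 0}"
    by (rule card_mono) (use K_fin Hy in \<open>auto simp: Z_def\<close>)
  hence cZ: "card Z \<le> df" using card_roots_le[OF HK Hnz] Hdeg by linarith
  have "norm (\<Sum>y\<in>K. I y) \<le> (\<Sum>y\<in>K. norm (I y))" by (rule norm_sum)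
  also have "\<dots> \<le> (\<Sum>y\<in>K. (if y \<in> Z then real q else 0) + (real dg * sqrt (real q) + 1))"
  proof (rule sum_mono)
    fix y assume y: "y \<in> K"
    have nn: "0 \<le> real dg * sqrt (real q) + 1" by (intro add_nonneg_nonneg mult_nonneg_nonneg) auto
    show "norm (I y) \<le> (if y \<in> Z then real q else 0) + (real dg * sqrt (real q) + 1)"
    proof (cases "y \<in> Z")
      case True
      have "norm (I y) = real (q - 1)" unfolding I0[OF True] by (rule norm_of_nat)
      also have "\<dots> \<le> real q" by (rule of_nat_mono) simp
      finally have "norm (I y) \<le> real q" .
      thus ?thesis using True nn by (simp only: if_True)
    next
      case False
      hence "P y \<noteq> 0" using y by (simp add: Z_def)
      thus ?thesis unfolding I_def
        using poly_char_sum_bound[OF \<psi> \<psi>1 PK[OF y] P0 _ Pdeg dg(3)] False by simp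
    qed
  qed
  also have "\<dots> = real (card Z) * real q + real q * (real dg * sqrt (real q) + 1)"
  proof -
    have "(\<Sum>y\<in>K. if y \<in> Z then real q else 0) = real (card Z) * real q"
      using K_fin by (simp add: sum.If_cases Z_def Int_def)
    thus ?thesis using K_card by (simp add: sum.distrib)
  qed
  also have "\<dots> \<le> real df * real q + real q * (real dg * sqrt (real q) + 1)"
    using cZ by (intro add_right_mono mult_right_mono) auto
  finally show ?thesis unfolding L .
qed

end

end

section \<open>Embedding a carrier-based field into a type-class ring\<close>

text \<open>The product of all commutative rings over the type \<open>'a\<close> is an instance of \<open>comm_ring_1\<close>; each
  of them is recovered as the corner cut out by an idempotent. The integer factor ensures
  \<open>0 \<noteq> 1\<close>.\<close>

typedef 'a cring_prod =
  "{f :: int \<times> ('a ring \<Rightarrow> 'a). \<forall>S. if cring S then snd f S \<in> carrier S else snd f S = undefined}"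
  by (rule exI[of _ "(0, \<lambda>S. if cring S then \<zero>\<^bsub>S\<^esub> else undefined)"]) (auto simp: cring.cring_simprules)

definition intp :: "'a cring_prod \<Rightarrow> int" where
  "intp x = fst (Rep_cring_prod x)"

definition component :: "'a ring \<Rightarrow> 'a cring_prod \<Rightarrow> 'a" where
  "component S x = snd (Rep_cring_prod x) S"

definition mk_cring_prod :: "int \<Rightarrow> ('a ring \<Rightarrow> 'a) \<Rightarrow> 'a cring_prod" where
  "mk_cring_prod n h = Abs_cring_prod (n, \<lambda>S. if cring S then h S else undefined)"

lemma component_carrier [simp]: "cring S \<Longrightarrow> component S x \<in> carrier S"
  using Rep_cring_prod[of x] unfolding component_def mem_Collect_eq by (auto split: if_splits)

lemma cring_prod_eqI:
  assumes "intp x = intp y" "\<And>S. cring S \<Longrightarrow> component S x = component S y"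
  shows "x = y"
proof -
  have "snd (Rep_cring_prod x) S = snd (Rep_cring_prod y) S" for S
    using assms(2)[of S] Rep_cring_prod[of x] Rep_cring_prod[of y]
    unfolding component_def mem_Collect_eq by (cases "cring S") metis+
  hence "Rep_cring_prod x = Rep_cring_prod y"
    using assms(1) by (intro prod_eqI ext) (auto simp: intp_def)
  thus ?thesis by (simp add: Rep_cring_prod_inject)
qed

lemma mk_cring_prod:
  assumes "\<And>S. cring S \<Longrightarrow> h S \<in> carrier S"
  shows "intp (mk_cring_prod n h) = n" "cring S \<Longrightarrow> component S (mk_cring_prod n h) = h S"
proof -
  have "Rep_cring_prod (mk_cring_prod n h) = (n, \<lambda>S. if cring S then h S else undefined)"
    unfolding mk_cring_prod_def by (rule Abs_cring_prod_inverse) (use assms in auto)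
  thus "intp (mk_cring_prod n h) = n" "cring S \<Longrightarrow> component S (mk_cring_prod n h) = h S"
    by (simp_all add: intp_def component_def)
qed

instantiation cring_prod :: (type) comm_ring_1
begin

definition "0 = mk_cring_prod 0 (\<lambda>S. \<zero>\<^bsub>S\<^esub>)"
definition "1 = mk_cring_prod 1 (\<lambda>S. \<one>\<^bsub>S\<^esub>)"
definition "x + y = mk_cring_prod (intp x + intp y) (\<lambda>S. component S x \<oplus>\<^bsub>S\<^esub> component S y)"
definition "- x = mk_cring_prod (- intp x) (\<lambda>S. \<ominus>\<^bsub>S\<^esub> component S x)"
definition "x - y = mk_cring_prod (intp x - intp y) (\<lambda>S. component S x \<ominus>\<^bsub>S\<^esub> component S y)"
definition "x * y = mk_cring_prod (intp x * intp y) (\<lambda>S. component S x \<otimes>\<^bsub>S\<^esub> component S y)"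

lemma component_simps [simp]:
  "cring S \<Longrightarrow> component S 0 = \<zero>\<^bsub>S\<^esub>" "cring S \<Longrightarrow> component S 1 = \<one>\<^bsub>S\<^esub>"
  "cring S \<Longrightarrow> component S (x + y) = component S x \<oplus>\<^bsub>S\<^esub> component S y"
  "cring S \<Longrightarrow> component S (- x) = \<ominus>\<^bsub>S\<^esub> component S x"
  "cring S \<Longrightarrow> component S (x - y) = component S x \<ominus>\<^bsub>S\<^esub> component S y"
  "cring S \<Longrightarrow> component S (x * y) = component S x \<otimes>\<^bsub>S\<^esub> component S y"
  unfolding zero_cring_prod_def one_cring_prod_def plus_cring_prod_def uminus_cring_prod_def
    minus_cring_prod_def times_cring_prod_def
  by (simp_all add: mk_cring_prod cring.cring_simprules)

lemma intp_simps [simp]: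
  "intp (0 :: 'a cring_prod) = 0" "intp (1 :: 'a cring_prod) = 1"
  "intp (x + y) = intp x + intp y" "intp (- x) = - intp x" "intp (x - y) = intp x - intp y"
  "intp (x * y) = intp x * intp y"
  unfolding zero_cring_prod_def one_cring_prod_def plus_cring_prod_def uminus_cring_prod_def
    minus_cring_prod_def times_cring_prod_def
  by (simp_all add: mk_cring_prod cring.cring_simprules)

instance
proof
  fix x y z :: "'a cring_prod"
  show "x + y + z = x + (y + z)" "x + y = y + x" "0 + x = x" "- x + x = 0" "x - y = x + - y"
    "x * y * z = x * (y * z)" "x * y = y * x" "1 * x = x" "(x + y) * z = x * z + y * z"
    by (rule cring_prod_eqI;
        simp add: cring.cring_simprules a_minus_def algebra_simps)+
  show "(0 :: 'a cring_prod) \<noteq> 1"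
  proof
    assume "(0 :: 'a cring_prod) = 1"
    hence "intp (0 :: 'a cring_prod) = intp (1 :: 'a cring_prod)" by simp
    thus False by simp
  qed
qed

end

text \<open>All other components and the integer factor are 0, so the image of the unit of
  \<open>R\<close> is an idempotent that cuts out \<open>R\<close>. The fallback for
  \<open>x\<close> outside the carrier keeps the value in the product.\<close>

definition emb :: "'a ring \<Rightarrow> 'a \<Rightarrow> 'a cring_prod" where
  "emb R x = mk_cring_prod 0 (\<lambda>S. if S = R \<and> x \<in> carrier R then x else \<zero>\<^bsub>S\<^esub>)"

lemma emb_simps [simp]:
  "intp (emb R x) = 0"
  "cring S \<Longrightarrow> component S (emb R x) = (if S = R \<and> x \<in> carrier R then x else \<zero>\<^bsub>S\<^esub>)"
  unfolding emb_def by (auto simp: mk_cring_prod cring.cring_simprules)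

lemma cring_zero_ops:
  assumes "cring S"
  shows "\<zero>\<^bsub>S\<^esub> \<oplus>\<^bsub>S\<^esub> \<zero>\<^bsub>S\<^esub> = \<zero>\<^bsub>S\<^esub>" "\<zero>\<^bsub>S\<^esub> \<otimes>\<^bsub>S\<^esub> \<zero>\<^bsub>S\<^esub> = \<zero>\<^bsub>S\<^esub>"
    "\<zero>\<^bsub>S\<^esub> \<ominus>\<^bsub>S\<^esub> \<zero>\<^bsub>S\<^esub> = \<zero>\<^bsub>S\<^esub>"
proof -
  interpret cring S by (rule assms)
  show "\<zero>\<^bsub>S\<^esub> \<oplus>\<^bsub>S\<^esub> \<zero>\<^bsub>S\<^esub> = \<zero>\<^bsub>S\<^esub>" "\<zero>\<^bsub>S\<^esub> \<otimes>\<^bsub>S\<^esub> \<zero>\<^bsub>S\<^esub> = \<zero>\<^bsub>S\<^esub>"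
    "\<zero>\<^bsub>S\<^esub> \<ominus>\<^bsub>S\<^esub> \<zero>\<^bsub>S\<^esub> = \<zero>\<^bsub>S\<^esub>" by simp_all
qed

locale plain_cring = cring R for R :: "'a ring" (structure)
begin

lemma emb_eqI:
  assumes "intp a = 0" "component R a = x" "x \<in> carrier R" "\<And>S. cring S \<Longrightarrow> S \<noteq> R \<Longrightarrow> component S a = \<zero>\<^bsub>S\<^esub>"
  shows "emb R x = a"
proof (rule cring_prod_eqI)
  fix S :: "'a ring" assume S: "cring S"
  show "component S (emb R x) = component S a"
    using assms(2,3) assms(4)[OF S] S by (cases "S = R") simp_all
qed (use assms in simp)

lemma emb_add: "x \<in> carrier R \<Longrightarrow> y \<in> carrier R \<Longrightarrow> emb R (x \<oplus> y) = emb R x + emb R y"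
  and emb_mult: "x \<in> carrier R \<Longrightarrow> y \<in> carrier R \<Longrightarrow> emb R (x \<otimes> y) = emb R x * emb R y"
  and emb_minus: "x \<in> carrier R \<Longrightarrow> y \<in> carrier R \<Longrightarrow> emb R (x \<ominus> y) = emb R x - emb R y"
  and emb_zero: "emb R \<zero> = 0"
  by (rule emb_eqI; simp add: is_cring cring_zero_ops)+

lemma emb_inj: "x \<in> carrier R \<Longrightarrow> y \<in> carrier R \<Longrightarrow> emb R x = emb R y \<longleftrightarrow> x = y"
proof -
  assume "x \<in> carrier R" "y \<in> carrier R"
  hence "component R (emb R x) = x" "component R (emb R y) = y" by (simp_all add: is_cring)
  thus ?thesis by metis
qed

lemma emb_corner: "corner (emb R \<one>) = emb R ` carrier R"
proof (intro equalityI subsetI)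
  fix a assume "a \<in> corner (emb R \<one>)"
  hence a: "emb R \<one> * a = a" by (rule corner_mult_id)
  have "a = emb R (component R a)"
  proof (rule cring_prod_eqI)
    show "intp a = intp (emb R (component R a))" using arg_cong[OF a, of intp] by simp
    fix S :: "'a ring" assume S: "cring S"
    show "component S a = component S (emb R (component R a))"
    proof (cases "S = R")
      case True
      then show ?thesis using S by simp
    next
      case False
      then show ?thesis using arg_cong[OF a, of "component S"] S by (simp add: cring.cring_simprules)
    qed
  qed
  thus "a \<in> emb R ` carrier R" using component_carrier[OF is_cring] by blast
next
  fix a assume "a \<in> emb R ` carrier R"
  then obtain x where x: "x \<in> carrier R" "a = emb R x" by auto
  have "emb R \<one> * emb R x = emb R x" using emb_mult[of \<one> x] x by simp
  thus "a \<in> corner (emb R \<one>)" using x by (simp add: corner_def)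
qed

text \<open>Coefficient lists begin with the leading coefficient, \<open>Poly\<close> begins with
  the constant one, hence \<open>rev\<close>. Powers of x are transported together with a
  coefficient, since the power of exponent 0 is the ambient \<open>1\<close> and not the embedded
  unit.\<close>

lemma emb_eval:
  assumes "set l \<subseteq> carrier R" "x \<in> carrier R"
  shows "emb R (eval l x) = poly (Poly (rev (map (emb R) l))) (emb R x)"
  using assms(1)
proof (induction l)
  case Nil
  then show ?case by (simp add: emb_zero)
next
  case (Cons c l)
  have pw: "emb R (c' \<otimes> x [^] n) = emb R c' * emb R x ^ n" if "c' \<in> carrier R" for c' and n :: nat
    using that assms(2)
  proof (induction n arbitrary: c')
    case (Suc n)
    have "c' \<otimes> x [^] Suc n = (c' \<otimes> x) \<otimes> x [^] n" using Suc.prems by (simp add: m_assoc m_comm)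
    thus ?case using Suc by (simp add: emb_mult mult.assoc)
  qed simp
  have "emb R (eval (c # l) x) = emb R c * emb R x ^ length l + emb R (eval l x)"
    using Cons.prems assms(2) by (simp add: emb_add pw eval_in_carrier)
  thus ?case using Cons by (simp add: Poly_append poly_monom mult.commute add.commute)
qed

end

definition emb_poly :: "'a ring \<Rightarrow> 'a list \<Rightarrow> 'a cring_prod poly" where
  "emb_poly R l = Poly (rev (map (emb R) l))"

lemma emb_poly_degree: "degree (emb_poly R l) \<le> length l - 1"
  unfolding emb_poly_def by (rule degree_le) (auto simp: nth_default_def)

text \<open>For the characteristic: translation by \<open>e\<close> permutes the corner, and
  comparing the sums of all elements gives p^k e = 0. If p e were nonzero it would be invertible,
  and then its k-th power could not vanish.\<close>

lemma field_component:
  fixes R :: "'a ring"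
  assumes R: "field R" and fin: "finite (carrier R)" and card: "card (carrier R) = p ^ k"
    and p: "prime p" and k: "k > 0"
  shows "finite_field_component (emb R \<one>\<^bsub>R\<^esub>) p k"
proof -
  interpret R: field R by (rule R)
  interpret R: plain_cring R by (rule plain_cring.intro) (rule R.is_cring)
  define e where "e = emb R \<one>\<^bsub>R\<^esub>"
  have c: "corner e = emb R ` carrier R" unfolding e_def by (rule R.emb_corner)
  have idem: "e * e = e" using R.emb_mult[of "\<one>\<^bsub>R\<^esub>" "\<one>\<^bsub>R\<^esub>"] by (simp add: e_def)
  have nz: "e \<noteq> 0" using R.emb_inj[of "\<one>\<^bsub>R\<^esub>" "\<zero>\<^bsub>R\<^esub>"] by (simp add: e_def R.emb_zero)
  have eK: "e \<in> corner e" using idem by (simp add: corner_def)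
  have finK: "finite (corner e)" using fin by (simp add: c)
  have cardK: "card (corner e) = p ^ k"
    unfolding c card[symmetric] by (rule card_image) (simp add: inj_on_def R.emb_inj)
  have inv: "\<exists>b\<in>corner e. a * b = e" if a: "a \<in> corner e" "a \<noteq> 0" for a
  proof -
    obtain x where x: "x \<in> carrier R" "a = emb R x" using a(1) by (auto simp: c)
    have "x \<noteq> \<zero>\<^bsub>R\<^esub>" using x a(2) by (auto simp: R.emb_zero)
    hence xu: "x \<in> Units R" using x R.field_Units by auto
    have "a * emb R (inv\<^bsub>R\<^esub> x) = emb R (x \<otimes>\<^bsub>R\<^esub> inv\<^bsub>R\<^esub> x)"
      unfolding x(2) using x(1) xu by (intro R.emb_mult[symmetric]) auto
    also have "\<dots> = e" using xu by (simp add: e_def)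
    finally show ?thesis using xu by (intro bexI[of _ "emb R (inv\<^bsub>R\<^esub> x)"]) (auto simp: c)
  qed
  have "(\<Sum>x\<in>corner e. x) = (\<Sum>x\<in>corner e. e + x)"
    by (rule sum.reindex_bij_witness[of _ "\<lambda>a. e + a" "\<lambda>a. a - e"])
       (auto intro: corner_add corner_diff eK)
  hence 0: "of_nat (p ^ k) * e = 0" using cardK by (simp add: sum.distrib)
  have char: "of_nat p * e = 0"
  proof (rule ccontr)
    assume "of_nat p * e \<noteq> 0"
    then obtain b where b: "of_nat p * e * b = e" using inv corner_mult2[OF eK] by blast
    have ek: "e ^ n = e" if "n > 0" for n
      using that
    proof (induction n)
      case (Suc n)
      then show ?case by (cases "n = 0") (simp_all add: idem)
    qed simp
    have "e = (of_nat p * e * b) ^ k" using b ek[OF k] by simp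
    also have "\<dots> = of_nat (p ^ k) * e * b ^ k" using ek[OF k] by (simp add: power_mult_distrib)
    finally show False using 0 nz by simp
  qed
  show ?thesis unfolding e_def[symmetric]
    by unfold_locales (use idem nz finK inv p char k cardK in auto)
qed

section \<open>Transport of the graph to the embedded field\<close>

lemma adj_eigenvalue_iso:
  assumes T: "bij_betw T V V'" and E: "\<And>a b. a \<in> V \<Longrightarrow> b \<in> V \<Longrightarrow> E a b \<longleftrightarrow> E' (T a) (T b)"
  shows "adj_eigenvalue V E mu \<longleftrightarrow> adj_eigenvalue V' E' mu"
proof
  assume "adj_eigenvalue V' E' mu"
  then obtain v where v: "\<exists>x\<in>V'. v x \<noteq> 0"
    "\<And>a. a \<in> V' \<Longrightarrow> (\<Sum>b\<in>V'. (if E' a b then 1 else 0) * v b) = mu * v a"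
    unfolding adj_eigenvalue_def by blast
  have im: "T ` V = V'" using T by (simp add: bij_betw_def)
  show "adj_eigenvalue V E mu"
    unfolding adj_eigenvalue_def
  proof (intro exI[of _ "v \<circ> T"] conjI ballI)
    show "\<exists>x\<in>V. (v \<circ> T) x \<noteq> 0" using v(1) im by auto
    fix a assume a: "a \<in> V"
    have "(\<Sum>b\<in>V. (if E a b then 1 else 0) * (v \<circ> T) b)
        = (\<Sum>b\<in>V. (if E' (T a) (T b) then 1 else 0) * v (T b))"
      using a E by (intro sum.cong) auto
    also have "\<dots> = (\<Sum>b\<in>V'. (if E' (T a) b then 1 else 0) * v b)"
      by (rule sum.reindex_bij_betw[OF T])
    finally show "(\<Sum>b\<in>V. (if E a b then 1 else 0) * (v \<circ> T) b) = mu * (v \<circ> T) a"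
      using v(2)[of "T a"] a im by auto
  qed
next
  assume "adj_eigenvalue V E mu"
  then obtain v where v: "\<exists>x\<in>V. v x \<noteq> 0"
    "\<And>a. a \<in> V \<Longrightarrow> (\<Sum>b\<in>V. (if E a b then 1 else 0) * v b) = mu * v a"
    unfolding adj_eigenvalue_def by blast
  define U where "U = inv_into V T"
  have U: "bij_betw U V' V" unfolding U_def using T by (rule bij_betw_inv_into)
  have UV: "U b \<in> V" "T (U b) = b" if "b \<in> V'" for b
    using that U T unfolding U_def by (auto simp: bij_betw_def f_inv_into_f inv_into_into)
  have TU: "U (T a) = a" if "a \<in> V" for a
    using that T unfolding U_def by (simp add: bij_betw_def)
  show "adj_eigenvalue V' E' mu"
    unfolding adj_eigenvalue_def
  proof (intro exI[of _ "v \<circ> U"] conjI ballI)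
    obtain x where "x \<in> V" "v x \<noteq> 0" using v(1) by auto
    thus "\<exists>x\<in>V'. (v \<circ> U) x \<noteq> 0" using TU T by (intro bexI[of _ "T x"]) (auto simp: bij_betw_def)
    fix a assume a: "a \<in> V'"
    have "(\<Sum>b\<in>V'. (if E' a b then 1 else 0) * (v \<circ> U) b)
        = (\<Sum>b\<in>V'. (if E (U a) (U b) then 1 else 0) * v (U b))"
      using a E UV by (intro sum.cong) auto
    also have "\<dots> = (\<Sum>b\<in>V. (if E (U a) b then 1 else 0) * v b)"
      by (rule sum.reindex_bij_betw[OF U])
    finally show "(\<Sum>b\<in>V'. (if E' a b then 1 else 0) * (v \<circ> U) b) = mu * (v \<circ> U) a"
      using v(2)[OF UV(1)[OF a]] by simp
  qed
qed

text \<open>Finiteness holds because each eigenvalue is one of the finitely many Cayley sums.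
  Together with the element \<open>- q\<close>, which excludes the empty set, it makes the maximum
  of \<open>M\<close> an element of \<open>M\<close>, to which the bound then applies.\<close>

lemma S_graph_eigenvalues:
  fixes R :: "'a ring" and f g :: "nat \<Rightarrow> 'a list"
  assumes R: "field R" and fin: "finite (carrier R)" and card: "card (carrier R) = p ^ k"
    and p: "prime p" and k: "k > 0" and n: "n \<ge> 3"
    and f: "\<And>i. i \<in> {3..n} \<Longrightarrow> set (f i) \<subseteq> carrier R" "\<And>i. i \<in> {3..n} \<Longrightarrow> length (f i) - 1 \<le> df"
    and g: "\<And>i. i \<in> {3..n} \<Longrightarrow> set (g i) \<subseteq> carrier R" "\<And>i. i \<in> {3..n} \<Longrightarrow> length (g i) - 1 \<le> dg"
    and g0: "\<And>i. i \<in> {3..n} \<Longrightarrow> ring.eval R (g i) \<zero>\<^bsub>R\<^esub> = \<zero>\<^bsub>R\<^esub>"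
    and df: "1 \<le> df" and dg: "1 \<le> dg" "dg < p"
  defines "q \<equiv> real (p ^ k)"
  defines "M \<equiv> {mu. adj_eigenvalue (S_vertices R n) (S_adj R n f g) mu \<and> mu \<noteq> q * (q - 1)}"
  shows "finite M" "- q \<in> M" "\<And>mu. mu \<in> M \<Longrightarrow> \<bar>mu\<bar> \<le> df * q + q * (dg * sqrt q + 1)"
proof -
  interpret R: field R by (rule R)
  interpret R: plain_cring R by (rule plain_cring.intro) (rule R.is_cring)
  define e where "e = emb R \<one>\<^bsub>R\<^esub>"
  interpret C: finite_field_component e p k
    unfolding e_def by (rule field_component[OF R fin card p k])
  let ?\<iota> = "emb R"
  have K: "corner e = ?\<iota> ` carrier R" unfolding e_def by (rule R.emb_corner)
  define f' g' where "f' i = emb_poly R (f i)" and "g' i = emb_poly R (g i)" for i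
  have KP: "emb_poly R l \<in> corner [:e:]" if "set l \<subseteq> carrier R" for l
    using that unfolding emb_poly_def corner_poly_iff coeff_Poly_eq K
    by (auto simp: nth_default_def R.emb_zero[symmetric] rev_nth subset_iff
        intro!: imageI)
  have fg': "f' i \<in> corner [:e:]" "g' i \<in> corner [:e:]" if "i \<in> {3..n}" for i
    unfolding f'_def g'_def using that f(1) g(1) by (auto intro!: KP)
  have ev: "?\<iota> (ring.eval R l x) = poly (emb_poly R l) (?\<iota> x)" if "set l \<subseteq> carrier R" "x \<in> carrier R" for l x
    unfolding emb_poly_def by (rule R.emb_eval[OF that])
  have g'0: "coeff (g' i) 0 = 0" if "i \<in> {3..n}" for i
    using ev[OF g(1)[OF that], of "\<zero>\<^bsub>R\<^esub>"] g0[OF that]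
    by (simp add: g'_def R.emb_zero poly_0_coeff_0)
  define T where "T a = restrict (\<lambda>i. ?\<iota> (a i)) {1..n}" for a :: "nat \<Rightarrow> 'a"
  have T: "bij_betw T (S_vertices R n) (C.verts n)"
    unfolding bij_betw_def
  proof
    show "inj_on T (S_vertices R n)"
    proof (rule inj_onI)
      fix a b assume ab: "a \<in> S_vertices R n" "b \<in> S_vertices R n" "T a = T b"
      have "a i = b i" if "i \<in> {1..n}" for i
        using fun_cong[OF ab(3), of i] that ab(1,2) R.emb_inj[of "a i" "b i"]
        by (auto simp: T_def S_vertices_def PiE_iff)
      thus "a = b" using ab(1,2) unfolding S_vertices_def by (intro PiE_ext)
    qed
    show "T ` S_vertices R n = C.verts n"
    proof (intro equalityI subsetI)
      fix b assume "b \<in> T ` S_vertices R n"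
      thus "b \<in> C.verts n" by (auto simp: T_def S_vertices_def C.verts_def K PiE_iff)
    next
      fix b assume b: "b \<in> C.verts n"
      define a where "a = restrict (\<lambda>i. inv_into (carrier R) ?\<iota> (b i)) {1..n}"
      have bi: "b i \<in> ?\<iota> ` carrier R" if "i \<in> {1..n}" for i
        using b that by (auto simp: C.verts_def K)
      have "a \<in> S_vertices R n" using bi by (auto simp: a_def S_vertices_def intro!: inv_into_into)
      moreover have "T a = b"
        using b bi by (auto simp: T_def a_def C.verts_def f_inv_into_f PiE_def extensional_def fun_eq_iff)
      ultimately show "b \<in> T ` S_vertices R n" by blast
    qed
  qed
  have E: "S_adj R n f g a b \<longleftrightarrow> C.adj n f' g' (T a) (T b)"
    if a: "a \<in> S_vertices R n" and b: "b \<in> S_vertices R n" for a b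
  proof -
    have ab: "a i \<in> carrier R" "b i \<in> carrier R" if "i \<in> {1..n}" for i
      using a b that by (auto simp: S_vertices_def)
    have ab12: "a 1 \<in> carrier R" "b 1 \<in> carrier R" "a 2 \<in> carrier R" "b 2 \<in> carrier R"
      using ab[of 1] ab[of 2] n by auto
    have minus_zero: "u \<ominus>\<^bsub>R\<^esub> v = \<zero>\<^bsub>R\<^esub> \<longleftrightarrow> u = v" if "u \<in> carrier R" "v \<in> carrier R" for u v
      using that by (metis R.r_right_minus_eq)
    show ?thesis
    proof
      assume adj: "S_adj R n f g a b"
      define x y where "x = b 1 \<ominus>\<^bsub>R\<^esub> a 1" and "y = (b 2 \<ominus>\<^bsub>R\<^esub> a 2) \<otimes>\<^bsub>R\<^esub> inv\<^bsub>R\<^esub> x"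
      have x: "x \<in> carrier R" "x \<noteq> \<zero>\<^bsub>R\<^esub>"
        using adj ab12 minus_zero[of "b 1" "a 1"] by (auto simp: x_def S_adj_def)
      hence xu: "x \<in> Units R" by (simp add: R.field_Units)
      have y: "y \<in> carrier R" using ab12 xu by (simp add: y_def)
      have xy: "x \<otimes>\<^bsub>R\<^esub> y = b 2 \<ominus>\<^bsub>R\<^esub> a 2"
      proof -
        have "x \<otimes>\<^bsub>R\<^esub> y = (b 2 \<ominus>\<^bsub>R\<^esub> a 2) \<otimes>\<^bsub>R\<^esub> (x \<otimes>\<^bsub>R\<^esub> inv\<^bsub>R\<^esub> x)"
          unfolding y_def by (rule R.m_lcomm) (use ab12 x(1) xu in auto)
        thus ?thesis using xu ab12 by simp
      qed
      have "T b = C.shift n (T a) (C.step f' g' (?\<iota> x) (?\<iota> y))"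
      proof (rule ext)
        fix i
        show "T b i = C.shift n (T a) (C.step f' g' (?\<iota> x) (?\<iota> y)) i"
        proof (cases "i \<in> {1..n}")
          case True
          have "?\<iota> (b i) - ?\<iota> (a i) = C.step f' g' (?\<iota> x) (?\<iota> y) i"
          proof -
            consider "i = 1" | "i = 2" | "i \<in> {3..n}" using True by fastforce
            thus ?thesis
            proof cases
              case 1
              then show ?thesis using ab12 by (simp add: C.step_def x_def R.emb_minus)
            next
              case 2
              then show ?thesis using R.emb_mult[OF x(1) y] xy ab12
                by (simp add: C.step_def R.emb_minus)
            next
              case 3
              have "b i \<ominus>\<^bsub>R\<^esub> a i = ring.eval R (g i) x \<otimes>\<^bsub>R\<^esub> ring.eval R (f i) y"
                using adj 3 unfolding S_adj_def x_def y_def by blast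
              hence "?\<iota> (b i \<ominus>\<^bsub>R\<^esub> a i) = ?\<iota> (ring.eval R (g i) x) * ?\<iota> (ring.eval R (f i) y)"
                using R.eval_in_carrier[OF g(1)[OF 3] x(1)] R.eval_in_carrier[OF f(1)[OF 3] y]
                by (simp add: R.emb_mult)
              thus ?thesis using 3 ab[OF True] ev[OF g(1)[OF 3] x(1)] ev[OF f(1)[OF 3] y]
                by (simp add: C.step_def R.emb_minus f'_def g'_def)
            qed
          qed
          thus ?thesis using True by (simp add: T_def C.shift_def algebra_simps)
        qed (auto simp: T_def C.shift_def)
      qed
      moreover have "?\<iota> x \<noteq> 0" using R.emb_inj[OF x(1), of "\<zero>\<^bsub>R\<^esub>"] x(2) by (simp add: R.emb_zero)
      ultimately show "C.adj n f' g' (T a) (T b)"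
        unfolding C.adj_def K using x(1) y by blast
    next
      assume "C.adj n f' g' (T a) (T b)"
      then obtain x' y' where xy': "x' \<in> ?\<iota> ` carrier R" "x' \<noteq> 0" "y' \<in> ?\<iota> ` carrier R"
        "T b = C.shift n (T a) (C.step f' g' x' y')" unfolding C.adj_def K by blast
      then obtain x y where xy: "x \<in> carrier R" "y \<in> carrier R" "x' = ?\<iota> x" "y' = ?\<iota> y" by auto
      have st: "?\<iota> (b i) - ?\<iota> (a i) = C.step f' g' (?\<iota> x) (?\<iota> y) i" if "i \<in> {1..n}" for i
        using fun_cong[OF xy'(4), of i] that by (simp add: T_def C.shift_def xy)
      have x0: "x \<noteq> \<zero>\<^bsub>R\<^esub>" using xy'(2) xy(3) by (auto simp: R.emb_zero)
      hence xu: "x \<in> Units R" using xy(1) by (simp add: R.field_Units)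
      have "?\<iota> (b 1 \<ominus>\<^bsub>R\<^esub> a 1) = ?\<iota> x" using st[of 1] n ab12 by (simp add: C.step_def R.emb_minus)
      hence x: "b 1 \<ominus>\<^bsub>R\<^esub> a 1 = x" using ab12 xy(1) by (simp add: R.emb_inj)
      have "?\<iota> (b 2 \<ominus>\<^bsub>R\<^esub> a 2) = ?\<iota> (x \<otimes>\<^bsub>R\<^esub> y)"
        using st[of 2] n ab12 xy by (simp add: C.step_def R.emb_minus R.emb_mult)
      hence "b 2 \<ominus>\<^bsub>R\<^esub> a 2 = x \<otimes>\<^bsub>R\<^esub> y" using ab12 xy by (simp add: R.emb_inj)
      hence y: "(b 2 \<ominus>\<^bsub>R\<^esub> a 2) \<otimes>\<^bsub>R\<^esub> inv\<^bsub>R\<^esub> x = y"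
        using xu xy by (simp add: R.m_comm[of x y] R.m_assoc)
      have "b i \<ominus>\<^bsub>R\<^esub> a i = ring.eval R (g i) x \<otimes>\<^bsub>R\<^esub> ring.eval R (f i) y" if i: "i \<in> {3..n}" for i
      proof -
        have in1: "i \<in> {1..n}" using i by auto
        have c: "ring.eval R (g i) x \<in> carrier R" "ring.eval R (f i) y \<in> carrier R"
          using R.eval_in_carrier[OF g(1)[OF i] xy(1)] R.eval_in_carrier[OF f(1)[OF i] xy(2)] by auto
        have "?\<iota> (b i \<ominus>\<^bsub>R\<^esub> a i) = ?\<iota> (ring.eval R (g i) x \<otimes>\<^bsub>R\<^esub> ring.eval R (f i) y)"
          using st[OF in1] i ab[OF in1] c ev[OF g(1)[OF i] xy(1)] ev[OF f(1)[OF i] xy(2)]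
          by (simp add: C.step_def R.emb_minus R.emb_mult f'_def g'_def)
        thus ?thesis using ab[OF in1] c by (simp add: R.emb_inj)
      qed
      moreover have "a 1 \<noteq> b 1" using x x0 ab12 minus_zero[of "b 1" "a 1"] by auto
      ultimately show "S_adj R n f g a b" unfolding S_adj_def x y by blast
    qed
  qed
  have iso: "adj_eigenvalue (S_vertices R n) (S_adj R n f g) mu
      \<longleftrightarrow> adj_eigenvalue (C.verts n) (C.adj n f' g') mu" for mu
    by (rule adj_eigenvalue_iso[OF T]) (rule E)
  obtain \<psi> where \<psi>: "C.add_char \<psi>" "\<exists>c\<in>corner e. \<psi> c \<noteq> 1" using C.exists_add_char by blast
  have n2: "n \<ge> 2" using n by simp
  note L = C.eigenvalue_cayley_sum[OF n2 fg' \<psi>] and B = C.cayley_sum_bound[OF n2 fg' \<psi>]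
  have ex: "\<exists>w\<in>C.verts n. of_real mu = C.cayley_sum \<psi> n f' g' w" if "mu \<in> M" for mu
  proof -
    have "adj_eigenvalue (C.verts n) (C.adj n f' g') mu" using that by (simp add: M_def iso)
    then obtain v :: "(nat \<Rightarrow> 'a cring_prod) \<Rightarrow> real" where v: "\<exists>x\<in>C.verts n. v x \<noteq> 0"
      "\<forall>a\<in>C.verts n. (\<Sum>b\<in>C.verts n. (if C.adj n f' g' a b then 1 else 0) * v b) = mu * v a"
      unfolding adj_eigenvalue_def by blast
    show ?thesis by (rule L[OF _ _ v(1)]) (use v(2) in auto)
  qed
  have "of_real ` M \<subseteq> C.cayley_sum \<psi> n f' g' ` C.verts n" using ex by auto
  hence "finite (complex_of_real ` M)" using C.finite_verts finite_subset by blast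
  thus "finite M" by (rule finite_imageD) (simp add: inj_on_def)
  have "q > 1" using C.q_gt1 by (simp add: q_def del: of_nat_power)
  hence "- q < 0" "q * (q - 1) > 0" by simp_all
  moreover have "adj_eigenvalue (C.verts n) (C.adj n f' g') (- q)"
    unfolding adj_eigenvalue_def q_def
    by (rule C.minus_q_eigenvector[OF n2 fg' \<psi>]) blast+
  ultimately show "- q \<in> M" by (simp add: M_def iso)
  fix mu assume mu: "mu \<in> M"
  then obtain w where w: "w \<in> C.verts n" "of_real mu = C.cayley_sum \<psi> n f' g' w" using ex by blast
  have deg: "degree (f' i) \<le> df" "degree (g' i) \<le> dg" if "i \<in> {3..n}" for i
    using emb_poly_degree[of R "f i"] emb_poly_degree[of R "g i"] f(2)[OF that] g(2)[OF that]
    by (simp_all add: f'_def g'_def)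
  have ne: "C.cayley_sum \<psi> n f' g' w \<noteq> of_nat (p ^ k) * (of_nat (p ^ k) - 1)"
  proof
    assume "C.cayley_sum \<psi> n f' g' w = of_nat (p ^ k) * (of_nat (p ^ k) - 1)"
    hence "complex_of_real mu = of_real (q * (q - 1))" using w(2) by (simp add: q_def)
    hence "mu = q * (q - 1)" by (simp only: of_real_eq_iff)
    thus False using mu by (simp add: M_def)
  qed
  have "norm (C.cayley_sum \<psi> n f' g' w) \<le> df * q + q * (dg * sqrt q + 1)"
    unfolding q_def by (rule B[OF _ _ w(1) g'0 deg(1) df deg(2) dg ne])
  thus "\<bar>mu\<bar> \<le> df * q + q * (dg * sqrt q + 1)" unfolding w(2)[symmetric] by simp
qed

text \<open>From here on \<open>degree\<close> refers to coefficient lists, as length minus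
  one.\<close>

hide_const (open) Polynomial.degree

theorem mainTheorem8:
  fixes R :: "nat \<Rightarrow> 'a ring"
    and k :: nat
    and q p e :: "nat \<Rightarrow> nat"
    and f g :: "nat \<Rightarrow> nat \<Rightarrow> 'a list"   \<comment> \<open>f i m = f_{i,m}\<close>
    and df dg :: "nat \<Rightarrow> nat"
    and lam :: "nat \<Rightarrow> real"
  assumes k3: "k \<ge> 3"
    and fields: "\<And>m. field (R m) \<and> finite (carrier (R m))"
    and q_card: "\<And>m. card (carrier (R m)) = q m"
    and q_pp: "\<And>m. prime (p m) \<and> e m \<ge> 1 \<and> q m = p m ^ e m"
    and q_incr: "strict_mono q"
    and f_poly: "\<And>m i. i \<in> {3..k} \<Longrightarrow>
         polynomial\<^bsub>R m\<^esub> (carrier (R m)) (f i m) \<and> degree (f i m) \<le> q m - 1"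
    and g_poly: "\<And>m i. i \<in> {3..k} \<Longrightarrow>
         polynomial\<^bsub>R m\<^esub> (carrier (R m)) (g i m) \<and> degree (g i m) \<le> q m - 1"
    and g_odd: "\<And>m i x. i \<in> {3..k} \<Longrightarrow> x \<in> carrier (R m) \<Longrightarrow>
         ring.eval (R m) (g i m) (\<ominus>\<^bsub>R m\<^esub> x) = \<ominus>\<^bsub>R m\<^esub> (ring.eval (R m) (g i m) x)"
    and g_zero: "\<And>m i. i \<in> {3..k} \<Longrightarrow> ring.eval (R m) (g i m) \<zero>\<^bsub>R m\<^esub> = \<zero>\<^bsub>R m\<^esub>"
    and df_def: "\<And>m. df m = Max ((\<lambda>i. degree (f i m)) ` {3..k})"
    and dg_def: "\<And>m. dg m = Max ((\<lambda>i. degree (g i m)) ` {3..k})"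
    and df_ge: "\<And>m. 1 \<le> df m"
    and df_o: "(\<lambda>m. real (df m) / real (q m)) \<longlonglongrightarrow> 0"
    and dg_o: "(\<lambda>m. real (dg m) / sqrt (real (q m))) \<longlonglongrightarrow> 0"
    and dg_bounds: "\<And>m. 1 \<le> dg m \<and> dg m < p m"
    and lam_def: "\<And>m. lam m = Max {mu. adj_eigenvalue (S_vertices (R m) k)
                          (S_adj (R m) k (\<lambda>i. f i m) (\<lambda>i. g i m)) mu
                        \<and> mu \<noteq> real (q m) * (real (q m) - 1)}"
  shows "(\<lambda>m. lam m / (real (q m))\<^sup>2) \<longlonglongrightarrow> 0"
proof -
  \<comment> \<open>Dividing the spectral bound by q^2 leaves exactly the two ratios assumed to tend
    to 0, plus 1/q from the excluded point x = 0.\<close>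
  have bound: "norm (lam m / (real (q m))\<^sup>2)
      \<le> real (df m) / real (q m) + real (dg m) / sqrt (real (q m)) + 1 / real (q m)" for m
  proof -
    let ?q = "real (q m)"
    let ?M = "{mu. adj_eigenvalue (S_vertices (R m) k) (S_adj (R m) k (\<lambda>i. f i m) (\<lambda>i. g i m)) mu
                 \<and> mu \<noteq> ?q * (?q - 1)}"
    have qm: "q m = p m ^ e m" "prime (p m)" "e m > 0" using q_pp[of m] by auto
    have q0: "?q > 0" using qm prime_gt_0_nat by simp
    have fdeg: "length (f i m) - 1 \<le> df m" and gdeg: "length (g i m) - 1 \<le> dg m" if "i \<in> {3..k}" for i
      unfolding df_def dg_def using that by (auto intro!: Max_ge)
    have fset: "set (f i m) \<subseteq> carrier (R m)" and gset: "set (g i m) \<subseteq> carrier (R m)" if "i \<in> {3..k}" for i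
      using f_poly[OF that, of m] g_poly[OF that, of m] by (auto simp: polynomial_def)
    have card: "card (carrier (R m)) = p m ^ e m" using q_card qm(1) by simp
    note S = S_graph_eigenvalues[where f = "\<lambda>i. f i m" and g = "\<lambda>i. g i m",
        OF conjunct1[OF fields] conjunct2[OF fields] card qm(2,3) k3 _ _ _ _ _
           df_ge conjunct1[OF dg_bounds] conjunct2[OF dg_bounds], folded qm(1)]
    have "finite ?M" by (rule S(1)) (erule fset fdeg gset gdeg g_zero)+
    moreover have "- ?q \<in> ?M" by (rule S(2)) (erule fset fdeg gset gdeg g_zero)+
    \<comment> \<open>As the maximum of a finite nonempty set, \<open>lam m\<close> is itself an
      eigenvalue, so the bound on absolute values covers both signs.\<close>
    ultimately have lam: "lam m \<in> ?M" unfolding lam_def by (intro Max_in) blast+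
    have "\<bar>lam m\<bar> \<le> df m * ?q + ?q * (dg m * sqrt ?q + 1)"
      by (rule S(3)[OF _ _ _ _ _ lam]) (erule fset fdeg gset gdeg g_zero)+
    hence "\<bar>lam m\<bar> / ?q\<^sup>2 \<le> (df m * ?q + ?q * (dg m * sqrt ?q + 1)) / ?q\<^sup>2"
      by (rule divide_right_mono) simp
    also have "\<dots> = df m / ?q + dg m * (sqrt ?q / ?q) + 1 / ?q"
      using q0 by (simp add: field_simps power2_eq_square)
    also have "sqrt ?q / ?q = 1 / sqrt ?q" using q0 by (simp add: real_div_sqrt field_simps)
    finally show ?thesis by (simp add: abs_divide)
  qed
  have "filterlim (\<lambda>m. real (q m)) at_top sequentially"
    using filterlim_compose[OF filterlim_real_sequentially filterlim_subseq[OF q_incr]] .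
  hence "(\<lambda>m. 1 / real (q m)) \<longlonglongrightarrow> 0"
    by (rule tendsto_divide_0[OF tendsto_const filterlim_at_top_imp_at_infinity])
  hence "(\<lambda>m. real (df m) / real (q m) + real (dg m) / sqrt (real (q m)) + 1 / real (q m)) \<longlonglongrightarrow> 0 + 0 + 0"
    by (intro tendsto_add df_o dg_o)
  hence "(\<lambda>m. norm (lam m / (real (q m))\<^sup>2)) \<longlonglongrightarrow> 0"
    by (intro tendsto_sandwich[OF _ always_eventually[OF allI[OF bound]] tendsto_const]) simp_all
  thus ?thesis by (rule tendsto_norm_zero_cancel)
qed

end
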